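(* Consider the random greedy triangle-packing process $G(0), G(1), \dots, G(M)$ on vertex set $[n]$, with the variables $Q, Y_u, Y_{u,v}, Y_{u,v,w}, R_{u,v}, T_u$ (functions of the step $i$) defined in the context. Set $$\gamma = \tfrac12, \qquad \hat\gamma = \hat\gamma(n) = \gamma - \frac{6}{\log n}, \qquad p = p(i,n) = 1 - \frac{6i}{n^2}, \qquad \Phi = \Phi(p,n) = e^{1-p}\log^2 n .$$ Then there exist absolute constants $\alpha,\beta,\kappa,\mu>0$ such that, with high probability, for every step $i\ge 0$ for which $$p = p(i,n) \ \ge\ p^\star = \Big(6\alpha^2 e^2\, \frac{\log^{10} n}{n}\Big)^{1/(4-2\hat\gamma)},$$ the process has not terminated before step $i$ (i.e. $i\le M$, so that $G(i)$ is defined) and the following estimates hold in $G(i)$ for all distinct vertices $u,v,w\in[n]$: \begin{align*} Q &= \frac{n^3p^3}{6} \pm \alpha^2 n^2 p^{2\hat\gamma-1}\Phi^2,\\ Y_{u,v} &= np^2 \pm \alpha n^{1/2}p^{\hat\gamma}\Phi,\\ R_{u,v} &= p\,Y_u Y_{u,v} \pm \beta n^{3/2}p^{2+\hat\gamma}\Phi,\\ Y_u &= np \pm \kappa n^{1/2}p^{\hat\gamma-1}\Phi,\\ T_u &= \frac{p\,Y_u^2}{2} \pm \mu n^{3/2}p^{1+\hat\gamma}\Phi,\\ Y_{u,v,w} &= np^3 \pm 2\sqrt{np^3\log^5 n}. \end{align*}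
   Context: The random greedy triangle-packing process: $G(0)$ is the complete graph on $[n]$; as long as $G(i)$ contains a triangle (a copy of $K_3$), $G(i+1)$ is obtained from $G(i)$ by removing the three edges of a triangle chosen uniformly at random from all triangles of $G(i)$. The process terminates at the first triangle-free graph $G(M)$. Let $E=E(i)$ denote the edge set of $G(i)$. For $u,v,w\in[n]$ and step $i$ define $N_u = \{x\in[n] : xu\in E(i)\}$, $N_{u,v} = N_u\cap N_v$, $N_{u,v,w} = N_u\cap N_v\cap N_w$, and - $Q = Q(i)$: the number of triangles in $G(i)$; - $Y_u = |N_u|$, $Y_{u,v} = |N_{u,v}|$, $Y_{u,v,w} = |N_{u,v,w}|$; - $R_{u,v} = \big|\{(x,y) : xy\in E(i),\ x\in N_{u,v},\ y\in N_u,\ y\ne v\}\big|$, counting ordered pairs (so edges inside $N_{u,v}$ are counted twice); - $T_u = \big|\{xy\in E(i) : x,y\in N_u\}\big|$, the number of (unordered) edges induced by $N_u$. Notation: $A = B\pm C$ means $A\in[B-C,B+C]$; $\log$ is the natural logarithm. An event (depending on $n$) holds with high probability if its probability tends to $1$ as $n\to\infty$; here the event is that all the estimates hold simultaneously for all vertices and all steps in the stated range. *)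

theory Defs
  imports "HOL-Probability.Probability"
begin

text \<open>
  A simple graph is represented by its edge set, whose members are two-element sets of
  vertices; the vertex set is \<open>{1..n}\<close>. A triangle is represented by its three-element
  vertex set.
\<close>

definition pairs :: "'a set \<Rightarrow> 'a set set" where
  "pairs V = {e. e \<subseteq> V \<and> card e = 2}"

definition triangles :: "'a set set \<Rightarrow> 'a set set" where
  "triangles E = {t. card t = 3 \<and> pairs t \<subseteq> E}"

lemma pairs_nonempty_if_card_3:
  assumes "card t = 3"
  shows "pairs t \<noteq> {}"
proof -
  have "2 \<le> card t" using assms by simp
  then obtain e where "e \<subseteq> t" "card e = 2"
    by (rule obtain_subset_with_card_n)
  then show ?thesis unfolding pairs_def by blast
qed

lemma finite_triangles:
  assumes "finite E"
  shows "finite (triangles E)"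
proof -
  have "t \<subseteq> \<Union>(Set.filter finite E)" if t: "card t = 3" "pairs t \<subseteq> E" for t
  proof
    fix x assume x: "x \<in> t"
    then have "card (t - {x}) = 2" using t(1) by simp
    then have "t - {x} \<noteq> {}" by force
    then obtain y where "y \<in> t" "y \<noteq> x" by blast
    then have "{x, y} \<in> pairs t" using x by (auto simp: pairs_def card_insert_if)
    then have "{x, y} \<in> Set.filter finite E" using t(2) by auto
    then show "x \<in> \<Union>(Set.filter finite E)" by blast
  qed
  then have "triangles E \<subseteq> Pow (\<Union>(Set.filter finite E))"
    by (auto simp: triangles_def)
  moreover have "finite (\<Union>(Set.filter finite E))" using assms by auto
  ultimately show ?thesis by (meson finite_Pow_iff finite_subset)
qed

text \<open>
  The law of the trajectory \<open>[G(0), G(1), \<dots>, G(M)]\<close> of the random greedy process started from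
  the graph \<open>E = G(0)\<close>. The list has length \<open>M + 1\<close>, so \<open>G(i)\<close> is defined iff \<open>i\<close> is
  smaller than the length of the list. The test \<open>finite E\<close> only serves termination.
\<close>

function greedy_process :: "'a set set \<Rightarrow> 'a set set list pmf" where
  "greedy_process E =
     (if finite E \<and> triangles E \<noteq> {}
      then bind_pmf (pmf_of_set (triangles E))
             (\<lambda>t. map_pmf (\<lambda>Gs. E # Gs) (greedy_process (E - pairs t)))
      else return_pmf [E])"
  by pat_completeness auto
termination
proof (relation "Wellfounded.measure card")
  fix E :: "'a set set" and t
  assume E: "finite E \<and> triangles E \<noteq> {}"
    and "t \<in> set_pmf (pmf_of_set (triangles E))"
  then have t: "t \<in> triangles E" by (simp add: finite_triangles)
  then have "pairs t \<noteq> {}" "pairs t \<subseteq> E"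
    by (auto simp: triangles_def dest: pairs_nonempty_if_card_3)
  then have "E - pairs t \<subset> E" by blast
  then show "(E - pairs t, E) \<in> Wellfounded.measure card" using E by (simp add: psubset_card_mono)
qed simp

declare greedy_process.simps [simp del]

definition triangle_packing_process :: "nat \<Rightarrow> nat set set list pmf" where
  "triangle_packing_process n = greedy_process (pairs {1..n})"

text \<open>
  All edges of \<open>G(i)\<close> lie inside \<open>{1..n}\<close>, so the neighbourhoods below need no explicit
  restriction to the vertex set.
\<close>

definition nbrs :: "'a set set \<Rightarrow> 'a \<Rightarrow> 'a set" where
  "nbrs E u = {x. {x, u} \<in> E}"

definition Q_var :: "'a set set \<Rightarrow> nat" where
  "Q_var E = card (triangles E)"

definition Y1_var :: "'a set set \<Rightarrow> 'a \<Rightarrow> nat" where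
  "Y1_var E u = card (nbrs E u)"

definition Y2_var :: "'a set set \<Rightarrow> 'a \<Rightarrow> 'a \<Rightarrow> nat" where
  "Y2_var E u v = card (nbrs E u \<inter> nbrs E v)"

definition Y3_var :: "'a set set \<Rightarrow> 'a \<Rightarrow> 'a \<Rightarrow> 'a \<Rightarrow> nat" where
  "Y3_var E u v w = card (nbrs E u \<inter> nbrs E v \<inter> nbrs E w)"

definition R_var :: "'a set set \<Rightarrow> 'a \<Rightarrow> 'a \<Rightarrow> nat" where
  "R_var E u v =
     card {(x, y). {x, y} \<in> E \<and> x \<in> nbrs E u \<inter> nbrs E v \<and> y \<in> nbrs E u \<and> y \<noteq> v}"

definition T_var :: "'a set set \<Rightarrow> 'a \<Rightarrow> nat" where
  "T_var E u = card {e \<in> E. e \<subseteq> nbrs E u}"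

definition gam :: real where
  "gam = 1 / 2"

definition gam_hat :: "nat \<Rightarrow> real" where
  "gam_hat n = gam - 6 / ln (real n)"

definition dens :: "nat \<Rightarrow> nat \<Rightarrow> real" where
  "dens n i = 1 - 6 * real i / (real n)^2"

definition Phi :: "nat \<Rightarrow> real \<Rightarrow> real" where
  "Phi n p = exp (1 - p) * (ln (real n))^2"

definition pstar :: "real \<Rightarrow> nat \<Rightarrow> real" where
  "pstar \<alpha> n =
     (6 * \<alpha>^2 * (exp 1)^2 * ((ln (real n))^10 / real n)) powr (1 / (4 - 2 * gam_hat n))"

abbreviation pm_interval :: "real \<Rightarrow> real \<Rightarrow> real set" (infix "\<plusminus>" 60) where
  "B \<plusminus> C \<equiv> {B - C..B + C}"

definition estimates ::
    "real \<Rightarrow> real \<Rightarrow> real \<Rightarrow> real \<Rightarrow> nat \<Rightarrow> real \<Rightarrow> nat set set \<Rightarrow> bool" where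
  "estimates \<alpha> \<beta> \<kappa> \<mu> n p E \<longleftrightarrow>
     (\<forall>u\<in>{1..n}. \<forall>v\<in>{1..n}. \<forall>w\<in>{1..n}. u \<noteq> v \<and> u \<noteq> w \<and> v \<noteq> w \<longrightarrow>
        real (Q_var E) \<in> (real n)^3 * p^3 / 6
          \<plusminus> \<alpha>^2 * (real n)^2 * p powr (2 * gam_hat n - 1) * (Phi n p)^2 \<and>
        real (Y2_var E u v) \<in> real n * p^2
          \<plusminus> \<alpha> * real n powr (1/2) * p powr gam_hat n * Phi n p \<and>
        real (R_var E u v) \<in> p * real (Y1_var E u) * real (Y2_var E u v)
          \<plusminus> \<beta> * real n powr (3/2) * p powr (2 + gam_hat n) * Phi n p \<and>
        real (Y1_var E u) \<in> real n * p
          \<plusminus> \<kappa> * real n powr (1/2) * p powr (gam_hat n - 1) * Phi n p \<and>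
        real (T_var E u) \<in> p * (real (Y1_var E u))^2 / 2
          \<plusminus> \<mu> * real n powr (3/2) * p powr (1 + gam_hat n) * Phi n p \<and>
        real (Y3_var E u v w) \<in> real n * p^3
          \<plusminus> 2 * sqrt (real n * p^3 * (ln (real n))^5))"

end

theory Submission
  imports Defs
begin

text \<open>
  Divide every count by its predicted value, a structure with \<open>k\<close> edges being compared with a
  multiple of \<open>p ^ k\<close>. As \<open>ln p\<close> decreases by one unit, such a ratio decreases, to first
  order, by the relative codegree errors summed over the edges of the structure and averaged over
  its copies. In differences of two ratios the common averages cancel. Let \<open>V\<^sub>u\<close> count the copies
  of \<open>K\<^sub>4\<close> minus an edge in which \<open>u\<close> is an end of the missing edge, let \<open>y\<close>, \<open>d\<close> be the relative
  errors of \<open>Y\<^sub>u\<^sub>v\<close>, \<open>Y\<^sub>u\<close>, and let \<open>e\<close>, \<open>q\<close>, \<open>f\<close> be the differences of the ratios of \<open>T\<^sub>u\<close> and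
  \<open>Y\<^sub>u\<close>, of \<open>V\<^sub>u\<close> and \<open>T\<^sub>u\<close>, and of \<open>R\<^sub>u\<^sub>v\<close> and \<open>Y\<^sub>u\<^sub>v\<close>. Then, up to second-order terms,
    \<open>d' = - e\<close>, \<open>e' = - (e + q)\<close>, \<open>q' = - 2 avg e\<close>,
    \<open>f' = - (e + avg y)\<close>, \<open>y' = - (f\<^sub>u\<^sub>v + f\<^sub>v\<^sub>u)\<close>.
  Measured in units of \<open>\<epsilon> = (ln n)\<^sup>2 / sqrt (n p\<^sup>3)\<close>, which grows like \<open>p\<close> to the power \<open>-3/2\<close>,
  the bounds 1, 1, 2, 44/5, 12 for \<open>d, e, q, f, y\<close> are each strictly larger than what they
  generate: for instance \<open>2 * 44/5 < 3/2 * 12\<close> and \<open>1 + 12 < 3/2 * 44/5\<close>. It is the tracking of \<open>V\<^sub>u\<close>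
  that makes the system for \<open>d, e, q\<close> independent of \<open>y\<close>; with only \<open>|q| \<le> sup |y|\<close> the exponent
  \<open>3/2\<close> would be out of reach. The slack absorbs the second-order terms and the random
  fluctuations, the latter by an exponential supermartingale for each statistic, sign and time.
\<close>

subsection \<open>Exponential supermartingales along the process\<close>

text \<open>The drift of each count is under control only while all counts are within their bounds,
  so the argument has to stop at the first violation. Stopping is done by backward induction along
  the recursion of \<open>greedy_process\<close>: a function of time and graph that is nonnegative,
  at least 1 at a violation and otherwise does not rise on average bounds the failure probability.

  Two more counts are tracked for the sake of second-order terms. The number of triangles is the
  denominator of all transition probabilities, so it is needed up to relative error
  \<open>eps^2\<close>. Triple codegrees enter the drifts of \<open>R\<close> and \<open>V\<close>
  only as weights of first-order errors, so order \<open>eps\<close> suffices, and the bound on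
  single codegree errors already gives it.

  A drift of rate \<open>mu\<close> per unit of \<open>- ln p\<close> under an envelope growing at
  rate \<open>s\<close> accumulates to \<open>mu / s\<close> envelopes; the numerical bounds come
  from these quotients. The error terms of the theorem follow since, for \<open>p \<le> 1\<close>,
  \<open>p\<close> to the power 1/2 is at most \<open>p\<close> to the power
  \<open>gam_hat n\<close>, and \<open>(ln n)^2\<close> is at most \<open>Phi n p\<close>.\<close>

lemma prob_bind_pmf_of_set:
  assumes "finite S" "S \<noteq> {}"
  shows "measure_pmf.prob (bind_pmf (pmf_of_set S) f) A
    = (\<Sum>t\<in>S. measure_pmf.prob (f t) A) / real (card S)"
proof -
  have "ennreal (measure_pmf.prob (bind_pmf (pmf_of_set S) f) A)
      = emeasure (measure_pmf (bind_pmf (pmf_of_set S) f)) A"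
    by (simp add: measure_pmf.emeasure_eq_measure)
  also have "\<dots> = (\<Sum>t\<in>S. emeasure (measure_pmf (f t)) A) / ennreal (real (card S))"
    using assms by (simp add: nn_integral_pmf_of_set ennreal_of_nat_eq_real_of_nat)
  also have "\<dots> = ennreal (\<Sum>t\<in>S. measure_pmf.prob (f t) A) / ennreal (real (card S))"
    by (simp add: measure_pmf.emeasure_eq_measure)
  also have "\<dots> = ennreal ((\<Sum>t\<in>S. measure_pmf.prob (f t) A) / real (card S))"
    using assms by (intro divide_ennreal) (auto simp: sum_nonneg card_gt_0_iff)
  finally show ?thesis
    by (subst (asm) ennreal_inj) (auto intro!: divide_nonneg_nonneg sum_nonneg)
qed

text \<open>Optional stopping without stopping times, by induction on the number of remaining steps.
  Early termination counts as failure through \<open>j < length Gs\<close>; \<open>tri\<close>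
  excludes it as long as the graph is good. The offset \<open>i\<close> allows a restart at an
  intermediate graph.\<close>

lemma greedy_process_failure:
  fixes Good :: "nat \<Rightarrow> 'a set set \<Rightarrow> bool" and U :: "nat \<Rightarrow> 'a set set \<Rightarrow> real"
  assumes fin: "\<And>i E. Inv i E \<Longrightarrow> finite E"
    and step: "\<And>i E t. Inv i E \<Longrightarrow> Good i E \<Longrightarrow> i < m \<Longrightarrow> t \<in> triangles E
      \<Longrightarrow> Inv (Suc i) (E - pairs t)"
    and tri: "\<And>i E. Inv i E \<Longrightarrow> Good i E \<Longrightarrow> i < m \<Longrightarrow> triangles E \<noteq> {}"
    and nonneg: "\<And>i E. 0 \<le> U i E"
    and bad: "\<And>i E. Inv i E \<Longrightarrow> i \<le> m \<Longrightarrow> \<not> Good i E \<Longrightarrow> 1 \<le> U i E"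
    and super: "\<And>i E. Inv i E \<Longrightarrow> Good i E \<Longrightarrow> i < m \<Longrightarrow>
      (\<Sum>t\<in>triangles E. U (Suc i) (E - pairs t)) \<le> real (card (triangles E)) * U i E"
  shows "Inv i E \<Longrightarrow> i \<le> m \<Longrightarrow>
    measure_pmf.prob (greedy_process E)
      {Gs. \<exists>j. i + j \<le> m \<and> \<not> (j < length Gs \<and> Good (i + j) (Gs ! j))} \<le> U i E"
proof (induction "m - i" arbitrary: i E)
  case 0
  then have im: "i = m" by simp
  show ?case
  proof (cases "Good i E")
    case False
    then show ?thesis using bad[OF 0(2,3)] measure_pmf.prob_le_1 order_trans by blast
  next
    case True
    have "measure_pmf.prob (greedy_process E)
      {Gs. \<exists>j. i + j \<le> m \<and> \<not> (j < length Gs \<and> Good (i + j) (Gs ! j))} = 0"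
    proof -
      have "\<exists>Hs. Gs = E # Hs" if "Gs \<in> set_pmf (greedy_process E)" for Gs
        using that by (subst (asm) greedy_process.simps) (auto split: if_splits)
      then show ?thesis
        using True im unfolding measure_pmf_zero_iff by fastforce
    qed
    then show ?thesis using nonneg by simp
  qed
next
  case (Suc k)
  then have im: "i < m" by simp
  show ?case
  proof (cases "Good i E")
    case False
    then show ?thesis using bad[OF Suc(3,4)] measure_pmf.prob_le_1 order_trans by blast
  next
    case True
    let ?B = "\<lambda>i. {Gs. \<exists>j. i + j \<le> m \<and> \<not> (j < length Gs \<and> Good (i + j) (Gs ! j))}"
    have fE: "finite E" and ne: "triangles E \<noteq> {}"
      using fin tri Suc(3) True im by blast+
    have ft: "finite (triangles E)" using fE by (rule finite_triangles)
    \<comment> \<open>A good present graph cannot witness the failure, so the witness lies in the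
      tail and its index drops by one.\<close>
    have vim: "((#) E) -` ?B i \<subseteq> ?B (Suc i)"
    proof
      fix Gs assume "Gs \<in> ((#) E) -` ?B i"
      then obtain j where a: "i + j \<le> m" "\<not> (j < length (E # Gs) \<and> Good (i + j) ((E # Gs) ! j))"
        by blast
      with True obtain j' where "j = Suc j'" by (cases j) auto
      with a have "\<exists>j. Suc i + j \<le> m \<and> \<not> (j < length Gs \<and> Good (Suc i + j) (Gs ! j))"
        by auto
      then show "Gs \<in> ?B (Suc i)" by blast
    qed
    have "measure_pmf.prob (greedy_process E) (?B i)
      = (\<Sum>t\<in>triangles E. measure_pmf.prob (greedy_process (E - pairs t)) (((#) E) -` ?B i))
          / real (card (triangles E))"
      by (subst greedy_process.simps) (simp add: fE ne ft prob_bind_pmf_of_set)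
    also have "\<dots> \<le> (\<Sum>t\<in>triangles E. U (Suc i) (E - pairs t)) / real (card (triangles E))"
    proof (intro divide_right_mono sum_mono)
      fix t assume t: "t \<in> triangles E"
      have "measure_pmf.prob (greedy_process (E - pairs t)) (((#) E) -` ?B i)
          \<le> measure_pmf.prob (greedy_process (E - pairs t)) (?B (Suc i))"
        using vim by (intro measure_pmf.finite_measure_mono) auto
      also have "\<dots> \<le> U (Suc i) (E - pairs t)"
        using Suc(2) im step[OF Suc(3) True im t] by (intro Suc(1)) auto
      finally show "measure_pmf.prob (greedy_process (E - pairs t)) (((#) E) -` ?B i)
          \<le> U (Suc i) (E - pairs t)" .
    qed simp
    also have "\<dots> \<le> U i E"
      using super[OF Suc(3) True im] ft ne
      by (simp add: divide_le_eq card_gt_0_iff mult.commute)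
    finally show ?thesis .
  qed
qed

section \<open>Exponential moments and accumulated drift\<close>

text \<open>For negative \<open>x\<close>, \<open>exp x\<close> is at most
  \<open>1 / (1 - x)\<close>, and \<open>(1 - x) (1 + x + x^2) = 1 - x^3\<close> is at least
  1.\<close>

lemma exp_le_quadratic:
  fixes x :: real
  assumes "\<bar>x\<bar> \<le> 1"
  shows "exp x \<le> 1 + x + x\<^sup>2"
proof (cases "0 \<le> x")
  case True
  then show ?thesis using assms exp_bound[of x] by simp
next
  case False
  have "(1 - x) * exp x \<le> exp (- x) * exp x"
    using exp_ge_add_one_self[of "- x"] by (intro mult_right_mono) auto
  also have "\<dots> = 1" by (simp add: exp_minus)
  also have "\<dots> \<le> (1 - x) * (1 + x + x\<^sup>2)"
  proof -
    have "(1 - x) * (1 + x + x\<^sup>2) = 1 + (- x) * x\<^sup>2"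
      by (simp add: algebra_simps power2_eq_square)
    then show ?thesis using False by (simp add: mult_nonpos_nonneg)
  qed
  finally show ?thesis using False by simp
qed

text \<open>One step of a Freedman-type bound, with sums over \<open>S\<close> in place of
  expectations: the quadratic bound on \<open>exp\<close> gives
  \<open>1 + \<theta> (a + \<theta> v)\<close>, which is again at most an exponential.\<close>

lemma sum_exp_le:
  fixes X :: "'t \<Rightarrow> real"
  assumes "finite S" and X: "\<And>t. t \<in> S \<Longrightarrow> \<bar>X t\<bar> \<le> c" and c: "\<theta> * c \<le> 1" and \<theta>: "0 \<le> \<theta>"
    and m: "sum X S \<le> real (card S) * a" and v: "(\<Sum>t\<in>S. (X t)\<^sup>2) \<le> real (card S) * v"
  shows "(\<Sum>t\<in>S. exp (\<theta> * X t)) \<le> real (card S) * exp (\<theta> * (a + \<theta> * v))"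
proof -
  have "(\<Sum>t\<in>S. exp (\<theta> * X t)) \<le> (\<Sum>t\<in>S. 1 + \<theta> * X t + \<theta>\<^sup>2 * (X t)\<^sup>2)"
  proof (rule sum_mono)
    fix t assume t: "t \<in> S"
    have "\<bar>\<theta> * X t\<bar> \<le> \<theta> * c" using X[OF t] \<theta> by (simp add: abs_mult mult_left_mono)
    then show "exp (\<theta> * X t) \<le> 1 + \<theta> * X t + \<theta>\<^sup>2 * (X t)\<^sup>2"
      using exp_le_quadratic[of "\<theta> * X t"] c by (simp add: power_mult_distrib)
  qed
  also have "\<dots> = real (card S) + \<theta> * sum X S + \<theta>\<^sup>2 * (\<Sum>t\<in>S. (X t)\<^sup>2)"
    by (simp add: sum.distrib sum_distrib_left)
  also have "\<dots> \<le> real (card S) + \<theta> * (real (card S) * a) + \<theta>\<^sup>2 * (real (card S) * v)"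
    using m v \<theta> by (intro add_mono mult_left_mono) auto
  also have "\<dots> = real (card S) * (1 + \<theta> * (a + \<theta> * v))"
    by (simp add: algebra_simps power2_eq_square)
  also have "\<dots> \<le> real (card S) * exp (\<theta> * (a + \<theta> * v))"
    by (intro mult_left_mono) auto
  finally show ?thesis .
qed

text \<open>Telescoping: the growth condition says that \<open>s * d i * g i\<close> is at most the
  increase of \<open>g\<close>. Drift proportional to the envelope thus accumulates to at most
  \<open>1 / s\<close> envelopes.\<close>

lemma sum_growth_le:
  fixes g d :: "nat \<Rightarrow> real"
  assumes s: "0 < s" and g: "\<And>i. i < j \<Longrightarrow> (1 + s * d i) * g i \<le> g (Suc i)" and g0: "0 \<le> g 0"
  shows "(\<Sum>l<j. d l * g l) \<le> g j / s"
  using g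
proof (induction j)
  case 0
  then show ?case using g0 s by simp
next
  case (Suc j)
  have "(\<Sum>l<j. d l * g l) \<le> g j / s" using Suc by simp
  moreover have "g j + s * (d j * g j) \<le> g (Suc j)" using Suc(2)[of j] by (simp add: algebra_simps)
  ultimately have "s * ((\<Sum>l<j. d l * g l) + d j * g j) \<le> g (Suc j)"
    using s by (simp add: field_simps)
  then show ?case using s by (simp add: field_simps)
qed

text \<open>
  The failure bound \<open>U\<close> sums, over statistics, signs and target times \<open>j\<close>, the exponential of the
  signed excess at time \<open>j\<close> with the drift and variance still to come before \<open>j\<close> added in advance; the
  multiplier \<open>\<theta> = 140 L / g j\<close> makes the slack \<open>g j / 20\<close> worth the exponent \<open>7 L\<close>.
\<close>

lemma process_tail:
  fixes W :: "'k \<Rightarrow> nat \<Rightarrow> 'a set set \<Rightarrow> real" and g :: "'k \<Rightarrow> nat \<Rightarrow> real"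
    and b \<mu> s :: "'k \<Rightarrow> real" and d :: "nat \<Rightarrow> real"
  defines "Good \<equiv> \<lambda>K i E. \<forall>\<kappa>\<in>K. \<bar>W \<kappa> i E\<bar> \<le> b \<kappa> * g \<kappa> i"
  assumes K: "finite K" and L: "2800 \<le> L"
    and fin: "\<And>i E. Inv i E \<Longrightarrow> finite E"
    and step: "\<And>i E t. Inv i E \<Longrightarrow> Good K i E \<Longrightarrow> i < m \<Longrightarrow> t \<in> triangles E
      \<Longrightarrow> Inv (Suc i) (E - pairs t)"
    and tri: "\<And>i E. Inv i E \<Longrightarrow> Good K i E \<Longrightarrow> i < m \<Longrightarrow> triangles E \<noteq> {}"
    and drift: "\<And>\<kappa> i E. \<kappa> \<in> K \<Longrightarrow> Inv i E \<Longrightarrow> Good K i E \<Longrightarrow> i < m \<Longrightarrow>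
      \<bar>\<Sum>t\<in>triangles E. W \<kappa> (Suc i) (E - pairs t) - W \<kappa> i E\<bar>
        \<le> real (card (triangles E)) * (\<mu> \<kappa> * d i * g \<kappa> i)"
    and incr: "\<And>\<kappa> i E t. \<kappa> \<in> K \<Longrightarrow> Inv i E \<Longrightarrow> Good K i E \<Longrightarrow> i < m \<Longrightarrow> t \<in> triangles E \<Longrightarrow>
      \<bar>W \<kappa> (Suc i) (E - pairs t) - W \<kappa> i E\<bar> \<le> g \<kappa> i / L\<^sup>2"
    and var: "\<And>\<kappa> i E. \<kappa> \<in> K \<Longrightarrow> Inv i E \<Longrightarrow> Good K i E \<Longrightarrow> i < m \<Longrightarrow>
      (\<Sum>t\<in>triangles E. (W \<kappa> (Suc i) (E - pairs t) - W \<kappa> i E)\<^sup>2)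
        \<le> real (card (triangles E)) * (d i * (g \<kappa> i)\<^sup>2 / L\<^sup>2)"
    and g_pos: "\<And>\<kappa> i. \<kappa> \<in> K \<Longrightarrow> i \<le> m \<Longrightarrow> 0 < g \<kappa> i"
    and d_nonneg: "\<And>i. i < m \<Longrightarrow> 0 \<le> d i"
    and growth: "\<And>\<kappa> i. \<kappa> \<in> K \<Longrightarrow> i < m \<Longrightarrow> (1 + s \<kappa> * d i) * g \<kappa> i \<le> g \<kappa> (Suc i)"
    and s: "\<And>\<kappa>. \<kappa> \<in> K \<Longrightarrow> 3/2 \<le> s \<kappa>" and \<mu>: "\<And>\<kappa>. \<kappa> \<in> K \<Longrightarrow> 0 \<le> \<mu> \<kappa>"
    and budget: "\<And>\<kappa>. \<kappa> \<in> K \<Longrightarrow> \<mu> \<kappa> / s \<kappa> + 11/100 \<le> b \<kappa>"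
    and init: "Inv 0 E0" "\<And>\<kappa>. \<kappa> \<in> K \<Longrightarrow> \<bar>W \<kappa> 0 E0\<bar> \<le> g \<kappa> 0 / 100"
  shows "measure_pmf.prob (greedy_process E0)
      {Gs. \<exists>j\<le>m. \<not> (j < length Gs \<and> Good K j (Gs ! j))}
    \<le> real (card K) * 2 * real (m + 1) * exp (- 7 * L)"
proof -
  define \<theta> where "\<theta> \<kappa> j = 140 * L / g \<kappa> j" for \<kappa> j
  define inc where "inc \<kappa> j l = \<mu> \<kappa> * d l * g \<kappa> l + \<theta> \<kappa> j * (d l * (g \<kappa> l)\<^sup>2 / L\<^sup>2)" for \<kappa> j l
  define u where "u \<kappa> \<sigma> j i E = exp (\<theta> \<kappa> j * (\<sigma> * W \<kappa> i E - b \<kappa> * g \<kappa> j + (\<Sum>l\<in>{i..<j}. inc \<kappa> j l)))"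
    for \<kappa> \<sigma> j i E
  define U where "U i E = (\<Sum>\<kappa>\<in>K. \<Sum>\<sigma>\<in>{1, -1::real}. \<Sum>j\<in>{i..m}. u \<kappa> \<sigma> j i E)" for i E
  have u_pos: "0 < u \<kappa> \<sigma> j i E" for \<kappa> \<sigma> j i E by (simp add: u_def)
  have mono: "g \<kappa> i \<le> g \<kappa> j" if "\<kappa> \<in> K" "i \<le> j" "j \<le> m" for \<kappa> i j
    using that(2,3)
  proof (induction j rule: dec_induct)
    case (step j)
    have "0 \<le> s \<kappa> * d j * g \<kappa> j"
      using s[OF that(1)] d_nonneg[of j] g_pos[OF that(1), of j] step by simp
    then have "g \<kappa> j \<le> (1 + s \<kappa> * d j) * g \<kappa> j" by (simp add: algebra_simps)
    also have "\<dots> \<le> g \<kappa> (Suc j)" using growth[OF that(1)] step by simp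
    finally show ?case using step by simp
  qed simp
  have \<theta>_pos: "0 < \<theta> \<kappa> j" if "\<kappa> \<in> K" "j \<le> m" for \<kappa> j
    using g_pos[OF that] L by (simp add: \<theta>_def)
  have bad: "1 \<le> U i E" if i: "i \<le> m" and E: "\<not> Good K i E" for i E
  proof -
    obtain \<kappa> where \<kappa>: "\<kappa> \<in> K" "b \<kappa> * g \<kappa> i < \<bar>W \<kappa> i E\<bar>"
      using E unfolding Good_def by (auto simp: not_le)
    define \<sigma> :: real where "\<sigma> = (if W \<kappa> i E \<ge> 0 then 1 else -1)"
    have \<sigma>: "\<sigma> \<in> {1, -1}" "\<sigma> * W \<kappa> i E = \<bar>W \<kappa> i E\<bar>" by (auto simp: \<sigma>_def)
    \<comment> \<open>The summand whose target time is the present suffices: no future drift is left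
      to add, so its exponent is positive.\<close>
    have "1 \<le> u \<kappa> \<sigma> i i E"
      using \<kappa>(2) \<theta>_pos[OF \<kappa>(1) i] by (simp add: u_def \<sigma>(2))
    also have "\<dots> \<le> (\<Sum>j\<in>{i..m}. u \<kappa> \<sigma> j i E)"
      using i less_imp_le[OF u_pos] by (intro member_le_sum) auto
    also have "\<dots> \<le> (\<Sum>\<sigma>\<in>{1, -1::real}. \<Sum>j\<in>{i..m}. u \<kappa> \<sigma> j i E)"
      using \<sigma>(1) less_imp_le[OF u_pos] by (intro member_le_sum) (auto intro!: sum_nonneg)
    also have "\<dots> \<le> U i E"
      unfolding U_def using K \<kappa>(1) less_imp_le[OF u_pos]
      by (intro member_le_sum[of \<kappa> K]) (auto intro!: sum_nonneg add_nonneg_nonneg)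
    finally show ?thesis .
  qed
  have super: "(\<Sum>t\<in>triangles E. U (Suc i) (E - pairs t)) \<le> real (card (triangles E)) * U i E"
    if E: "Inv i E" "Good K i E" and i: "i < m" for i E
  proof -
    have ft: "finite (triangles E)" using fin[OF E(1)] by (rule finite_triangles)
    have one: "(\<Sum>t\<in>triangles E. u \<kappa> \<sigma> j (Suc i) (E - pairs t)) \<le> real (card (triangles E)) * u \<kappa> \<sigma> j i E"
      if \<kappa>: "\<kappa> \<in> K" and \<sigma>: "\<sigma> \<in> {1, -1}" and j: "j \<in> {Suc i..m}" for \<kappa> \<sigma> j
    proof -
      have gj: "0 < g \<kappa> j" using g_pos[OF \<kappa>] j by simp
      have gi: "g \<kappa> i \<le> g \<kappa> j" "0 < g \<kappa> i" using mono[OF \<kappa>, of i j] g_pos[OF \<kappa>, of i] j by auto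
      define X where "X t = \<sigma> * (W \<kappa> (Suc i) (E - pairs t) - W \<kappa> i E)" for t
      define r where "r = \<sigma> * W \<kappa> i E - b \<kappa> * g \<kappa> j + (\<Sum>l\<in>{Suc i..<j}. inc \<kappa> j l)"
      have X1: "\<bar>X t\<bar> \<le> g \<kappa> i / L\<^sup>2" if "t \<in> triangles E" for t
        using incr[OF \<kappa> E i that] \<sigma> by (auto simp: X_def abs_mult)
      \<comment> \<open>The increment bound carries \<open>L^2\<close>, so \<open>140 / L\<close>
        times a ratio of envelopes remains; that ratio is at most 1 because envelopes
        increase.\<close>
      have c: "\<theta> \<kappa> j * (g \<kappa> i / L\<^sup>2) \<le> 1"
      proof -
        have "\<theta> \<kappa> j * (g \<kappa> i / L\<^sup>2) = (140 / L) * (g \<kappa> i / g \<kappa> j)"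
          using L by (simp add: \<theta>_def power2_eq_square)
        also have "\<dots> \<le> 1 * 1" using L gi gj by (intro mult_mono) auto
        finally show ?thesis by simp
      qed
      have "sum X (triangles E) \<le> \<bar>\<Sum>t\<in>triangles E. W \<kappa> (Suc i) (E - pairs t) - W \<kappa> i E\<bar>"
        unfolding X_def sum_distrib_left[symmetric] using \<sigma> by auto
      then have X2: "sum X (triangles E) \<le> real (card (triangles E)) * (\<mu> \<kappa> * d i * g \<kappa> i)"
        using drift[OF \<kappa> E i] by linarith
      have "\<sigma>\<^sup>2 = 1" using \<sigma> by auto
      then have X3: "(\<Sum>t\<in>triangles E. (X t)\<^sup>2) \<le> real (card (triangles E)) * (d i * (g \<kappa> i)\<^sup>2 / L\<^sup>2)"
        using var[OF \<kappa> E i] by (simp add: X_def power_mult_distrib)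
      have "(\<Sum>t\<in>triangles E. u \<kappa> \<sigma> j (Suc i) (E - pairs t))
          = (\<Sum>t\<in>triangles E. exp (\<theta> \<kappa> j * r) * exp (\<theta> \<kappa> j * X t))"
        by (intro sum.cong refl) (simp add: u_def r_def X_def exp_add[symmetric] algebra_simps)
      also have "\<dots> = exp (\<theta> \<kappa> j * r) * (\<Sum>t\<in>triangles E. exp (\<theta> \<kappa> j * X t))"
        by (simp add: sum_distrib_left)
      also have "\<dots> \<le> exp (\<theta> \<kappa> j * r) * (real (card (triangles E)) * exp (\<theta> \<kappa> j * inc \<kappa> j i))"
        unfolding inc_def using j \<theta>_pos[OF \<kappa>]
        by (intro mult_left_mono sum_exp_le[OF ft X1 c _ X2 X3]) (auto intro: less_imp_le)
      also have "\<dots> = real (card (triangles E)) * exp (\<theta> \<kappa> j * (r + inc \<kappa> j i))"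
        by (simp add: exp_add[symmetric] algebra_simps)
      also have "r + inc \<kappa> j i = \<sigma> * W \<kappa> i E - b \<kappa> * g \<kappa> j + (\<Sum>l\<in>{i..<j}. inc \<kappa> j l)"
        using j by (simp add: r_def sum.atLeast_Suc_lessThan)
      finally show ?thesis by (simp add: u_def)
    qed
    have "(\<Sum>t\<in>triangles E. U (Suc i) (E - pairs t))
      = (\<Sum>\<kappa>\<in>K. \<Sum>\<sigma>\<in>{1, -1::real}. \<Sum>j\<in>{Suc i..m}. \<Sum>t\<in>triangles E. u \<kappa> \<sigma> j (Suc i) (E - pairs t))"
      unfolding U_def by (subst sum.swap) (intro sum.cong refl, subst sum.swap, intro sum.cong refl, rule sum.swap)
    also have "\<dots> \<le> (\<Sum>\<kappa>\<in>K. \<Sum>\<sigma>\<in>{1, -1::real}. \<Sum>j\<in>{Suc i..m}. real (card (triangles E)) * u \<kappa> \<sigma> j i E)"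
      by (intro sum_mono one)
    \<comment> \<open>Putting back the target time \<open>j = i\<close>, which is past after the
      step, only enlarges the sum.\<close>
    also have "\<dots> \<le> (\<Sum>\<kappa>\<in>K. \<Sum>\<sigma>\<in>{1, -1::real}. \<Sum>j\<in>{i..m}. real (card (triangles E)) * u \<kappa> \<sigma> j i E)"
      using less_imp_le[OF u_pos] by (intro sum_mono sum_mono2) auto
    also have "\<dots> = real (card (triangles E)) * U i E"
      unfolding U_def by (simp only: sum_distrib_left)
    finally show ?thesis .
  qed
  have start: "u \<kappa> \<sigma> j 0 E0 \<le> exp (- 7 * L)"
    if \<kappa>: "\<kappa> \<in> K" and \<sigma>: "\<sigma> \<in> {1, -1}" and j: "j \<in> {0..m}" for \<kappa> \<sigma> j
  proof -
    have gj: "0 < g \<kappa> j" and g0: "0 < g \<kappa> 0" "g \<kappa> 0 \<le> g \<kappa> j"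
      using g_pos[OF \<kappa>] mono[OF \<kappa>] j by auto
    have s\<kappa>: "3/2 \<le> s \<kappa>" using s[OF \<kappa>] .
    have S1: "(\<Sum>l<j. d l * g \<kappa> l) \<le> g \<kappa> j / s \<kappa>"
      using s\<kappa> j g0 by (intro sum_growth_le growth[OF \<kappa>]) auto
    \<comment> \<open>Squared envelopes grow at rate at least \<open>3 = 2 * (3/2)\<close>.\<close>
    have S2: "(\<Sum>l<j. d l * (g \<kappa> l)\<^sup>2) \<le> (g \<kappa> j)\<^sup>2 / 3"
    proof (rule sum_growth_le)
      fix i assume "i < j"
      then have i: "i < m" using j by simp
      have dg: "0 \<le> d i" "0 < g \<kappa> i" using d_nonneg[OF i] g_pos[OF \<kappa>, of i] i by auto
      have "3/2 * d i \<le> s \<kappa> * d i" using s\<kappa> dg by (intro mult_right_mono) auto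
      then have "1 + 3 * d i \<le> 1 + 2 * (s \<kappa> * d i) + (s \<kappa> * d i)\<^sup>2"
        using zero_le_power2[of "s \<kappa> * d i"] by linarith
      also have "\<dots> = (1 + s \<kappa> * d i)\<^sup>2" by (simp add: power2_eq_square algebra_simps)
      finally have "(1 + 3 * d i) * (g \<kappa> i)\<^sup>2 \<le> ((1 + s \<kappa> * d i) * g \<kappa> i)\<^sup>2"
        by (simp add: power_mult_distrib mult_right_mono)
      also have "\<dots> \<le> (g \<kappa> (Suc i))\<^sup>2"
        using growth[OF \<kappa> i] dg s\<kappa> by (intro power_mono) auto
      finally show "(1 + 3 * d i) * (g \<kappa> i)\<^sup>2 \<le> (g \<kappa> (Suc i))\<^sup>2" .
    qed auto
    have th: "\<theta> \<kappa> j * ((\<Sum>l<j. d l * (g \<kappa> l)\<^sup>2) / L\<^sup>2) \<le> g \<kappa> j / 20"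
    proof -
      have "\<theta> \<kappa> j * ((\<Sum>l<j. d l * (g \<kappa> l)\<^sup>2) / L\<^sup>2) \<le> \<theta> \<kappa> j * ((g \<kappa> j)\<^sup>2 / 3 / L\<^sup>2)"
        using S2 \<theta>_pos[OF \<kappa>, of j] j by (intro mult_left_mono divide_right_mono) auto
      also have "\<dots> = 140 / (3 * L) * g \<kappa> j"
        using L gj by (simp add: \<theta>_def power2_eq_square)
      also have "\<dots> \<le> (1 / 20) * g \<kappa> j"
        using L gj by (intro mult_right_mono) (auto simp: field_simps)
      finally show ?thesis by simp
    qed
    have "(\<Sum>l\<in>{0..<j}. inc \<kappa> j l)
        = \<mu> \<kappa> * (\<Sum>l<j. d l * g \<kappa> l) + \<theta> \<kappa> j * ((\<Sum>l<j. d l * (g \<kappa> l)\<^sup>2) / L\<^sup>2)"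
      by (simp add: inc_def sum.distrib sum_distrib_left sum_divide_distrib atLeast0LessThan mult.assoc)
    also have "\<dots> \<le> \<mu> \<kappa> * (g \<kappa> j / s \<kappa>) + g \<kappa> j / 20"
      using S1 th \<mu>[OF \<kappa>] by (intro add_mono mult_left_mono) auto
    finally have inc: "(\<Sum>l\<in>{0..<j}. inc \<kappa> j l) \<le> (\<mu> \<kappa> / s \<kappa>) * g \<kappa> j + g \<kappa> j / 20" by simp
    have "\<sigma> * W \<kappa> 0 E0 \<le> g \<kappa> j / 100" using init(2)[OF \<kappa>] \<sigma> g0 by auto
    \<comment> \<open>The reserve 11/100 is spent as 1/100 on the initial deviation, 5/100 on the
      variance and 5/100 on the slack \<open>g \<kappa> j / 20\<close>, which
      \<open>\<theta> \<kappa> j\<close> turns into \<open>7 * L\<close>.\<close>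
    moreover have "(\<mu> \<kappa> / s \<kappa> + 11/100) * g \<kappa> j \<le> b \<kappa> * g \<kappa> j"
      using budget[OF \<kappa>] gj by (intro mult_right_mono) auto
    ultimately have "\<sigma> * W \<kappa> 0 E0 - b \<kappa> * g \<kappa> j + (\<Sum>l\<in>{0..<j}. inc \<kappa> j l) \<le> - (g \<kappa> j / 20)"
      using inc by (simp add: algebra_simps)
    then have "\<theta> \<kappa> j * (\<sigma> * W \<kappa> 0 E0 - b \<kappa> * g \<kappa> j + (\<Sum>l\<in>{0..<j}. inc \<kappa> j l)) \<le> \<theta> \<kappa> j * (- (g \<kappa> j / 20))"
      using \<theta>_pos[OF \<kappa>, of j] j by (intro mult_left_mono) auto
    also have "\<dots> = - 7 * L" using gj by (simp add: \<theta>_def)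
    finally show ?thesis by (simp add: u_def)
  qed
  have "measure_pmf.prob (greedy_process E0)
      {Gs. \<exists>j. 0 + j \<le> m \<and> \<not> (j < length Gs \<and> Good K (0 + j) (Gs ! j))} \<le> U 0 E0"
    using fin step tri bad super init(1) less_imp_le[OF u_pos]
    by (intro greedy_process_failure[where Inv = Inv and U = U])
       (auto simp: U_def intro!: sum_nonneg add_nonneg_nonneg)
  also have "U 0 E0 \<le> (\<Sum>\<kappa>\<in>K. \<Sum>\<sigma>\<in>{1, -1::real}. \<Sum>j\<in>{0..m}. exp (- 7 * L))"
    unfolding U_def by (intro sum_mono start)
  also have "\<dots> = real (card K) * 2 * real (m + 1) * exp (- 7 * L)"
    by (simp add: algebra_simps)
  finally show ?thesis by simp
qed

subsection \<open>Copies of a structure and the edges of a random triangle\<close>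

text \<open>
  A potential copy of a structure is an index \<open>\<iota> \<in> I\<close> with edge set \<open>F \<iota>\<close>; \<open>cnt I F E\<close> counts those
  present in \<open>E\<close>.
\<close>

definition cnt :: "'i set \<Rightarrow> ('i \<Rightarrow> 'a set set) \<Rightarrow> 'a set set \<Rightarrow> real" where
  "cnt I F E = real (card {\<iota> \<in> I. F \<iota> \<subseteq> E})"

text \<open>For an edge this is the codegree of its ends, see \<open>tdeg_eq\<close>; indexing by
  the edge avoids naming the ends.\<close>

definition tdeg :: "'a set set \<Rightarrow> 'a set \<Rightarrow> real" where
  "tdeg E e = real (card {t \<in> triangles E. e \<in> pairs t})"

lemma cnt_nonneg [simp]: "0 \<le> cnt I F E"
  by (simp add: cnt_def)

lemma cnt_loss_eq:
  assumes "finite I"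
  shows "cnt I F E - cnt I F (E - pairs t)
    = real (card {\<iota> \<in> I. F \<iota> \<subseteq> E \<and> pairs t \<inter> F \<iota> \<noteq> {}})"
proof -
  have "{\<iota> \<in> I. F \<iota> \<subseteq> E} = {\<iota> \<in> I. F \<iota> \<subseteq> E - pairs t} \<union> {\<iota> \<in> I. F \<iota> \<subseteq> E \<and> pairs t \<inter> F \<iota> \<noteq> {}}"
    by auto
  then have "card {\<iota> \<in> I. F \<iota> \<subseteq> E}
      = card {\<iota> \<in> I. F \<iota> \<subseteq> E - pairs t} + card {\<iota> \<in> I. F \<iota> \<subseteq> E \<and> pairs t \<inter> F \<iota> \<noteq> {}}"
    using assms by (simp only:) (subst card_Un_disjoint; auto)
  then show ?thesis by (simp add: cnt_def)
qed

text \<open>Double counting of the pairs of a triangle and a present copy that share an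
  edge.\<close>

lemma sum_cnt_loss:
  assumes "finite I" "finite E"
  shows "(\<Sum>t\<in>triangles E. cnt I F E - cnt I F (E - pairs t))
    = (\<Sum>\<iota>\<in>{\<iota> \<in> I. F \<iota> \<subseteq> E}. real (card {t \<in> triangles E. pairs t \<inter> F \<iota> \<noteq> {}}))"
proof -
  let ?A = "{\<iota> \<in> I. F \<iota> \<subseteq> E}"
  have fin: "finite ?A" "finite (triangles E)" using assms finite_triangles by auto
  have eq: "{\<iota> \<in> I. F \<iota> \<subseteq> E \<and> P \<iota>} = {\<iota> \<in> ?A. P \<iota>}" for P by auto
  have "(\<Sum>t\<in>triangles E. cnt I F E - cnt I F (E - pairs t))
      = (\<Sum>t\<in>triangles E. \<Sum>\<iota>\<in>?A. of_bool (pairs t \<inter> F \<iota> \<noteq> {}))"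
    unfolding cnt_loss_eq[OF assms(1)] eq using fin
    by (intro sum.cong refl) (simp add: Int_def)
  also have "\<dots> = (\<Sum>\<iota>\<in>?A. \<Sum>t\<in>triangles E. of_bool (pairs t \<inter> F \<iota> \<noteq> {}))"
    by (rule sum.swap)
  also have "\<dots> = (\<Sum>\<iota>\<in>?A. real (card {t \<in> triangles E. pairs t \<inter> F \<iota> \<noteq> {}}))"
    using fin by (intro sum.cong refl) (simp add: Int_def)
  finally show ?thesis .
qed

text \<open>Keeps the number of triangles that meet a structure in two edges bounded, which is the
  error term of \<open>hit_ge\<close>.\<close>

lemma two_edges_determine_triangle:
  assumes "card t = 3" "e \<in> pairs t" "e' \<in> pairs t" "e \<noteq> e'"
  shows "t = e \<union> e'"
proof -
  have t: "finite t" using assms(1) by (auto intro: card_ge_0_finite)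
  have e: "e \<subseteq> t" "e' \<subseteq> t" "card e = 2" "card e' = 2" using assms(2,3) by (auto simp: pairs_def)
  have fe: "finite e" "finite e'" using e t finite_subset by blast+
  have "e \<subset> e \<union> e'"
  proof -
    have "\<not> e' \<subseteq> e" using card_subset_eq[OF fe(1), of e'] e assms(4) by auto
    then show ?thesis by blast
  qed
  then have "card e < card (e \<union> e')" using fe by (intro psubset_card_mono) auto
  then have "card t \<le> card (e \<union> e')" using e assms(1) by simp
  then show ?thesis using e t by (intro card_seteq[symmetric]) auto
qed

lemma hit_le:
  assumes "finite E" "finite F"
  shows "real (card {t \<in> triangles E. pairs t \<inter> F \<noteq> {}}) \<le> (\<Sum>e\<in>F. tdeg E e)"
proof -
  have "{t \<in> triangles E. pairs t \<inter> F \<noteq> {}} = (\<Union>e\<in>F. {t \<in> triangles E. e \<in> pairs t})" by auto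
  then have "card {t \<in> triangles E. pairs t \<inter> F \<noteq> {}} \<le> (\<Sum>e\<in>F. card {t \<in> triangles E. e \<in> pairs t})"
    using card_UN_le[OF assms(2)] by simp
  then show ?thesis unfolding tdeg_def of_nat_sum[symmetric] of_nat_le_iff .
qed

text \<open>A Bonferroni inequality: a triangle containing \<open>h\<close> edges of
  \<open>F\<close> is overcounted \<open>h - 1\<close> times, which is at most its number of ordered
  pairs of distinct edges of \<open>F\<close>; each such pair lies in at most one triangle.\<close>

lemma hit_ge:
  assumes "finite E" "finite F"
  shows "(\<Sum>e\<in>F. tdeg E e) - (real (card F))\<^sup>2 \<le> real (card {t \<in> triangles E. pairs t \<inter> F \<noteq> {}})"
proof -
  let ?T = "triangles E"
  have ft: "finite ?T" using assms finite_triangles by blast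
  define h where "h t = card {e \<in> F. e \<in> pairs t}" for t
  have fh: "finite {e \<in> F. e \<in> pairs t}" for t using assms by simp
  have sum1: "(\<Sum>e\<in>F. tdeg E e) = (\<Sum>t\<in>?T. real (h t))"
  proof -
    have "(\<Sum>e\<in>F. tdeg E e) = (\<Sum>e\<in>F. \<Sum>t\<in>?T. of_bool (e \<in> pairs t))"
      using ft by (intro sum.cong refl) (simp add: tdeg_def Int_def)
    also have "\<dots> = (\<Sum>t\<in>?T. \<Sum>e\<in>F. of_bool (e \<in> pairs t))" by (rule sum.swap)
    also have "\<dots> = (\<Sum>t\<in>?T. real (h t))"
      using assms by (intro sum.cong refl) (simp add: h_def Int_def)
    finally show ?thesis .
  qed
  have sum2: "real (card {t \<in> ?T. pairs t \<inter> F \<noteq> {}}) = (\<Sum>t\<in>?T. of_bool (pairs t \<inter> F \<noteq> {}))"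
    using ft by (simp add: Int_def)
  have pt: "real (h t) - of_bool (pairs t \<inter> F \<noteq> {})
      \<le> (\<Sum>(e, e')\<in>F \<times> F. of_bool (e \<noteq> e' \<and> e \<in> pairs t \<and> e' \<in> pairs t))" for t
  proof (cases "h t \<le> 1")
    case True
    have "0 \<le> (\<Sum>(e, e')\<in>F \<times> F. of_bool (e \<noteq> e' \<and> e \<in> pairs t \<and> e' \<in> pairs t) :: real)"
      by (intro sum_nonneg) auto
    moreover have "h t = 0" if "pairs t \<inter> F = {}"
    proof -
      have "{e \<in> F. e \<in> pairs t} = {}" using that by auto
      then show ?thesis by (simp only: h_def card.empty)
    qed
    ultimately show ?thesis using True by (cases "pairs t \<inter> F = {}") auto
  next
    case False
    let ?H = "{e \<in> F. e \<in> pairs t}"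
    have "?H \<noteq> {}"
    proof
      assume "?H = {}"
      then have "h t = 0" by (simp only: h_def card.empty)
      then show False using False by simp
    qed
    then obtain e where e: "e \<in> ?H" by blast
    \<comment> \<open>The pairs with one fixed first edge \<open>e\<close> already number
      \<open>h t - 1\<close>.\<close>
    have "real (h t) - 1 = real (card (?H - {e}))"
      using e fh[of t] False by (simp add: h_def of_nat_diff)
    also have "\<dots> = real (card ({e} \<times> (?H - {e})))" by (simp add: card_cartesian_product)
    also have "\<dots> = (\<Sum>x\<in>{e} \<times> (?H - {e}). 1)" by simp
    also have "\<dots> = (\<Sum>(e, e')\<in>{e} \<times> (?H - {e}). of_bool (e \<noteq> e' \<and> e \<in> pairs t \<and> e' \<in> pairs t))"
      using e by (intro sum.cong refl) auto
    also have "\<dots> \<le> (\<Sum>(e, e')\<in>F \<times> F. of_bool (e \<noteq> e' \<and> e \<in> pairs t \<and> e' \<in> pairs t))"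
      using e assms by (intro sum_mono2) auto
    finally show ?thesis using e by (auto simp: of_bool_def)
  qed
  have "(\<Sum>e\<in>F. tdeg E e) - real (card {t \<in> ?T. pairs t \<inter> F \<noteq> {}})
      = (\<Sum>t\<in>?T. real (h t) - of_bool (pairs t \<inter> F \<noteq> {}))"
    unfolding sum1 sum2 by (simp add: sum_subtractf)
  also have "\<dots> \<le> (\<Sum>t\<in>?T. \<Sum>(e, e')\<in>F \<times> F. of_bool (e \<noteq> e' \<and> e \<in> pairs t \<and> e' \<in> pairs t))"
    by (intro sum_mono pt)
  also have "\<dots> = (\<Sum>(e, e')\<in>F \<times> F. \<Sum>t\<in>?T. of_bool (e \<noteq> e' \<and> e \<in> pairs t \<and> e' \<in> pairs t))"
    by (subst sum.swap) (simp add: case_prod_unfold)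
  also have "\<dots> \<le> (\<Sum>(e, e')\<in>F \<times> F. 1)"
  proof (intro sum_mono, clarify)
    fix e e'
    have "{t \<in> ?T. e \<noteq> e' \<and> e \<in> pairs t \<and> e' \<in> pairs t} \<subseteq> {e \<union> e'}"
      using two_edges_determine_triangle by (fastforce simp: triangles_def)
    then have "card {t \<in> ?T. e \<noteq> e' \<and> e \<in> pairs t \<and> e' \<in> pairs t} \<le> card {e \<union> e'}"
      by (intro card_mono) auto
    then show "(\<Sum>t\<in>?T. of_bool (e \<noteq> e' \<and> e \<in> pairs t \<and> e' \<in> pairs t)) \<le> (1 :: real)"
      using ft by (simp add: Int_def)
  qed
  also have "\<dots> = (real (card F))\<^sup>2"
    by (simp add: case_prod_unfold card_cartesian_product power2_eq_square)
  finally show ?thesis by linarith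
qed

lemma card_pairs_triangle:
  assumes "card t = 3"
  shows "card (pairs t) = 3"
proof -
  have "finite t" using assms by (auto intro: card_ge_0_finite)
  then show ?thesis using n_subsets[of t 2] assms by (simp add: pairs_def numeral_eq_Suc)
qed

lemma cnt_loss_le:
  assumes I: "finite I" and t: "card t = 3"
    and D: "\<And>e. e \<in> E \<Longrightarrow> real (card {\<iota> \<in> I. F \<iota> \<subseteq> E \<and> e \<in> F \<iota>}) \<le> D" and "0 \<le> D"
  shows "cnt I F E - cnt I F (E - pairs t) \<le> 3 * D"
proof -
  have fp: "finite (pairs t)" using card_pairs_triangle[OF t] by (auto intro: card_ge_0_finite)
  have "{\<iota> \<in> I. F \<iota> \<subseteq> E \<and> pairs t \<inter> F \<iota> \<noteq> {}} = (\<Union>e\<in>pairs t. {\<iota> \<in> I. F \<iota> \<subseteq> E \<and> e \<in> F \<iota>})"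
    by auto
  then have "card {\<iota> \<in> I. F \<iota> \<subseteq> E \<and> pairs t \<inter> F \<iota> \<noteq> {}}
      \<le> (\<Sum>e\<in>pairs t. card {\<iota> \<in> I. F \<iota> \<subseteq> E \<and> e \<in> F \<iota>})"
    using card_UN_le[OF fp] by simp
  then have "cnt I F E - cnt I F (E - pairs t)
      \<le> (\<Sum>e\<in>pairs t. real (card {\<iota> \<in> I. F \<iota> \<subseteq> E \<and> e \<in> F \<iota>}))"
    unfolding cnt_loss_eq[OF I] of_nat_sum[symmetric] of_nat_le_iff .
  also have "\<dots> \<le> (\<Sum>e\<in>pairs t. D)"
  proof (rule sum_mono)
    fix e
    show "real (card {\<iota> \<in> I. F \<iota> \<subseteq> E \<and> e \<in> F \<iota>}) \<le> D"
    proof (cases "e \<in> E")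
      case True
      then show ?thesis by (rule D)
    next
      case False
      then have "{\<iota> \<in> I. F \<iota> \<subseteq> E \<and> e \<in> F \<iota>} = {}" by auto
      then show ?thesis using \<open>0 \<le> D\<close> by (simp only: card.empty of_nat_0)
    qed
  qed
  also have "\<dots> = 3 * D" using card_pairs_triangle[OF t] by simp
  finally show ?thesis .
qed

lemma cnt_mono:
  assumes "finite I" "E' \<subseteq> E"
  shows "cnt I F E' \<le> cnt I F E"
  unfolding cnt_def of_nat_le_iff using assms by (intro card_mono) auto

section \<open>First-order effect of one step on a ratio\<close>

text \<open>When \<open>p\<close> drops to \<open>p * (1 - d)\<close>, a ratio normalized by
  \<open>p ^ k\<close> is rescaled by \<open>1 / (1 - d) ^ k\<close>. Both bounds rest on the
  Bernoulli inequality. The limit 5 on \<open>k\<close> is the edge count of the largest structure,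
  \<open>FV\<close>.\<close>

lemma inverse_power_expansion:
  fixes d :: real
  assumes d: "0 \<le> d" "d \<le> 1/100" and k: "k \<le> 5"
  shows "1 + real k * d \<le> 1 / (1 - d) ^ k" "1 / (1 - d) ^ k \<le> 1 + real k * d + 50 * d\<^sup>2"
proof -
  have kd: "real k * d \<le> 1/20" "0 \<le> real k * d"
    using mult_mono[of "real k" 5 d "1/100"] d k by auto
  have pos: "0 < (1 - d) ^ k" using d by simp
  have "(1 - d) ^ k * (1 + real k * d) \<le> (1 - d) ^ k * (1 + d) ^ k"
    using Bernoulli_inequality[of d k] d by (intro mult_left_mono) auto
  also have "\<dots> = (1 - d\<^sup>2) ^ k"
    by (simp add: power_mult_distrib[symmetric] power2_eq_square algebra_simps)
  also have "\<dots> \<le> 1" using d by (intro power_le_one) (auto simp: power_le_one)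
  finally show "1 + real k * d \<le> 1 / (1 - d) ^ k"
    using pos by (simp add: field_simps)
  have B: "1 - real k * d \<le> (1 - d) ^ k" using Bernoulli_inequality[of "-d" k] d by simp
  define x where "x = real k * d"
  have x: "0 \<le> x" "x \<le> 1/20" using kd by (auto simp: x_def)
  have "x\<^sup>2 \<le> 25 * d\<^sup>2"
    using power_mono[of x "5 * d" 2] mult_right_mono[of "real k" 5 d] x k d
    by (simp add: x_def power_mult_distrib)
  moreover have "1 / (1 - x) \<le> 1 + x + 2 * x\<^sup>2"
  proof -
    have "0 \<le> x\<^sup>2 * (1 - 2 * x)" using x by (intro mult_nonneg_nonneg) auto
    then have "1 \<le> (1 + x + 2 * x\<^sup>2) * (1 - x)" by (simp add: algebra_simps power2_eq_square)
    then show ?thesis using x by (simp add: divide_le_eq)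
  qed
  moreover have "1 / (1 - d) ^ k \<le> 1 / (1 - x)"
    using B x pos by (intro divide_left_mono) (auto simp: x_def)
  ultimately show "1 / (1 - d) ^ k \<le> 1 + real k * d + 50 * d\<^sup>2"
    unfolding x_def by linarith
qed

text \<open>Here \<open>u * (z - d * X)\<close> is the mean of a ratio after one step:
  \<open>X\<close> is the expected loss in units of \<open>d\<close>, \<open>s\<close> the summed
  codegree errors of the copies, \<open>\<tau>\<close> the overcount from triangles hitting a copy
  twice, \<open>g\<close> the relative error of the number of triangles. The part
  \<open>k * z\<close> of the loss is cancelled by the rescaling \<open>u\<close>, so that
  \<open>- d * s\<close> survives. The remainder is of order \<open>d * e2\<close> only because
  \<open>g\<close> itself is of order \<open>e2\<close>.\<close>

lemma relative_drift:
  fixes z s \<tau> g d e2 :: real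
  assumes k: "k \<le> 5" and e2: "e2 \<le> 1/1000000000" and d: "0 \<le> d" "d \<le> e2"
    and g: "\<bar>g\<bar> \<le> 150 * e2" and z: "0 \<le> z" "z \<le> 2" and s: "\<bar>s\<bar> \<le> 1"
    and \<tau>: "0 \<le> \<tau>" "\<tau> \<le> 50 * e2"
  defines "X \<equiv> (real k * z + s - \<tau>) / (1 + g)" and "u \<equiv> 1 / (1 - d) ^ k"
  shows "\<bar>u * (z - d * X) - z + d * s\<bar> \<le> 2000 * d * e2" "\<bar>X\<bar> \<le> 12" "0 \<le> u - 1" "u - 1 \<le> 6 * d"
proof -
  define Y where "Y = real k * z + s"
  define \<eta> where "\<eta> = X - Y"
  have kz: "0 \<le> real k * z" "real k * z \<le> 10"
    using mult_mono[of "real k" 5 z 2] k z by auto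
  then have Y: "\<bar>Y\<bar> \<le> 11" using s unfolding Y_def by linarith
  have g1: "1/2 \<le> 1 + g" using g e2 by linarith
  have \<eta>_eq: "\<eta> * (1 + g) = - \<tau> - g * Y" using g1 by (simp add: \<eta>_def X_def Y_def field_simps)
  have "\<bar>g * Y\<bar> \<le> 150 * e2 * 11" unfolding abs_mult using g Y by (intro mult_mono) auto
  then have "\<bar>\<eta> * (1 + g)\<bar> \<le> 1700 * e2" unfolding \<eta>_eq using \<tau> by linarith
  then have "\<bar>\<eta>\<bar> * (1 + g) \<le> 1700 * e2" using g1 by (simp add: abs_mult)
  moreover have "\<bar>\<eta>\<bar> * (999/1000) \<le> \<bar>\<eta>\<bar> * (1 + g)" using g e2 by (intro mult_left_mono) auto
  ultimately have \<eta>: "\<bar>\<eta>\<bar> \<le> 1710 * e2" by linarith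
  then show X: "\<bar>X\<bar> \<le> 12" using Y e2 unfolding \<eta>_def by linarith
  have d': "d \<le> 1/100" using d e2 by linarith
  note u = inverse_power_expansion[OF d(1) d' k, folded u_def]
  have kd: "real k * d \<le> 5 * d" "0 \<le> real k * d" using k d by (auto intro!: mult_right_mono)
  have d2: "50 * d\<^sup>2 \<le> d" using mult_right_mono[OF d' d(1)] d(1) d e2 mult_right_mono[of d "1/1000000000" d]
    by (simp add: power2_eq_square)
  show u1: "0 \<le> u - 1" "u - 1 \<le> 6 * d" using u kd d2 by linarith+
  have 1: "\<bar>(u - 1 - real k * d) * z\<bar> \<le> 50 * d\<^sup>2 * 2"
    unfolding abs_mult using u z by (intro mult_mono) auto
  have 2: "\<bar>d * \<eta>\<bar> \<le> d * (1710 * e2)"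
    unfolding abs_mult using \<eta> d by (intro mult_mono) auto
  have 3: "\<bar>(u - 1) * d * X\<bar> \<le> 6 * d * d * 12"
    unfolding abs_mult using u1 d X by (intro mult_mono) auto
  \<comment> \<open>The three remainders are the curvature of the rescaling, the error of the loss,
    and the product of rescaling and loss.\<close>
  have eq: "u * (z - d * X) - z + d * s = (u - 1 - real k * d) * z - d * \<eta> - (u - 1) * d * X"
    by (simp add: \<eta>_def Y_def algebra_simps)
  have "d * d \<le> d * e2" using d by (intro mult_left_mono) auto
  then have "50 * d\<^sup>2 * 2 + d * (1710 * e2) + 6 * d * d * 12 \<le> 2000 * d * e2"
    using mult_nonneg_nonneg[of d e2] d unfolding power2_eq_square by linarith
  then show "\<bar>u * (z - d * X) - z + d * s\<bar> \<le> 2000 * d * e2"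
    unfolding eq using 1 2 3 by linarith
qed

text \<open>
  Here \<open>eps\<close> is the unit for relative errors, \<open>dl\<close> the relative decrease of \<open>p\<close> in one step, and
  \<open>r\<close> (up to a constant) the largest relative change of a count in one step.
\<close>

locale scale =
  fixes n :: nat and p L :: real
  assumes p: "0 < p" "p \<le> 1" and L: "10^6 \<le> L" and np3: "L^10 \<le> real n * p^3"
begin

definition "eps = L\<^sup>2 / sqrt (real n * p^3)"
definition "dl = 6 / ((real n)\<^sup>2 * p)"
definition "p' = p * (1 - dl)"
definition "r = 1 / (real n * p^3)"

lemma np3_pos: "0 < real n * p^3"
  using np3 L by (intro less_le_trans[OF _ np3]) auto

lemma n_pos: "0 < real n"
  using np3_pos p by (simp add: zero_less_mult_iff)

lemma r_pos: "0 < r"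
  using np3_pos by (simp add: r_def)

lemma eps_pos: "0 < eps"
  using np3_pos L by (simp add: eps_def)

lemma eps_sq: "eps\<^sup>2 = L^4 * r"
  using np3_pos by (simp add: eps_def r_def power_divide)

lemma r_le: "r \<le> 1 / L^10"
  unfolding r_def using np3 L by (intro divide_left_mono) (auto intro: mult_pos_pos np3_pos)

lemma L_pow: "10^(6 * k) \<le> L^k"
  using power_mono[OF L, of k] by (simp add: power_mult)

lemma r_eps: "1000000000 * r \<le> eps\<^sup>2"
  unfolding eps_sq using mult_right_mono[OF L_pow[of 4], of r] r_pos by simp

lemma eps_small: "eps \<le> 1/1000000000"
proof -
  have "eps\<^sup>2 \<le> L^4 * (1 / L^10)" unfolding eps_sq using r_le L by (intro mult_left_mono) auto
  also have "\<dots> = 1 / L^6" using L by (simp add: field_simps flip: power_add)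
  also have "\<dots> \<le> 1 / 10^36" using L_pow[of 6] L by (intro divide_left_mono) auto
  also have "\<dots> \<le> (1/1000000000)\<^sup>2" by (simp add: power2_eq_square)
  finally show ?thesis by (rule power2_le_imp_le) simp
qed

lemma eps_sq_small: "eps\<^sup>2 \<le> eps / 1000000000" "eps\<^sup>2 \<le> 1/1000000000"
  using mult_left_mono[OF eps_small, of eps] mult_mono[OF eps_small, of eps 1] eps_small eps_pos
  by (simp_all add: power2_eq_square)

lemma r_ge: "1 / real n \<le> r" "1 / (real n * p) \<le> r" "1 / (real n * p\<^sup>2) \<le> r"
proof -
  have "p^3 \<le> p\<^sup>2" "p^3 \<le> p" "p^3 \<le> 1"
    using p power_decreasing[of 2 3 p] power_decreasing[of 1 3 p] power_decreasing[of 0 3 p] by auto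
  then show "1 / real n \<le> r" "1 / (real n * p) \<le> r" "1 / (real n * p\<^sup>2) \<le> r"
    unfolding r_def using n_pos p
    by (auto intro!: divide_left_mono mult_left_mono mult_pos_pos
        intro: mult_left_le simp: mult_left_le)
qed

lemma dl_pos: "0 < dl"
  using n_pos p by (simp add: dl_def)

lemma dl_le: "dl \<le> 6 * r\<^sup>2"
proof -
  have "dl = 6 * (1 / real n) * (1 / (real n * p))"
    using n_pos p by (simp add: dl_def power2_eq_square)
  also have "\<dots> \<le> 6 * r * r" using r_ge r_pos n_pos p by (intro mult_mono) auto
  finally show ?thesis by (simp add: power2_eq_square)
qed

lemma r_small: "r \<le> 1/10000000000"
proof -
  have "1 / L^10 \<le> 1 / 10^60" using L_pow[of 10] L by (intro divide_left_mono) auto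
  then show ?thesis using r_le by (simp add: field_simps)
qed

lemma dl_r: "dl \<le> r / 1000000000"
proof -
  have "6 * r\<^sup>2 \<le> 6 * (r * (1/10000000000))" unfolding power2_eq_square
    using r_small r_pos by (intro mult_left_mono) auto
  then show ?thesis using dl_le r_pos by linarith
qed

lemma dl_small: "dl \<le> 1/1000000000" "dl \<le> eps\<^sup>2"
  using dl_r r_small r_eps r_pos by auto

lemma p'_eq: "p' = p - 6 / (real n)\<^sup>2"
  using p by (simp add: p'_def dl_def field_simps)

text \<open>
  A ratio whose copies have average relative codegree error \<open>s\<close> changes by \<open>- dl * s\<close> in expectation.
  The sums run over all triangles, so expectations appear multiplied by \<open>Q_var E\<close>.
\<close>

definition one_step :: "'a set set \<Rightarrow> real \<Rightarrow> ('a set set \<Rightarrow> real) \<Rightarrow> real \<Rightarrow> bool" where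
  "one_step E x x' s \<longleftrightarrow>
    \<bar>(\<Sum>t\<in>triangles E. x' (E - pairs t) - x) + Q_var E * (dl * s)\<bar> \<le> Q_var E * (2000 * dl * eps\<^sup>2) \<and>
    (\<Sum>t\<in>triangles E. \<bar>x' (E - pairs t) - x\<bar>) \<le> Q_var E * (50 * dl) \<and>
    (\<forall>t\<in>triangles E. \<bar>x' (E - pairs t) - x\<bar> \<le> 200 * r)"

text \<open>The common engine for all structures. A copy is lost when the chosen triangle meets its
  edges; by \<open>hit_le\<close> and \<open>hit_ge\<close> the number of such triangles is
  \<open>n p^2\<close> times \<open>k\<close> plus the sum of \<open>h\<close>, up to 25. The bound
  \<open>D\<close> says that one edge lies in at most a constant multiple of the fraction
  \<open>r = 1 / (n p^3)\<close> of the predicted \<open>N * p ^ k\<close> copies, which limits the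
  largest jump.\<close>

lemma family_step:
  fixes E :: "'a set set" and h :: "'a set \<Rightarrow> real" and F :: "'i \<Rightarrow> 'a set set"
  assumes E: "finite E" and I: "finite I" and k: "\<And>\<iota>. \<iota> \<in> I \<Longrightarrow> card (F \<iota>) = k" "k \<le> 5" "0 < k"
    and g: "real (Q_var E) = real n ^ 3 * p ^ 3 / 6 * (1 + g)" "\<bar>g\<bar> \<le> 150 * eps\<^sup>2"
    and h: "\<And>e. e \<in> E \<Longrightarrow> tdeg E e = real n * p\<^sup>2 * (1 + h e)" "\<And>e. e \<in> E \<Longrightarrow> \<bar>h e\<bar> \<le> 12 * eps"
    and N: "0 < N" and z: "cnt I F E \<le> 2 * (N * p ^ k)"
    and D: "\<And>e. e \<in> E \<Longrightarrow> real (card {\<iota> \<in> I. F \<iota> \<subseteq> E \<and> e \<in> F \<iota>}) \<le> 16 * (N * p ^ k * r)"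
  shows "one_step E (cnt I F E / (N * p ^ k)) (\<lambda>E. cnt I F E / (N * p' ^ k))
    ((\<Sum>\<iota>\<in>{\<iota> \<in> I. F \<iota> \<subseteq> E}. \<Sum>e\<in>F \<iota>. h e) / (N * p ^ k))"
proof -
  define M where "M = N * p ^ k"
  define Q where "Q = real (Q_var E)"
  define A where "A = {\<iota> \<in> I. F \<iota> \<subseteq> E}"
  define S where "S = (\<Sum>\<iota>\<in>A. \<Sum>e\<in>F \<iota>. h e)"
  define C where "C = cnt I F E"
  define H where "H = (\<Sum>t\<in>triangles E. C - cnt I F (E - pairs t))"
  define m where "m = real n * p\<^sup>2"
  define u where "u = 1 / (1 - dl) ^ k"
  have M: "0 < M" using N p by (simp add: M_def)
  have m: "0 < m" using n_pos p by (simp add: m_def)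
  have C: "C = real (card A)" "0 \<le> C" by (simp_all add: C_def cnt_def A_def)
  have dl1: "dl < 1" using dl_small by linarith
  have M': "N * p' ^ k = M / u" by (simp add: M_def p'_def u_def power_mult_distrib)
  have u_pos: "0 < u" using dl1 by (simp add: u_def)
  have fA: "finite A" using I by (simp add: A_def)
  have fF: "finite (F \<iota>)" if "\<iota> \<in> A" for \<iota>
    using k that by (auto simp: A_def intro: card_ge_0_finite)
  have ft: "finite (triangles E)" using E by (rule finite_triangles)
  have cardQ: "real (card (triangles E)) = Q" by (simp add: Q_def Q_var_def)
  have sumdeg: "(\<Sum>e\<in>F \<iota>. tdeg E e) = m * (real k + (\<Sum>e\<in>F \<iota>. h e))" if \<iota>: "\<iota> \<in> A" for \<iota>
  proof -
    have "(\<Sum>e\<in>F \<iota>. tdeg E e) = (\<Sum>e\<in>F \<iota>. m * (1 + h e))"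
      using \<iota> h(1) by (intro sum.cong refl) (auto simp: A_def m_def)
    also have "\<dots> = m * (real (card (F \<iota>)) + (\<Sum>e\<in>F \<iota>. h e))"
      by (simp add: sum_distrib_left[symmetric] sum.distrib)
    finally show ?thesis using k(1) \<iota> by (simp add: A_def)
  qed
  have H_eq: "H = (\<Sum>\<iota>\<in>A. real (card {t \<in> triangles E. pairs t \<inter> F \<iota> \<noteq> {}}))"
    unfolding H_def C_def A_def by (rule sum_cnt_loss[OF I E])
  have H_le: "H \<le> m * (k * C + S)"
  proof -
    have "H \<le> (\<Sum>\<iota>\<in>A. \<Sum>e\<in>F \<iota>. tdeg E e)"
      unfolding H_eq by (intro sum_mono hit_le E fF)
    also have "\<dots> = m * (k * C + S)"
      by (simp add: sumdeg C S_def sum_distrib_left sum.distrib algebra_simps)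
    finally show ?thesis .
  qed
  \<comment> \<open>A copy has at most five edges, hence an overcount of at most
    \<open>5^2\<close>.\<close>
  have H_ge: "m * (k * C + S) - 25 * C \<le> H"
  proof -
    have "real k \<le> 5" using k(2) by simp
    then have k25: "(real k)\<^sup>2 \<le> 25" using power_mono[of "real k" 5 2] by simp
    have "m * (k * C + S) - 25 * C = (\<Sum>\<iota>\<in>A. (\<Sum>e\<in>F \<iota>. tdeg E e) - 25)"
      by (simp add: sumdeg C S_def sum_distrib_left sum.distrib sum_subtractf algebra_simps)
    also have "\<dots> \<le> (\<Sum>\<iota>\<in>A. (\<Sum>e\<in>F \<iota>. tdeg E e) - (real (card (F \<iota>)))\<^sup>2)"
      using k25 k(1) by (intro sum_mono) (auto simp: A_def)
    also have "\<dots> \<le> H" unfolding H_eq by (intro sum_mono hit_ge E fF)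
    finally show ?thesis .
  qed
  define z where "z = C / M"
  define s where "s = S / M"
  define \<tau> where "\<tau> = (m * (k * C + S) - H) / (m * M)"
  define X where "X = (real k * z + s - \<tau>) / (1 + g)"
  have zb: "0 \<le> z" "z \<le> 2" using assms(11) C M by (auto simp: z_def C_def M_def divide_le_eq)
  have "\<bar>S\<bar> \<le> (\<Sum>\<iota>\<in>A. 5 * (12 * eps))"
    unfolding S_def
  proof (rule order.trans[OF sum_abs], rule sum_mono)
    fix \<iota> assume \<iota>: "\<iota> \<in> A"
    have "\<bar>\<Sum>e\<in>F \<iota>. h e\<bar> \<le> (\<Sum>e\<in>F \<iota>. 12 * eps)"
      using h(2) \<iota> by (intro order.trans[OF sum_abs] sum_mono) (auto simp: A_def)
    also have "\<dots> = real k * (12 * eps)" using k(1) \<iota> by (simp add: A_def)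
    also have "\<dots> \<le> 5 * (12 * eps)" using k(2) eps_pos by (intro mult_right_mono) auto
    finally show "\<bar>\<Sum>e\<in>F \<iota>. h e\<bar> \<le> 5 * (12 * eps)" .
  qed
  then have "\<bar>S\<bar> \<le> C * (60 * eps)" by (simp add: C)
  also have "\<dots> \<le> C * (1/2)" using eps_small C by (intro mult_left_mono) auto
  finally have "\<bar>S\<bar> / M \<le> C * (1/2) / M" using M by (intro divide_right_mono) auto
  then have "\<bar>s\<bar> \<le> z / 2" using M by (simp add: s_def z_def)
  then have s: "\<bar>s\<bar> \<le> 1" using zb by linarith
  have \<tau>0: "0 \<le> \<tau>" using H_le m M by (simp add: \<tau>_def)
  have "\<tau> \<le> 25 * C / (m * M)"
    unfolding \<tau>_def using H_ge m M by (intro divide_right_mono) auto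
  also have "\<dots> = 25 * z * (1 / m)" by (simp add: z_def)
  also have "\<dots> \<le> 25 * 2 * eps\<^sup>2"
    using zb r_ge(3) r_eps r_pos m by (intro mult_mono) (auto simp: m_def)
  finally have \<tau>1: "\<tau> \<le> 50 * eps\<^sup>2" by simp
  have e2: "eps\<^sup>2 \<le> 1/1000000000" using eps_sq_small by simp
  note R = relative_drift[OF k(2) e2 less_imp_le[OF dl_pos] dl_small(2) g(2) zb s \<tau>0 \<tau>1,
      folded X_def u_def]
  have g1: "0 < 1 + g" using g(2) e2 by linarith
  have "0 < real n ^ 3 * p ^ 3 / 6 * (1 + g)" using g1 n_pos p by simp
  then have Qpos: "0 < Q" by (simp only: Q_def g(1))
  have HX: "H / M = Q * (dl * X)"
  proof -
    have "m * M * (real k * z + s - \<tau>) = H" using m M by (simp add: z_def s_def \<tau>_def field_simps)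
    moreover have "X * (1 + g) = real k * z + s - \<tau>" using g1 by (simp add: X_def)
    ultimately have "m * M * (X * (1 + g)) = H" by simp
    then have "H / M = m * (X * (1 + g))" using M by (auto simp: field_simps)
    \<comment> \<open>The typical codegree divided by the predicted number of triangles is exactly
      \<open>dl\<close>, the relative decrease of \<open>p\<close>.\<close>
    moreover have "Q * dl = m * (1 + g)"
      using n_pos p by (simp add: Q_def g(1) dl_def m_def power2_eq_square power3_eq_cube field_simps)
    moreover have "m * (X * (1 + g)) = m * (1 + g) * X" by simp
    ultimately have "H / M = Q * dl * X" by (simp only:)
    then show ?thesis by (simp only: mult.assoc)
  qed
  have W: "cnt I F E' / (N * p' ^ k) = u * (cnt I F E' / M)" for E' :: "'a set set"
    using u_pos by (simp add: M')
  have sumC: "(\<Sum>t\<in>triangles E. cnt I F (E - pairs t)) = Q * C - H"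
    by (simp add: H_def sum_subtractf cardQ)
  have part1: "(\<Sum>t\<in>triangles E. cnt I F (E - pairs t) / (N * p' ^ k) - z) + Q * (dl * s)
      = Q * (u * (z - dl * X) - z + dl * s)"
  proof -
    have "(\<Sum>t\<in>triangles E. cnt I F (E - pairs t) / (N * p' ^ k) - z)
        = u * ((\<Sum>t\<in>triangles E. cnt I F (E - pairs t)) / M) - Q * z"
      unfolding W by (simp add: sum_subtractf sum_distrib_left sum_divide_distrib cardQ)
    also have "\<dots> = u * (Q * z - Q * (dl * X)) - Q * z"
      unfolding sumC by (simp add: diff_divide_distrib HX z_def)
    finally show ?thesis by (simp add: algebra_simps)
  qed
  \<comment> \<open>Loss and rescaling have known signs, so the first absolute moment reduces to the
    mean loss \<open>H\<close>.\<close>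
  have pt: "\<bar>cnt I F (E - pairs t) / (N * p' ^ k) - z\<bar> \<le> u * ((C - cnt I F (E - pairs t)) / M) + (u - 1) * z" for t
  proof -
    have eq: "cnt I F (E - pairs t) / (N * p' ^ k) - z
       = (u - 1) * z - u * ((C - cnt I F (E - pairs t)) / M)"
      unfolding W by (simp add: z_def algebra_simps diff_divide_distrib)
    have "0 \<le> u * ((C - cnt I F (E - pairs t)) / M)"
      using cnt_mono[OF I, of "E - pairs t" E F] u_pos M by (simp add: C_def)
    moreover have "0 \<le> (u - 1) * z" using R(3) zb by simp
    moreover have "\<bar>b - a\<bar> \<le> a + b" if "0 \<le> a" "0 \<le> b" for a b :: real using that by linarith
    ultimately show ?thesis unfolding eq by blast
  qed
  have uz: "(u - 1) * z \<le> 12 * dl"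
    using mult_mono[OF R(4) zb(2)] zb dl_pos by simp
  have u2: "u \<le> 101/100" using R(4) dl_small by linarith
  have part2: "(\<Sum>t\<in>triangles E. \<bar>cnt I F (E - pairs t) / (N * p' ^ k) - z\<bar>) \<le> Q * (50 * dl)"
  proof -
    have "(\<Sum>t\<in>triangles E. \<bar>cnt I F (E - pairs t) / (N * p' ^ k) - z\<bar>)
        \<le> (\<Sum>t\<in>triangles E. u * ((C - cnt I F (E - pairs t)) / M) + (u - 1) * z)"
      by (intro sum_mono pt)
    also have "\<dots> = u * (H / M) + Q * ((u - 1) * z)"
      by (simp add: sum.distrib sum_distrib_left sum_divide_distrib cardQ H_def)
    also have "\<dots> = Q * (u * (dl * X) + (u - 1) * z)" by (simp add: HX algebra_simps)
    also have "\<dots> \<le> Q * (50 * dl)"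
    proof -
      have "u * (dl * X) \<le> (101/100) * (dl * 12)"
        using u2 u_pos R(2) dl_pos
        by (intro order.trans[OF mult_left_mono mult_right_mono]) auto
      then have "u * (dl * X) + (u - 1) * z \<le> 50 * dl" using uz dl_pos by linarith
      then show ?thesis using Qpos by (intro mult_left_mono) auto
    qed
    finally show ?thesis .
  qed
  have part3: "\<bar>cnt I F (E - pairs t) / (N * p' ^ k) - z\<bar> \<le> 200 * r" if t: "t \<in> triangles E" for t
  proof -
    have "C - cnt I F (E - pairs t) \<le> 3 * (16 * (M * r))"
    proof -
      have t3: "card t = 3" using t by (simp add: triangles_def)
      have "0 \<le> 16 * (M * r)" using M r_pos by simp
      then show ?thesis
        unfolding C_def by (intro cnt_loss_le[OF I t3] D[folded M_def])
    qed
    then have "(C - cnt I F (E - pairs t)) / M \<le> 48 * r" using M by (simp add: divide_le_eq mult.commute)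
    then have "u * ((C - cnt I F (E - pairs t)) / M) \<le> (101/100) * (48 * r)"
      using u2 u_pos r_pos by (intro order.trans[OF mult_left_mono mult_right_mono]) auto
    then show ?thesis using pt[of t] uz dl_r r_pos by linarith
  qed
  show ?thesis
    unfolding one_step_def using part1 part2 part3 R(1) Qpos
    unfolding z_def s_def S_def C_def A_def M_def[symmetric] Q_def[symmetric]
    by (auto simp: abs_mult mult_left_mono)
qed

lemma one_step_diff:
  assumes "one_step E x x' s" "one_step E z z' r'"
  shows
    "\<bar>(\<Sum>t\<in>triangles E. (x' (E - pairs t) - z' (E - pairs t)) - (x - z)) + Q_var E * (dl * (s - r'))\<bar>
      \<le> Q_var E * (4000 * dl * eps\<^sup>2)"
    "(\<Sum>t\<in>triangles E. \<bar>(x' (E - pairs t) - z' (E - pairs t)) - (x - z)\<bar>) \<le> Q_var E * (100 * dl)"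
    "\<And>t. t \<in> triangles E \<Longrightarrow> \<bar>(x' (E - pairs t) - z' (E - pairs t)) - (x - z)\<bar> \<le> 400 * r"
proof -
  have eq: "(\<Sum>t\<in>triangles E. (x' (E - pairs t) - z' (E - pairs t)) - (x - z)) + Q_var E * (dl * (s - r'))
     = ((\<Sum>t\<in>triangles E. x' (E - pairs t) - x) + Q_var E * (dl * s))
       - ((\<Sum>t\<in>triangles E. z' (E - pairs t) - z) + Q_var E * (dl * r'))"
    by (simp add: sum_subtractf sum.distrib algebra_simps)
  show "\<bar>(\<Sum>t\<in>triangles E. (x' (E - pairs t) - z' (E - pairs t)) - (x - z)) + Q_var E * (dl * (s - r'))\<bar>
      \<le> Q_var E * (4000 * dl * eps\<^sup>2)"
    unfolding eq using assms unfolding one_step_def by linarith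
  have "(\<Sum>t\<in>triangles E. \<bar>(x' (E - pairs t) - z' (E - pairs t)) - (x - z)\<bar>)
    \<le> (\<Sum>t\<in>triangles E. \<bar>x' (E - pairs t) - x\<bar> + \<bar>z' (E - pairs t) - z\<bar>)"
    by (intro sum_mono) linarith
  then show "(\<Sum>t\<in>triangles E. \<bar>(x' (E - pairs t) - z' (E - pairs t)) - (x - z)\<bar>) \<le> Q_var E * (100 * dl)"
    using assms unfolding one_step_def sum.distrib by linarith
  show "\<bar>(x' (E - pairs t) - z' (E - pairs t)) - (x - z)\<bar> \<le> 400 * r" if "t \<in> triangles E" for t
  proof -
    have "\<bar>x' (E - pairs t) - x\<bar> \<le> 200 * r" "\<bar>z' (E - pairs t) - z\<bar> \<le> 200 * r"
      using assms that unfolding one_step_def by blast+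
    then show ?thesis by linarith
  qed
qed

end

subsection \<open>The structures around given vertices\<close>

text \<open>
  \<open>IT\<close>, \<open>FT\<close> count ordered pairs, hence \<open>2 T\<^sub>u\<close>, and \<open>IV\<close>, \<open>FV\<close> likewise \<open>2 V\<^sub>u\<close>.
\<close>

definition adj :: "nat set set \<Rightarrow> nat \<Rightarrow> nat \<Rightarrow> real" where
  "adj E x y = of_bool ({x, y} \<in> E)"

definition I1 :: "nat \<Rightarrow> nat \<Rightarrow> nat set" where "I1 n u = {1..n} - {u}"
definition F1 :: "nat \<Rightarrow> nat \<Rightarrow> nat set set" where "F1 u x = {{u, x}}"
definition I2 :: "nat \<Rightarrow> nat \<Rightarrow> nat \<Rightarrow> nat set" where "I2 n u v = {1..n} - {u, v}"
definition F2 :: "nat \<Rightarrow> nat \<Rightarrow> nat \<Rightarrow> nat set set" where "F2 u v x = {{u, x}, {v, x}}"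
definition I3 :: "nat \<Rightarrow> nat \<Rightarrow> nat \<Rightarrow> nat \<Rightarrow> nat set" where "I3 n u v w = {1..n} - {u, v, w}"
definition F3 :: "nat \<Rightarrow> nat \<Rightarrow> nat \<Rightarrow> nat \<Rightarrow> nat set set" where
  "F3 u v w x = {{u, x}, {v, x}, {w, x}}"
definition IT :: "nat \<Rightarrow> nat \<Rightarrow> (nat \<times> nat) set" where
  "IT n u = {(x, y). x \<in> {1..n} \<and> y \<in> {1..n} \<and> distinct [u, x, y]}"
definition FT :: "nat \<Rightarrow> nat \<times> nat \<Rightarrow> nat set set" where
  "FT u = (\<lambda>(x, y). {{u, x}, {u, y}, {x, y}})"
definition IR :: "nat \<Rightarrow> nat \<Rightarrow> nat \<Rightarrow> (nat \<times> nat) set" where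
  "IR n u v = {(x, y). x \<in> {1..n} \<and> y \<in> {1..n} \<and> distinct [u, v, x, y]}"
definition FR :: "nat \<Rightarrow> nat \<Rightarrow> nat \<times> nat \<Rightarrow> nat set set" where
  "FR u v = (\<lambda>(x, y). {{u, x}, {v, x}, {u, y}, {x, y}})"
definition IV :: "nat \<Rightarrow> nat \<Rightarrow> (nat \<times> nat \<times> nat) set" where
  "IV n u = {(x, y, z). x \<in> {1..n} \<and> y \<in> {1..n} \<and> z \<in> {1..n} \<and> distinct [u, x, y, z]}"
definition FV :: "nat \<Rightarrow> nat \<times> nat \<times> nat \<Rightarrow> nat set set" where
  "FV u = (\<lambda>(x, y, z). {{u, x}, {u, y}, {x, y}, {x, z}, {y, z}})"

lemma finite_families [simp]:
  "finite (I1 n u)" "finite (I2 n u v)" "finite (I3 n u v w)" "finite (IT n u)" "finite (IR n u v)"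
  "finite (IV n u)"
proof -
  have "IT n u \<subseteq> {1..n} \<times> {1..n}" by (auto simp: IT_def)
  then show "finite (IT n u)" by (rule finite_subset) simp
  have "IR n u v \<subseteq> {1..n} \<times> {1..n}" by (auto simp: IR_def)
  then show "finite (IR n u v)" by (rule finite_subset) simp
  have "IV n u \<subseteq> {1..n} \<times> {1..n} \<times> {1..n}" by (auto simp: IV_def)
  then show "finite (IV n u)" by (rule finite_subset) simp
qed (simp_all add: I1_def I2_def I3_def)

lemma card_F1: "\<iota> \<in> I1 n u \<Longrightarrow> card (F1 u \<iota>) = 1"
  by (simp add: F1_def)

lemma card_F2: "u \<noteq> v \<Longrightarrow> \<iota> \<in> I2 n u v \<Longrightarrow> card (F2 u v \<iota>) = 2"
  by (simp add: I2_def F2_def doubleton_eq_iff)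

lemma card_F3: "distinct [u, v, w] \<Longrightarrow> \<iota> \<in> I3 n u v w \<Longrightarrow> card (F3 u v w \<iota>) = 3"
  by (simp add: I3_def F3_def doubleton_eq_iff)

lemma card_FT: "\<iota> \<in> IT n u \<Longrightarrow> card (FT u \<iota>) = 3"
  by (cases \<iota>) (simp add: IT_def FT_def doubleton_eq_iff)

lemma card_FR: "u \<noteq> v \<Longrightarrow> \<iota> \<in> IR n u v \<Longrightarrow> card (FR u v \<iota>) = 4"
  by (cases \<iota>) (simp add: IR_def FR_def doubleton_eq_iff)

lemma card_FV: "\<iota> \<in> IV n u \<Longrightarrow> card (FV u \<iota>) = 5"
  by (cases \<iota>) (simp add: IV_def FV_def doubleton_eq_iff)

lemma adj_sym: "adj E x y = adj E y x"
  by (simp add: adj_def insert_commute)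

lemma adj_nonneg [simp]: "0 \<le> adj E x y"
  by (simp add: adj_def)

lemma adj_sq [simp]: "adj E x y * adj E x y = adj E x y" "adj E x y * (adj E x y * c) = adj E x y * c"
  by (simp_all add: adj_def)

lemma adj_neq_0 [simp]: "adj E x y \<noteq> 0 \<longleftrightarrow> {x, y} \<in> E" "adj E x y = 0 \<longleftrightarrow> {x, y} \<notin> E"
  by (simp_all add: adj_def)

section \<open>Counts as sums of adjacency indicators\<close>

locale packing_graph =
  fixes n :: nat and E :: "nat set set"
  assumes E_sub: "E \<subseteq> pairs {1..n}"
begin

abbreviation "V \<equiv> {1..n}"
abbreviation "A \<equiv> adj E"

lemma edgeD:
  assumes "{x, y} \<in> E"
  shows "x \<noteq> y" "y \<noteq> x" "x \<in> V" "y \<in> V"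
  using assms E_sub by (auto simp: pairs_def card_insert_if split: if_splits)

lemma edgeE:
  assumes "e \<in> E"
  obtains x y where "e = {x, y}" "x \<noteq> y" "x \<in> V" "y \<in> V"
proof -
  have "card e = 2" "e \<subseteq> V" using assms E_sub by (auto simp: pairs_def)
  then show ?thesis using that by (auto simp: card_2_iff)
qed

lemma singleton_notin_E [simp]: "{x} \<notin> E"
  using edgeD(1)[of x x] by auto

lemma finite_E: "finite E"
proof -
  have "pairs V \<subseteq> Pow V" by (auto simp: pairs_def)
  then show ?thesis using E_sub by (meson finite_Pow_iff finite_atLeastAtMost finite_subset)
qed

lemma adj_refl [simp]: "A x x = 0"
  by (simp add: adj_def)

definition "N u = {x \<in> V. {u, x} \<in> E}"

lemma finite_N [simp]: "finite (N u)"
  by (simp add: N_def)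

definition "deg u = (\<Sum>x\<in>V. A u x)"
definition "cd u v = (\<Sum>x\<in>V. A u x * A v x)"
definition "td u v w = (\<Sum>x\<in>V. A u x * A v x * A w x)"

lemma deg_card: "deg u = real (card (N u))"
  by (simp add: deg_def N_def adj_def Int_def)

lemma cd_sym: "cd u v = cd v u"
  by (simp add: cd_def mult.commute)

lemma cd_nonneg [simp]: "0 \<le> cd u v"
  by (auto simp: cd_def intro!: sum_nonneg)

lemma deg_nonneg [simp]: "0 \<le> deg u"
  by (auto simp: deg_def intro!: sum_nonneg)

lemma sum_I1: "(\<Sum>\<iota>\<in>{\<iota> \<in> I1 n u. F1 u \<iota> \<subseteq> E}. g \<iota>) = (\<Sum>x\<in>V. A u x * g x)" for g :: "nat \<Rightarrow> real"
  by (rule sum.mono_neutral_cong_left) (auto simp: I1_def F1_def adj_def)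

lemma sum_I2: "(\<Sum>\<iota>\<in>{\<iota> \<in> I2 n u v. F2 u v \<iota> \<subseteq> E}. g \<iota>) = (\<Sum>x\<in>V. A u x * A v x * g x)" for g :: "nat \<Rightarrow> real"
  by (rule sum.mono_neutral_cong_left) (auto simp: I2_def F2_def adj_def)

lemma sum_I3: "(\<Sum>\<iota>\<in>{\<iota> \<in> I3 n u v w. F3 u v w \<iota> \<subseteq> E}. g \<iota>)
    = (\<Sum>x\<in>V. A u x * A v x * A w x * g x)" for g :: "nat \<Rightarrow> real"
  by (rule sum.mono_neutral_cong_left) (auto simp: I3_def F3_def adj_def)

lemma sum_IT: "(\<Sum>\<iota>\<in>{\<iota> \<in> IT n u. FT u \<iota> \<subseteq> E}. g \<iota>)
    = (\<Sum>x\<in>V. \<Sum>y\<in>V. A u x * A u y * A x y * g (x, y))" for g :: "nat \<times> nat \<Rightarrow> real"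
proof -
  have eq: "{\<iota> \<in> IT n u. FT u \<iota> \<subseteq> E}
      = {\<iota> \<in> V \<times> V. {u, fst \<iota>} \<in> E \<and> {u, snd \<iota>} \<in> E \<and> {fst \<iota>, snd \<iota>} \<in> E}" (is "?L = ?R")
  proof (intro set_eqI)
    fix \<iota> show "\<iota> \<in> ?L \<longleftrightarrow> \<iota> \<in> ?R"
    proof (cases \<iota>)
      case (Pair x y)
      then show ?thesis using edgeD(1)[of u x] edgeD(1)[of u y] edgeD(1)[of x y]
        by (simp only: IT_def FT_def mem_Collect_eq case_prod_conv insert_subset empty_subsetI
          distinct.simps list.set insert_iff empty_iff mem_Sigma_iff fst_conv snd_conv) blast
    qed
  qed
  have "(\<Sum>\<iota>\<in>{\<iota> \<in> IT n u. FT u \<iota> \<subseteq> E}. g \<iota>)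
      = (\<Sum>\<iota>\<in>V \<times> V. A u (fst \<iota>) * A u (snd \<iota>) * A (fst \<iota>) (snd \<iota>) * g \<iota>)"
    unfolding eq by (rule sum.mono_neutral_cong_left) (auto simp: adj_def)
  then show ?thesis unfolding sum.cartesian_product by (simp add: case_prod_unfold)
qed

text \<open>Vertices joined by an edge are distinct automatically. Besides \<open>u\<close> and
  \<open>v\<close>, only the pair of \<open>y\<close> and \<open>v\<close> lacks such an edge, which
  is why it alone needs an indicator.\<close>

lemma sum_IR: "(\<Sum>\<iota>\<in>{\<iota> \<in> IR n u v. FR u v \<iota> \<subseteq> E}. g \<iota>)
    = (\<Sum>x\<in>V. \<Sum>y\<in>V. A u x * A v x * A u y * A x y * of_bool (y \<noteq> v) * g (x, y))"
    if uv: "u \<noteq> v" for g :: "nat \<times> nat \<Rightarrow> real"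
proof -
  have eq: "{\<iota> \<in> IR n u v. FR u v \<iota> \<subseteq> E}
      = {\<iota> \<in> V \<times> V. {u, fst \<iota>} \<in> E \<and> {v, fst \<iota>} \<in> E \<and> {u, snd \<iota>} \<in> E
          \<and> {fst \<iota>, snd \<iota>} \<in> E \<and> snd \<iota> \<noteq> v}" (is "?L = ?R")
  proof (intro set_eqI)
    fix \<iota> show "\<iota> \<in> ?L \<longleftrightarrow> \<iota> \<in> ?R"
    proof (cases \<iota>)
      case (Pair x y)
      then show ?thesis using uv edgeD(1)[of u x] edgeD(1)[of v x] edgeD(1)[of u y] edgeD(1)[of x y]
        by (simp only: IR_def FR_def mem_Collect_eq case_prod_conv insert_subset empty_subsetI
          distinct.simps list.set insert_iff empty_iff mem_Sigma_iff fst_conv snd_conv) blast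
    qed
  qed
  have "(\<Sum>\<iota>\<in>{\<iota> \<in> IR n u v. FR u v \<iota> \<subseteq> E}. g \<iota>)
      = (\<Sum>\<iota>\<in>V \<times> V. A u (fst \<iota>) * A v (fst \<iota>) * A u (snd \<iota>) * A (fst \<iota>) (snd \<iota>)
          * of_bool (snd \<iota> \<noteq> v) * g \<iota>)"
    unfolding eq by (rule sum.mono_neutral_cong_left) (auto simp: adj_def)
  then show ?thesis unfolding sum.cartesian_product by (simp add: case_prod_unfold)
qed

lemma sum_IV: "(\<Sum>\<iota>\<in>{\<iota> \<in> IV n u. FV u \<iota> \<subseteq> E}. g \<iota>)
    = (\<Sum>x\<in>V. \<Sum>y\<in>V. \<Sum>z\<in>V. A u x * A u y * A x y * A x z * A y z * of_bool (z \<noteq> u) * g (x, y, z))"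
    for g :: "nat \<times> nat \<times> nat \<Rightarrow> real"
proof -
  have eq: "{\<iota> \<in> IV n u. FV u \<iota> \<subseteq> E}
      = {\<iota> \<in> V \<times> V \<times> V. {u, fst \<iota>} \<in> E \<and> {u, fst (snd \<iota>)} \<in> E \<and> {fst \<iota>, fst (snd \<iota>)} \<in> E
          \<and> {fst \<iota>, snd (snd \<iota>)} \<in> E \<and> {fst (snd \<iota>), snd (snd \<iota>)} \<in> E \<and> snd (snd \<iota>) \<noteq> u}" (is "?L = ?R")
  proof (intro set_eqI)
    fix \<iota> show "\<iota> \<in> ?L \<longleftrightarrow> \<iota> \<in> ?R"
    proof (cases \<iota>)
      case (fields x y z)
      then show ?thesis using edgeD(1)[of u x] edgeD(1)[of u y] edgeD(1)[of x y] edgeD(1)[of x z] edgeD(1)[of y z]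
        by (simp only: IV_def FV_def mem_Collect_eq case_prod_conv insert_subset empty_subsetI
          distinct.simps list.set insert_iff empty_iff mem_Sigma_iff fst_conv snd_conv) blast
    qed
  qed
  have "(\<Sum>\<iota>\<in>{\<iota> \<in> IV n u. FV u \<iota> \<subseteq> E}. g \<iota>)
      = (\<Sum>\<iota>\<in>V \<times> V \<times> V. A u (fst \<iota>) * A u (fst (snd \<iota>)) * A (fst \<iota>) (fst (snd \<iota>))
          * A (fst \<iota>) (snd (snd \<iota>)) * A (fst (snd \<iota>)) (snd (snd \<iota>)) * of_bool (snd (snd \<iota>) \<noteq> u) * g \<iota>)"
    unfolding eq by (rule sum.mono_neutral_cong_left) (auto simp: adj_def)
  then show ?thesis unfolding sum.cartesian_product by (simp add: case_prod_unfold)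
qed

lemma cnt_as_sum: "finite I \<Longrightarrow> cnt I F E = (\<Sum>\<iota>\<in>{\<iota> \<in> I. F \<iota> \<subseteq> E}. 1)"
  by (simp add: cnt_def)

lemma cnt_I1: "cnt (I1 n u) (F1 u) E = deg u"
  by (subst cnt_as_sum) (simp_all only: finite_families sum_I1 deg_def mult_1_right)

lemma cnt_I2: "cnt (I2 n u v) (F2 u v) E = cd u v"
  by (subst cnt_as_sum) (simp_all only: finite_families sum_I2 cd_def mult_1_right)

lemma cnt_I3: "cnt (I3 n u v w) (F3 u v w) E = td u v w"
  by (subst cnt_as_sum) (simp_all only: finite_families sum_I3 td_def mult_1_right)

lemma cnt_IT: "cnt (IT n u) (FT u) E = (\<Sum>x\<in>V. A u x * cd u x)"
proof -
  have "cnt (IT n u) (FT u) E = (\<Sum>x\<in>V. \<Sum>y\<in>V. A u x * A u y * A x y)"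
    by (subst cnt_as_sum) (simp_all only: finite_families sum_IT mult_1_right)
  then show ?thesis by (simp add: cd_def sum_distrib_left mult.assoc)
qed

text \<open>The vertex \<open>y\<close> runs through the common neighbours of \<open>u\<close> and
  \<open>x\<close>. As \<open>x\<close> is adjacent to \<open>v\<close>, the forbidden value
  \<open>v\<close> is among them exactly when \<open>uv\<close> is an edge.\<close>

lemma cnt_IR:
  assumes "u \<noteq> v"
  shows "cnt (IR n u v) (FR u v) E = (\<Sum>x\<in>V. A u x * A v x * (cd u x - A u v))"
    "(\<Sum>y\<in>V. A u y * A x y * of_bool (y \<noteq> v)) = cd u x - A u v * A x v"
proof -
  show 1: "(\<Sum>y\<in>V. A u y * A x y * of_bool (y \<noteq> v)) = cd u x - A u v * A x v" for x
  proof -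
    have "cd u x - (\<Sum>y\<in>V. A u y * A x y * of_bool (y \<noteq> v)) = (\<Sum>y\<in>V. A u y * A x y * of_bool (y = v))"
      unfolding cd_def sum_subtractf[symmetric] by (intro sum.cong) auto
    also have "\<dots> = A u v * A x v"
    proof (cases "v \<in> V")
      case False
      then show ?thesis using edgeD(4)[of u v] by (auto simp: of_bool_def intro!: sum.neutral)
    qed (simp add: of_bool_def if_distrib[of "\<lambda>x. _ * x"] sum.delta cong: if_cong)
    finally show ?thesis by linarith
  qed
  have "cnt (IR n u v) (FR u v) E
      = (\<Sum>x\<in>V. \<Sum>y\<in>V. A u x * A v x * A u y * A x y * of_bool (y \<noteq> v))"
    using assms by (subst cnt_as_sum) (simp_all only: finite_families sum_IR[OF assms] mult_1_right)
  also have "\<dots> = (\<Sum>x\<in>V. A u x * A v x * (\<Sum>y\<in>V. A u y * A x y * of_bool (y \<noteq> v)))"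
    by (simp add: sum_distrib_left mult.assoc)
  also have "\<dots> = (\<Sum>x\<in>V. A u x * A v x * (cd u x - A u v))"
    unfolding 1 by (intro sum.cong refl) (auto simp: adj_def insert_commute)
  finally show "cnt (IR n u v) (FR u v) E = (\<Sum>x\<in>V. A u x * A v x * (cd u x - A u v))" .
qed

lemma sum_third: "(\<Sum>z\<in>V. A x z * A y z * of_bool (z \<noteq> u)) = cd x y - A x u * A y u"
proof -
  have "(\<Sum>z\<in>V. A x z * A y z * of_bool (z \<noteq> u)) = cd x y - A x u * A y u" if "x \<noteq> u"
    using cnt_IR(2)[OF that, of y] by simp
  moreover have "(\<Sum>z\<in>V. A x z * A y z * of_bool (z \<noteq> u)) = cd x y - A x u * A y u" if "x = u"
  proof -
    have "(\<Sum>z\<in>V. A x z * A y z * of_bool (z \<noteq> u)) = (\<Sum>z\<in>V. A x z * A y z)"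
      by (rule sum.cong[OF refl]) (auto simp: that)
    then show ?thesis using that by (simp add: cd_def)
  qed
  ultimately show ?thesis by blast
qed

lemma cnt_IV: "cnt (IV n u) (FV u) E = (\<Sum>x\<in>V. \<Sum>y\<in>V. A u x * A u y * A x y * (cd x y - 1))"
proof -
  have "cnt (IV n u) (FV u) E
      = (\<Sum>x\<in>V. \<Sum>y\<in>V. \<Sum>z\<in>V. A u x * A u y * A x y * A x z * A y z * of_bool (z \<noteq> u))"
    by (subst cnt_as_sum) (simp_all only: finite_families sum_IV mult_1_right)
  also have "\<dots> = (\<Sum>x\<in>V. \<Sum>y\<in>V. A u x * A u y * A x y * (\<Sum>z\<in>V. A x z * A y z * of_bool (z \<noteq> u)))"
    by (simp add: sum_distrib_left mult.assoc)
  also have "\<dots> = (\<Sum>x\<in>V. \<Sum>y\<in>V. A u x * A u y * A x y * (cd x y - 1))"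
    unfolding sum_third by (intro sum.cong refl) (auto simp: adj_def insert_commute)
  finally show ?thesis .
qed

lemma tdeg_eq:
  assumes "{x, y} \<in> E"
  shows "tdeg E {x, y} = cd x y"
proof -
  have xy: "x \<noteq> y" using edgeD assms by blast
  let ?Z = "{z \<in> V. {x, z} \<in> E \<and> {y, z} \<in> E}"
  have "bij_betw (\<lambda>z. {x, y, z}) ?Z {t \<in> triangles E. {x, y} \<in> pairs t}"
  proof (rule bij_betw_imageI)
    show "inj_on (\<lambda>z. {x, y, z}) ?Z"
      by (rule inj_onI) (use edgeD in \<open>fastforce\<close>)
    show "(\<lambda>z. {x, y, z}) ` ?Z = {t \<in> triangles E. {x, y} \<in> pairs t}"
    proof (intro set_eqI iffI)
      fix t assume "t \<in> (\<lambda>z. {x, y, z}) ` ?Z"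
      then obtain z where z: "t = {x, y, z}" "{x, z} \<in> E" "{y, z} \<in> E" by auto
      have ne: "x \<noteq> z" "y \<noteq> z" using z edgeD by blast+
      have "card t = 3" using xy ne z by simp
      moreover have "pairs t \<subseteq> E"
      proof
        fix e assume "e \<in> pairs t"
        then obtain a b where "e = {a, b}" "a \<noteq> b" "a \<in> t" "b \<in> t"
          by (auto simp: pairs_def card_2_iff)
        then show "e \<in> E" using z assms by (auto simp: insert_commute)
      qed
      moreover have "{x, y} \<in> pairs t" using xy z by (auto simp: pairs_def)
      ultimately show "t \<in> {t \<in> triangles E. {x, y} \<in> pairs t}" by (simp add: triangles_def)
    next
      fix t assume t: "t \<in> {t \<in> triangles E. {x, y} \<in> pairs t}"
      then have t3: "card t = 3" "pairs t \<subseteq> E" "x \<in> t" "y \<in> t" by (auto simp: triangles_def pairs_def)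
      then have "card (t - {x, y}) = 1" using xy by (subst card_Diff_subset) auto
      then obtain z where z: "t - {x, y} = {z}" by (auto simp: card_1_singleton_iff)
      then have zt: "t = {x, y, z}" "z \<noteq> x" "z \<noteq> y" using t3 by auto
      then have "{x, z} \<in> pairs t" "{y, z} \<in> pairs t" by (auto simp: pairs_def)
      then have "z \<in> ?Z" using t3 edgeD by blast
      then show "t \<in> (\<lambda>z. {x, y, z}) ` ?Z" using zt by blast
    qed
  qed
  then have "card ?Z = card {t \<in> triangles E. {x, y} \<in> pairs t}" by (rule bij_betw_same_card)
  then have "tdeg E {x, y} = real (card ?Z)" by (simp add: tdeg_def)
  also have "\<dots> = (\<Sum>z\<in>V. of_bool ({x, z} \<in> E \<and> {y, z} \<in> E))" by (simp add: Int_def)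
  also have "\<dots> = cd x y" unfolding cd_def by (intro sum.cong) (auto simp: adj_def)
  finally show ?thesis .
qed

section \<open>Copies through a given edge\<close>

lemma hit_F123:
  assumes "e \<in> E" and "\<And>x e. e \<in> F x \<Longrightarrow> x \<in> e"
  shows "real (card {x \<in> I. F x \<subseteq> E \<and> e \<in> F x}) \<le> 2"
proof -
  obtain a b where e: "e = {a, b}" using edgeE[OF assms(1)] by blast
  have "card {x \<in> I. F x \<subseteq> E \<and> e \<in> F x} \<le> card {a, b}"
    using assms(2) e by (intro card_mono) auto
  also have "\<dots> \<le> 2" by (auto simp: card_insert_if)
  finally show ?thesis by simp
qed

text \<open>One index is an end of \<open>e\<close>, the other is free. The crude factor
  \<open>n\<close> is enough because \<open>n^2 p^3 r = n\<close>; for \<open>FR\<close> and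
  \<open>FV\<close> the corresponding products are \<open>n p\<close> and \<open>(n p)^2\<close>, so
  degrees are needed there.\<close>

lemma hit_FT:
  assumes "e \<in> E"
  shows "real (card {x \<in> IT n u. FT u x \<subseteq> E \<and> e \<in> FT u x}) \<le> 4 * real n"
proof -
  obtain a b where e: "e = {a, b}" using edgeE[OF assms(1)] by blast
  have "{x \<in> IT n u. FT u x \<subseteq> E \<and> e \<in> FT u x} \<subseteq> {a, b} \<times> V \<union> V \<times> {a, b}"
  proof
    fix \<iota> assume \<iota>: "\<iota> \<in> {x \<in> IT n u. FT u x \<subseteq> E \<and> e \<in> FT u x}"
    then obtain x y where xy: "\<iota> = (x, y)" "x \<in> V" "y \<in> V" by (auto simp: IT_def)
    then have "x \<in> e \<or> y \<in> e" using \<iota> by (auto simp: FT_def)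
    then show "\<iota> \<in> {a, b} \<times> V \<union> V \<times> {a, b}" using xy e by auto
  qed
  then have "card {x \<in> IT n u. FT u x \<subseteq> E \<and> e \<in> FT u x} \<le> card ({a, b} \<times> V \<union> V \<times> {a, b})"
    by (intro card_mono) auto
  also have "\<dots> \<le> card ({a, b} \<times> V) + card (V \<times> {a, b})" by (rule card_Un_le)
  also have "\<dots> \<le> 2 * n + n * 2"
    unfolding card_cartesian_product by (intro add_mono mult_mono) (auto simp: card_insert_if)
  finally show ?thesis by simp
qed

lemma hit_FR:
  assumes "e \<in> E"
  shows "real (card {x \<in> IR n u v. FR u v x \<subseteq> E \<and> e \<in> FR u v x}) \<le> 4 * deg u"
proof -
  obtain a b where e: "e = {a, b}" using edgeE[OF assms(1)] by blast
  have "{x \<in> IR n u v. FR u v x \<subseteq> E \<and> e \<in> FR u v x} \<subseteq> {a, b} \<times> N u \<union> N u \<times> {a, b}"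
    by (auto simp: IR_def FR_def e N_def doubleton_eq_iff)
  then have "card {x \<in> IR n u v. FR u v x \<subseteq> E \<and> e \<in> FR u v x} \<le> card ({a, b} \<times> N u \<union> N u \<times> {a, b})"
    by (intro card_mono) auto
  also have "\<dots> \<le> card ({a, b} \<times> N u) + card (N u \<times> {a, b})" by (rule card_Un_le)
  also have "\<dots> \<le> 2 * card (N u) + card (N u) * 2"
    unfolding card_cartesian_product by (intro add_mono mult_mono) (auto simp: card_insert_if)
  finally show ?thesis by (simp add: deg_card)
qed

text \<open>Every edge of \<open>FV\<close> contains \<open>x\<close> or \<open>y\<close>. If
  \<open>x\<close> is an end of \<open>e\<close>, then \<open>y\<close> is a neighbour of
  \<open>u\<close> and \<open>z\<close> a neighbour of \<open>y\<close>; exchanging \<open>x\<close>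
  and \<open>y\<close> gives the other half.\<close>

lemma hit_FV:
  assumes "e \<in> E" and dm: "\<And>x. x \<in> V \<Longrightarrow> deg x \<le> D" and u: "u \<in> V"
  shows "real (card {x \<in> IV n u. FV u x \<subseteq> E \<and> e \<in> FV u x}) \<le> 4 * D\<^sup>2"
proof -
  obtain a b where e: "e = {a, b}" using edgeE[OF assms(1)] by blast
  define S where "S = {a, b} \<times> (SIGMA y:N u. N y)"
  have fS: "finite S" by (auto simp: S_def intro!: finite_SigmaI)
  have "{x \<in> IV n u. FV u x \<subseteq> E \<and> e \<in> FV u x} \<subseteq> S \<union> (\<lambda>(y, x, z). (x, y, z)) ` S"
    by (auto simp: IV_def FV_def e N_def S_def doubleton_eq_iff image_iff)
  then have "card {x \<in> IV n u. FV u x \<subseteq> E \<and> e \<in> FV u x} \<le> card (S \<union> (\<lambda>(y, x, z). (x, y, z)) ` S)"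
    using fS by (intro card_mono) auto
  also have "\<dots> \<le> card S + card S"
    using card_image_le[OF fS, of "\<lambda>(y, x, z). (x, y, z)"] by (intro order.trans[OF card_Un_le]) auto
  finally have 1: "real (card {x \<in> IV n u. FV u x \<subseteq> E \<and> e \<in> FV u x}) \<le> 2 * real (card S)"
    by linarith
  have D: "0 \<le> D" using dm[OF u] deg_nonneg[of u] by linarith
  have "real (card (SIGMA y:N u. N y)) = (\<Sum>y\<in>N u. deg y)"
    by (subst card_SigmaI) (auto simp: deg_card)
  also have "\<dots> \<le> (\<Sum>y\<in>N u. D)" by (intro sum_mono dm) (auto simp: N_def)
  also have "\<dots> = deg u * D" by (simp add: deg_card)
  also have "\<dots> \<le> D * D" using dm[OF u] D by (intro mult_right_mono) auto
  finally have "real (card {a, b}) * real (card (SIGMA y:N u. N y)) \<le> 2 * (D * D)"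
    by (intro mult_mono) (auto simp: card_insert_if intro!: sum_nonneg)
  then have "real (card S) \<le> 2 * (D * D)" by (simp add: S_def card_cartesian_product)
  then show ?thesis using 1 by (simp add: power2_eq_square)
qed

text \<open>Double counting of incidences between edges and triangles. The second identity expresses
  the total loss of triangles through squared codegrees, the starting point of
  \<open>zeta_le\<close>.\<close>

lemma sum_edges_tdeg: "(\<Sum>e\<in>E. tdeg E e) = 3 * real (Q_var E)"
  and sum_edges_tdeg_sq: "(\<Sum>t\<in>triangles E. \<Sum>e\<in>pairs t. tdeg E e) = (\<Sum>e\<in>E. (tdeg E e)\<^sup>2)"
proof -
  have ft: "finite (triangles E)" using finite_E by (rule finite_triangles)
  have td: "tdeg E e = (\<Sum>t\<in>triangles E. of_bool (e \<in> pairs t))" for e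
    using ft by (simp add: tdeg_def Int_def)
  have gen: "(\<Sum>t\<in>triangles E. \<Sum>e\<in>pairs t. f e) = (\<Sum>e\<in>E. tdeg E e * f e)" for f :: "nat set \<Rightarrow> real"
  proof -
    have "(\<Sum>t\<in>triangles E. \<Sum>e\<in>pairs t. f e) = (\<Sum>t\<in>triangles E. \<Sum>e\<in>E. of_bool (e \<in> pairs t) * f e)"
    proof (rule sum.cong[OF refl])
      fix t assume "t \<in> triangles E"
      then show "(\<Sum>e\<in>pairs t. f e) = (\<Sum>e\<in>E. of_bool (e \<in> pairs t) * f e)"
        by (intro sum.mono_neutral_cong_left finite_E) (auto simp: triangles_def)
    qed
    also have "\<dots> = (\<Sum>e\<in>E. tdeg E e * f e)"
      by (subst sum.swap) (simp add: td sum_distrib_right)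
    finally show ?thesis .
  qed
  have "(\<Sum>t\<in>triangles E. \<Sum>e\<in>pairs t. (1::real)) = (\<Sum>t\<in>triangles E. 3)"
    by (intro sum.cong refl) (simp add: card_pairs_triangle triangles_def)
  then show "(\<Sum>e\<in>E. tdeg E e) = 3 * real (Q_var E)" using gen[of "\<lambda>_. 1"] by (simp add: Q_var_def)
  show "(\<Sum>t\<in>triangles E. \<Sum>e\<in>pairs t. tdeg E e) = (\<Sum>e\<in>E. (tdeg E e)\<^sup>2)"
    using gen[of "tdeg E"] by (simp add: power2_eq_square)
qed

end

subsection \<open>First-order drifts\<close>

text \<open>Counts divided by their predictions. The exponent 1 is written out to match the shape of
  \<open>family_step\<close>.\<close>

definition "rel_Y1 n p u E = cnt (I1 n u) (F1 u) E / (real n * p ^ 1)"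
definition "rel_Y2 n p u v E = cnt (I2 n u v) (F2 u v) E / (real n * p ^ 2)"
definition "rel_Y3 n p u v w E = cnt (I3 n u v w) (F3 u v w) E / (real n * p ^ 3)"
definition "rel_T n p u E = cnt (IT n u) (FT u) E / ((real n)^2 * p ^ 3)"
definition "rel_R n p u v E = cnt (IR n u v) (FR u v) E / ((real n)^2 * p ^ 4)"
definition "rel_V n p u E = cnt (IV n u) (FV u) E / ((real n)^3 * p ^ 5)"
definition "rel_Q n p E = real (Q_var E) / (real n ^ 3 * p ^ 3 / 6)"

text \<open>
  With \<open>h\<close> and the relative deviation of \<open>\<rho>\<close> of order \<open>eps\<close>, replacing \<open>\<rho>\<close> by its typical value \<open>c\<close>
  is a second-order error. This is what closes the system of drifts.
\<close>

lemma decouple: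
  fixes w h \<rho> :: "'i \<Rightarrow> real"
  assumes w: "\<And>i. i \<in> I \<Longrightarrow> 0 \<le> w i" and h: "\<And>i. i \<in> I \<Longrightarrow> w i \<noteq> 0 \<Longrightarrow> \<bar>h i\<bar> \<le> a"
    and \<rho>: "\<And>i. i \<in> I \<Longrightarrow> w i \<noteq> 0 \<Longrightarrow> \<bar>\<rho> i - c\<bar> \<le> b"
  shows "\<bar>(\<Sum>i\<in>I. w i * h i * \<rho> i) - c * (\<Sum>i\<in>I. w i * h i)\<bar> \<le> a * b * (\<Sum>i\<in>I. w i)"
proof -
  have "(\<Sum>i\<in>I. w i * h i * \<rho> i) - c * (\<Sum>i\<in>I. w i * h i) = (\<Sum>i\<in>I. w i * (h i * (\<rho> i - c)))"
    unfolding sum_distrib_left sum_subtractf[symmetric]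
    by (intro sum.cong refl) (simp add: algebra_simps)
  also have "\<bar>\<dots>\<bar> \<le> (\<Sum>i\<in>I. w i * (a * b))"
  proof (intro order.trans[OF sum_abs] sum_mono)
    fix i assume i: "i \<in> I"
    show "\<bar>w i * (h i * (\<rho> i - c))\<bar> \<le> w i * (a * b)"
    proof (cases "w i = 0")
      case False
      have "\<bar>h i * (\<rho> i - c)\<bar> \<le> a * b"
        unfolding abs_mult using h[OF i False] \<rho>[OF i False] by (intro mult_mono) auto
      then show ?thesis using w[OF i] by (simp add: abs_mult mult_left_mono)
    qed simp
  qed
  also have "\<dots> = a * b * (\<Sum>i\<in>I. w i)" by (simp add: sum_distrib_left mult.commute)
  finally show ?thesis .
qed

lemma decouple2:
  fixes w h \<rho> :: "'i \<Rightarrow> 'j \<Rightarrow> real"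
  assumes w: "\<And>i j. i \<in> I \<Longrightarrow> j \<in> J \<Longrightarrow> 0 \<le> w i j"
    and h: "\<And>i j. i \<in> I \<Longrightarrow> j \<in> J \<Longrightarrow> w i j \<noteq> 0 \<Longrightarrow> \<bar>h i j\<bar> \<le> a"
    and \<rho>: "\<And>i j. i \<in> I \<Longrightarrow> j \<in> J \<Longrightarrow> w i j \<noteq> 0 \<Longrightarrow> \<bar>\<rho> i j - c\<bar> \<le> b"
  shows "\<bar>(\<Sum>i\<in>I. \<Sum>j\<in>J. w i j * h i j * \<rho> i j) - c * (\<Sum>i\<in>I. \<Sum>j\<in>J. w i j * h i j)\<bar>
    \<le> a * b * (\<Sum>i\<in>I. \<Sum>j\<in>J. w i j)"
  using decouple[of "I \<times> J" "\<lambda>(i, j). w i j" "\<lambda>(i, j). h i j" a "\<lambda>(i, j). \<rho> i j" c b] assms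
  by (simp add: sum.cartesian_product case_prod_unfold mem_Times_iff)

lemma abs_divide_diff_le:
  fixes X Y c M :: real
  assumes "0 < M" "\<bar>X - M * Y\<bar> \<le> M * c"
  shows "\<bar>X / M - Y\<bar> \<le> c"
proof -
  have "X / M - Y = (X - M * Y) / M" using assms(1) by (simp add: field_simps)
  then have "\<bar>X / M - Y\<bar> = \<bar>X - M * Y\<bar> / M" using assms(1) by simp
  then show ?thesis using assms by (simp add: divide_le_eq mult.commute)
qed

text \<open>A graph at which all tracked statistics are within their bounds; the constants are those
  of \<open>bnd\<close>. The edge count is exact, and its term \<open>- real n\<close> is left over
  from the \<open>n (n - 1) / 2\<close> edges at the start.\<close>

locale good_state = scale n p L + packing_graph n E for n p L E +
  assumes card_E: "2 * real (card E) = (real n)\<^sup>2 * p - real n"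
    and deg_close: "u \<in> {1..n} \<Longrightarrow> \<bar>rel_Y1 n p u E - 1\<bar> \<le> eps"
    and tri_close: "u \<in> {1..n} \<Longrightarrow> \<bar>rel_T n p u E - rel_Y1 n p u E\<bar> \<le> eps"
    and V_close: "u \<in> {1..n} \<Longrightarrow> \<bar>rel_V n p u E - rel_T n p u E\<bar> \<le> 2 * eps"
    and codeg_close: "u \<in> {1..n} \<Longrightarrow> v \<in> {1..n} \<Longrightarrow> u \<noteq> v \<Longrightarrow> \<bar>rel_Y2 n p u v E - 1\<bar> \<le> 12 * eps"
    and R_close: "u \<in> {1..n} \<Longrightarrow> v \<in> {1..n} \<Longrightarrow> u \<noteq> v \<Longrightarrow> \<bar>rel_R n p u v E - rel_Y2 n p u v E\<bar> \<le> 44/5 * eps"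
    and codeg3_close: "u \<in> {1..n} \<Longrightarrow> v \<in> {1..n} \<Longrightarrow> w \<in> {1..n} \<Longrightarrow> distinct [u, v, w] \<Longrightarrow>
      \<bar>rel_Y3 n p u v w E - 1\<bar> \<le> 25 * eps"
    and Q_close: "\<bar>rel_Q n p E - 1\<bar> \<le> 150 * eps\<^sup>2"
begin

definition "m = real n * p\<^sup>2"
definition "y u v = cd u v / m - 1"
definition "h e = tdeg E e / m - 1"
text \<open>Average codegree error over the edges at \<open>u\<close>; \<open>e_eq\<close>
  identifies it with a tracked difference of ratios.\<close>

definition "e u = (\<Sum>x\<in>V. A u x * y u x) / (real n * p)"

abbreviation hsum :: "'i set \<Rightarrow> ('i \<Rightarrow> nat set set) \<Rightarrow> real" where
  "hsum I F \<equiv> (\<Sum>\<iota>\<in>{\<iota> \<in> I. F \<iota> \<subseteq> E}. \<Sum>a\<in>F \<iota>. h a)"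

lemma m_pos: "0 < m"
  using n_pos p by (simp add: m_def)

lemma np_pos: "0 < real n * p"
  using n_pos p by simp

lemma y_sym: "y u v = y v u"
  by (simp add: y_def cd_sym)

lemma h_edge: "{a, b} \<in> E \<Longrightarrow> h {a, b} = y a b"
  by (simp add: h_def y_def tdeg_eq)

lemma rel_Y2_y: "rel_Y2 n p u v E = 1 + y u v"
  by (simp add: rel_Y2_def cnt_I2 y_def m_def)

lemma y_le: "u \<in> V \<Longrightarrow> v \<in> V \<Longrightarrow> u \<noteq> v \<Longrightarrow> \<bar>y u v\<bar> \<le> 12 * eps"
  using codeg_close[of u v] by (simp add: rel_Y2_y)

lemma y_edge_le: "{u, v} \<in> E \<Longrightarrow> \<bar>y u v\<bar> \<le> 12 * eps"
  using y_le edgeD by blast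

lemma cd_y: "cd u v = m * (1 + y u v)"
  using m_pos by (simp add: y_def)

text \<open>Makes corrections by 1 in a codegree harmless: relative to \<open>m\<close> they cost
  \<open>r\<close>, far below \<open>eps^2\<close>.\<close>

lemma m_large: "1 \<le> r * m" "r \<le> eps / 1000000000" "r \<le> eps\<^sup>2 / 1000000000"
proof -
  show "1 \<le> r * m" using r_ge(3) m_pos by (simp add: m_def divide_le_eq)
  show "r \<le> eps\<^sup>2 / 1000000000" using r_eps by simp
  then show "r \<le> eps / 1000000000" using eps_sq_small eps_pos by linarith
qed

lemma cd_dev:
  assumes "u \<in> V" "v \<in> V" "u \<noteq> v"
  shows "\<bar>cd u v - m\<bar> \<le> 12 * eps * m" "\<bar>cd u v - 1 - m\<bar> \<le> 13 * eps * m"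
    "\<bar>cd u v - A a b - m\<bar> \<le> 13 * eps * m"
proof -
  have "\<bar>cd u v - m\<bar> = \<bar>y u v\<bar> * m" using m_pos by (simp add: cd_y algebra_simps abs_mult)
  then show 1: "\<bar>cd u v - m\<bar> \<le> 12 * eps * m"
    using y_le[OF assms] m_pos by (simp add: mult_right_mono)
  have "r * m \<le> eps * m" using m_large m_pos eps_pos by (intro mult_right_mono) auto
  then have "1 \<le> eps * m" using m_large by linarith
  moreover have "0 \<le> A a b" "A a b \<le> 1" by (auto simp: adj_def)
  ultimately show "\<bar>cd u v - 1 - m\<bar> \<le> 13 * eps * m" "\<bar>cd u v - A a b - m\<bar> \<le> 13 * eps * m"
    using 1 by linarith+
qed

lemma td_dev:
  assumes "u \<in> V" "v \<in> V" "w \<in> V" "distinct [u, v, w]"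
  shows "\<bar>td u v w - real n * p^3\<bar> \<le> 25 * eps * (real n * p^3)"
proof -
  define P where "P = real n * p^3"
  have P: "0 < P" using np3_pos by (simp add: P_def)
  have "td u v w - P = (rel_Y3 n p u v w E - 1) * P"
    using P by (simp add: rel_Y3_def cnt_I3 P_def[symmetric] left_diff_distrib)
  then have "\<bar>td u v w - real n * p^3\<bar> = \<bar>rel_Y3 n p u v w E - 1\<bar> * (real n * p^3)"
    using P by (simp add: abs_mult P_def[symmetric])
  also have "\<dots> \<le> 25 * eps * (real n * p^3)"
    using codeg3_close[OF assms] np3_pos by (intro mult_right_mono) auto
  finally show ?thesis .
qed

lemma rel_bounds:
  "u \<in> V \<Longrightarrow> rel_Y1 n p u E \<le> 101/100" "u \<in> V \<Longrightarrow> rel_T n p u E \<le> 101/100"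
  "u \<in> V \<Longrightarrow> rel_V n p u E \<le> 101/100" "u \<in> V \<Longrightarrow> v \<in> V \<Longrightarrow> u \<noteq> v \<Longrightarrow> rel_Y2 n p u v E \<le> 101/100"
  "u \<in> V \<Longrightarrow> v \<in> V \<Longrightarrow> u \<noteq> v \<Longrightarrow> rel_R n p u v E \<le> 101/100"
  "u \<in> V \<Longrightarrow> v \<in> V \<Longrightarrow> w \<in> V \<Longrightarrow> distinct [u, v, w] \<Longrightarrow> rel_Y3 n p u v w E \<le> 101/100"
proof -
  have D: "rel_Y1 n p u E \<le> 1 + eps" "rel_T n p u E \<le> 1 + 2 * eps" "rel_V n p u E \<le> 1 + 4 * eps" if "u \<in> V"
    using deg_close[OF that] tri_close[OF that] V_close[OF that] by linarith+
  have Y: "rel_Y2 n p u v E \<le> 1 + 12 * eps" "rel_R n p u v E \<le> 1 + 21 * eps" if "u \<in> V" "v \<in> V" "u \<noteq> v"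
    using codeg_close[OF that] R_close[OF that] eps_pos by linarith+
  note small = eps_small eps_pos
  show "u \<in> V \<Longrightarrow> rel_Y1 n p u E \<le> 101/100" "u \<in> V \<Longrightarrow> rel_T n p u E \<le> 101/100"
    "u \<in> V \<Longrightarrow> rel_V n p u E \<le> 101/100"
    using D small by force+
  show "u \<in> V \<Longrightarrow> v \<in> V \<Longrightarrow> u \<noteq> v \<Longrightarrow> rel_Y2 n p u v E \<le> 101/100"
    "u \<in> V \<Longrightarrow> v \<in> V \<Longrightarrow> u \<noteq> v \<Longrightarrow> rel_R n p u v E \<le> 101/100"
    using Y small by force+
  show "u \<in> V \<Longrightarrow> v \<in> V \<Longrightarrow> w \<in> V \<Longrightarrow> distinct [u, v, w] \<Longrightarrow> rel_Y3 n p u v w E \<le> 101/100"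
    using codeg3_close[of u v w] small by (simp add: abs_le_iff)
qed

lemma deg_le: "u \<in> V \<Longrightarrow> deg u \<le> 101/100 * (real n * p)"
  using rel_bounds(1)[of u] n_pos p by (simp add: rel_Y1_def cnt_I1 divide_le_eq)

text \<open>Each neighbour \<open>x\<close> of \<open>u\<close> contributes its codegree
  \<open>m * (1 + y u x)\<close> to the ordered count behind \<open>rel_T\<close>.\<close>

lemma e_eq: "e u = rel_T n p u E - rel_Y1 n p u E"
proof -
  have "(\<Sum>x\<in>V. A u x * y u x) = (\<Sum>x\<in>V. A u x * cd u x) / m - deg u"
    unfolding deg_def sum_divide_distrib sum_subtractf[symmetric]
    by (intro sum.cong refl) (simp add: y_def algebra_simps)
  then have "e u = (\<Sum>x\<in>V. A u x * cd u x) / (m * (real n * p)) - deg u / (real n * p)"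
    by (simp add: e_def diff_divide_distrib)
  then show ?thesis
    by (simp add: rel_T_def rel_Y1_def cnt_IT cnt_I1 m_def power2_eq_square power3_eq_cube mult_ac)
qed

lemma e_le: "u \<in> V \<Longrightarrow> \<bar>e u\<bar> \<le> eps"
  using tri_close by (simp add: e_eq)

lemma e_sum: "(\<Sum>x\<in>V. A u x * y u x) = real n * p * e u"
  using n_pos p by (simp add: e_def)

abbreviation "wT u x z \<equiv> A u x * A u z * A x z"

lemma wT_sum: "(\<Sum>x\<in>V. \<Sum>z\<in>V. wT u x z) = (real n)\<^sup>2 * p^3 * rel_T n p u E"
proof -
  have "(\<Sum>x\<in>V. \<Sum>z\<in>V. wT u x z) = (\<Sum>x\<in>V. A u x * cd u x)"
    by (simp add: cd_def sum_distrib_left mult.assoc)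
  then show ?thesis using n_pos p by (simp add: rel_T_def cnt_IT)
qed

definition "psi u = (\<Sum>x\<in>V. \<Sum>z\<in>V. wT u x z * y x z)"

text \<open>\<open>V\<close> weights each ordered triangle at \<open>u\<close> by the codegree of
  the edge opposite \<open>u\<close>, less 1. So the errors of the opposite edges sum to the tracked
  difference of \<open>V\<close> and \<open>T\<close>, and the weaker bound on single codegrees is
  avoided.\<close>

lemma psi_eq: "psi u = (real n)\<^sup>2 * p^3 * ((rel_V n p u E - rel_T n p u E) + rel_T n p u E / m)"
proof -
  define P where "P = (real n)\<^sup>2 * p^3"
  define T where "T = rel_T n p u E"
  define X where "X = rel_V n p u E"
  define S where "S = (\<Sum>x\<in>V. \<Sum>z\<in>V. wT u x z * (cd x z - 1))"
  have pos: "0 < (real n)^3 * p^5" using n_pos p by simp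
  have PX: "(real n)^3 * p^5 = m * P"
    by (simp add: P_def m_def eval_nat_numeral)
  have S1: "S = m * P * X"
    using pos unfolding X_def rel_V_def cnt_IV S_def[symmetric] PX by (auto simp: zero_less_mult_iff)
  have W: "(\<Sum>x\<in>V. \<Sum>z\<in>V. wT u x z) = P * T" unfolding wT_sum P_def T_def ..
  have "S = (\<Sum>x\<in>V. \<Sum>z\<in>V. m * (wT u x z * y x z) + (m - 1) * wT u x z)"
    unfolding S_def by (intro sum.cong refl) (simp add: cd_y algebra_simps)
  also have "\<dots> = m * psi u + (m - 1) * (P * T)"
    by (simp only: psi_def W[symmetric] sum_distrib_left sum.distrib)
  finally have "m * psi u = m * (P * X + (P * T) / m - P * T)"
    using S1 m_pos by (simp add: algebra_simps)
  then have "psi u = P * X + (P * T) / m - P * T" using m_pos by simp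
  then show ?thesis by (simp add: P_def T_def X_def algebra_simps)
qed

lemma inner_cd: "(\<Sum>z\<in>V. wT u x z * c) = A u x * c * cd u x"
  unfolding cd_def sum_distrib_left by (intro sum.cong refl) simp

lemma triangle_sum_first:
  "(\<Sum>x\<in>V. \<Sum>z\<in>V. wT u x z * y u x) = (\<Sum>x\<in>V. A u x * y u x * cd u x)"
  "(\<Sum>x\<in>V. \<Sum>z\<in>V. wT u x z * y u z) = (\<Sum>x\<in>V. A u x * y u x * cd u x)"
proof -
  show 1: "(\<Sum>x\<in>V. \<Sum>z\<in>V. wT u x z * y u x) = (\<Sum>x\<in>V. A u x * y u x * cd u x)"
    by (simp only: inner_cd)
  have "(\<Sum>x\<in>V. \<Sum>z\<in>V. wT u x z * y u z) = (\<Sum>z\<in>V. \<Sum>x\<in>V. wT u x z * y u z)" by (rule sum.swap)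
  also have "\<dots> = (\<Sum>x\<in>V. \<Sum>z\<in>V. wT u x z * y u x)"
  proof (intro sum.cong refl)
    fix x z
    have "A z x = A x z" by (rule adj_sym)
    then show "wT u z x * y u x = wT u x z * y u x" by simp
  qed
  finally show "(\<Sum>x\<in>V. \<Sum>z\<in>V. wT u x z * y u z) = (\<Sum>x\<in>V. A u x * y u x * cd u x)" using 1 by simp
qed

definition "s2 u v = hsum (I2 n u v) (F2 u v) / (real n * p^2)"
definition "s3 u v w = hsum (I3 n u v w) (F3 u v w) / (real n * p^3)"
definition "sT u = hsum (IT n u) (FT u) / ((real n)\<^sup>2 * p^3)"
definition "sR u v = hsum (IR n u v) (FR u v) / ((real n)\<^sup>2 * p^4)"
definition "sV u = hsum (IV n u) (FV u) / ((real n)^3 * p^5)"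

lemma sum_F1: "hsum (I1 n u) (F1 u) = (\<Sum>x\<in>V. A u x * y u x)"
  unfolding sum_I1 by (intro sum.cong refl) (auto simp: F1_def adj_def h_edge)

lemma sum_F2:
  assumes "u \<noteq> v"
  shows "hsum (I2 n u v) (F2 u v)
    = (\<Sum>x\<in>V. A u x * A v x * (y u x + y v x))"
  unfolding sum_I2
proof (intro sum.cong refl)
  fix x
  show "A u x * A v x * (\<Sum>e\<in>F2 u v x. h e) = A u x * A v x * (y u x + y v x)"
  proof (cases "{u, x} \<in> E \<and> {v, x} \<in> E")
    case True
    then show ?thesis using assms edgeD(1)[of u x] edgeD(1)[of v x]
      by (simp add: F2_def doubleton_eq_iff h_edge)
  qed (auto simp: adj_def)
qed

text \<open>No cancellation is sought: three edges cost at most \<open>12 * eps\<close> each. The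
  error allowed for triple codegrees in the theorem is \<open>2 * sqrt L\<close> times
  \<open>eps\<close>, which leaves ample room.\<close>

lemma sum_F3_le:
  assumes uvw: "distinct [u, v, w]"
  shows "\<bar>hsum (I3 n u v w) (F3 u v w)\<bar> \<le> 36 * eps * td u v w"
proof -
  have "\<bar>hsum (I3 n u v w) (F3 u v w)\<bar>
      \<le> (\<Sum>\<iota>\<in>{\<iota> \<in> I3 n u v w. F3 u v w \<iota> \<subseteq> E}. 36 * eps)"
  proof (rule order.trans[OF sum_abs], rule sum_mono)
    fix \<iota> assume \<iota>: "\<iota> \<in> {\<iota> \<in> I3 n u v w. F3 u v w \<iota> \<subseteq> E}"
    have "\<bar>\<Sum>e\<in>F3 u v w \<iota>. h e\<bar> \<le> (\<Sum>e\<in>F3 u v w \<iota>. 12 * eps)"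
    proof (intro order.trans[OF sum_abs] sum_mono)
      fix e assume e: "e \<in> F3 u v w \<iota>"
      then have "e \<in> E" using \<iota> by auto
      then obtain a b where ab: "e = {a, b}" using edgeE by blast
      then show "\<bar>h e\<bar> \<le> 12 * eps" using \<open>e \<in> E\<close> h_edge y_edge_le by simp
    qed
    also have "\<dots> = 36 * eps" using card_F3[OF uvw, of \<iota> n] \<iota> by simp
    finally show "\<bar>\<Sum>e\<in>F3 u v w \<iota>. h e\<bar> \<le> 36 * eps" .
  qed
  also have "\<dots> = 36 * eps * cnt (I3 n u v w) (F3 u v w) E" by (simp add: cnt_def)
  finally show ?thesis by (simp only: cnt_I3)
qed

lemma sum_FT: "hsum (IT n u) (FT u)
    = (\<Sum>x\<in>V. \<Sum>z\<in>V. wT u x z * (y u x + y u z + y x z))"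
  unfolding sum_IT
proof (intro sum.cong refl)
  fix x z
  show "wT u x z * (\<Sum>e\<in>FT u (x, z). h e) = wT u x z * (y u x + y u z + y x z)"
  proof (cases "{u, x} \<in> E \<and> {u, z} \<in> E \<and> {x, z} \<in> E")
    case True
    then show ?thesis using edgeD(1)[of u x] edgeD(1)[of u z] edgeD(1)[of x z]
      by (simp add: FT_def doubleton_eq_iff h_edge)
  qed (auto simp: adj_def)
qed

abbreviation "wR u v x z \<equiv> A u x * A v x * A u z * A x z * of_bool (z \<noteq> v)"

lemma sum_FR:
  assumes "u \<noteq> v"
  shows "hsum (IR n u v) (FR u v)
    = (\<Sum>x\<in>V. \<Sum>z\<in>V. wR u v x z * (y u x + y v x + y u z + y x z))"
  unfolding sum_IR[OF assms]
proof (intro sum.cong refl)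
  fix x z
  show "wR u v x z * (\<Sum>e\<in>FR u v (x, z). h e) = wR u v x z * (y u x + y v x + y u z + y x z)"
  proof (cases "{u, x} \<in> E \<and> {v, x} \<in> E \<and> {u, z} \<in> E \<and> {x, z} \<in> E \<and> z \<noteq> v")
    case True
    then show ?thesis using assms edgeD(1)[of u x] edgeD(1)[of v x] edgeD(1)[of u z] edgeD(1)[of x z]
      by (simp add: FR_def doubleton_eq_iff h_edge)
  qed (auto simp: adj_def)
qed

abbreviation "wV u x z t \<equiv> A u x * A u z * A x z * A x t * A z t * of_bool (t \<noteq> u)"

lemma sum_FV: "hsum (IV n u) (FV u)
    = (\<Sum>x\<in>V. \<Sum>z\<in>V. \<Sum>t\<in>V. wV u x z t * (y u x + y u z + y x z + y x t + y z t))"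
  unfolding sum_IV
proof (intro sum.cong refl)
  fix x z t
  show "wV u x z t * (\<Sum>e\<in>FV u (x, z, t). h e) = wV u x z t * (y u x + y u z + y x z + y x t + y z t)"
  proof (cases "{u, x} \<in> E \<and> {u, z} \<in> E \<and> {x, z} \<in> E \<and> {x, t} \<in> E \<and> {z, t} \<in> E \<and> t \<noteq> u")
    case True
    then show ?thesis
      using edgeD(1)[of u x] edgeD(1)[of u z] edgeD(1)[of x z] edgeD(1)[of x t] edgeD(1)[of z t]
      by (simp add: FV_def doubleton_eq_iff h_edge)
  qed (auto simp: adj_def)
qed

text \<open>The two edges at \<open>u\<close> contribute \<open>e u\<close> each, once the weight
  \<open>cd u x\<close> is replaced by \<open>m\<close>; the opposite edge contributes the
  difference of \<open>V\<close> and \<open>T\<close> by \<open>psi_eq\<close>. Subtracting the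
  drift \<open>e u\<close> of the degree leaves \<open>e + q\<close>.\<close>

lemma drift_T:
  assumes u: "u \<in> V"
  shows "\<bar>hsum (IT n u) (FT u) / ((real n)\<^sup>2 * p^3)
    - (2 * e u + (rel_V n p u E - rel_T n p u E))\<bar> \<le> 300 * eps\<^sup>2"
proof (rule abs_divide_diff_le)
  define S where "S = (\<Sum>x\<in>V. A u x * y u x * cd u x)"
  define K where "K = m * (real n * p)"
  define q where "q = rel_V n p u E - rel_T n p u E"
  have K: "0 < K" using m_pos np_pos by (simp add: K_def)
  have M: "(real n)\<^sup>2 * p^3 = K" by (simp add: K_def m_def power2_eq_square power3_eq_cube)
  have "\<bar>S - m * (\<Sum>x\<in>V. A u x * y u x)\<bar> \<le> 12 * eps * (12 * eps * m) * (\<Sum>x\<in>V. A u x)"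
    unfolding S_def using y_edge_le cd_dev(1) u by (intro decouple) (auto dest: edgeD)
  also have "\<dots> \<le> 12 * eps * (12 * eps * m) * (101/100 * (real n * p))"
    using deg_le[OF u] eps_pos m_pos unfolding deg_def by (intro mult_left_mono) auto
  also have "\<dots> = K * (144 * 101/100 * eps\<^sup>2)" by (simp add: K_def power2_eq_square)
  finally have S: "\<bar>S - K * e u\<bar> \<le> K * (144 * 101/100 * eps\<^sup>2)"
    unfolding e_sum K_def by (simp only: mult.assoc)
  have T0: "0 \<le> rel_T n p u E" using p by (auto simp: rel_T_def intro!: divide_nonneg_nonneg)
  have "rel_T n p u E * (1 / m) \<le> (101/100) * r"
    using rel_bounds(2)[OF u] r_ge(3) r_pos m_pos by (intro mult_mono) (auto simp: m_def)
  then have "rel_T n p u E * (1 / m) \<le> eps\<^sup>2" using m_large(3) r_pos by linarith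
  then have T1: "rel_T n p u E / m \<le> eps\<^sup>2" by simp
  have P0: "psi u - K * q = K * (rel_T n p u E / m)"
    unfolding psi_eq M q_def by (simp only: distrib_left add_diff_cancel_left')
  have "0 \<le> rel_T n p u E / m" using T0 m_pos by simp
  then have P: "\<bar>psi u - K * q\<bar> \<le> K * eps\<^sup>2"
    unfolding P0 abs_mult using T1 K by (intro mult_mono; linarith)
  have "hsum (IT n u) (FT u) = S + S + psi u"
    unfolding sum_FT psi_def S_def distrib_left sum.distrib triangle_sum_first by (rule refl)
  then have "hsum (IT n u) (FT u) - K * (2 * e u + q)
      = 2 * (S - K * e u) + (psi u - K * q)"
    by (simp add: algebra_simps)
  moreover have "\<bar>2 * a + b\<bar> \<le> K * (300 * eps\<^sup>2)"
    if "\<bar>a\<bar> \<le> K * (144 * 101/100 * eps\<^sup>2)" "\<bar>b\<bar> \<le> K * eps\<^sup>2" for a b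
  proof -
    have "K * (144 * 101/100 * eps\<^sup>2) = 14544/100 * (K * eps\<^sup>2)"
      "K * (300 * eps\<^sup>2) = 300 * (K * eps\<^sup>2)" "0 \<le> K * eps\<^sup>2"
      using K by simp_all
    then show ?thesis using that by linarith
  qed
  ultimately show "\<bar>hsum (IT n u) (FT u)
      - (real n)\<^sup>2 * p^3 * (2 * e u + (rel_V n p u E - rel_T n p u E))\<bar> \<le> (real n)\<^sup>2 * p^3 * (300 * eps\<^sup>2)"
    unfolding M q_def[symmetric] using S P by (simp only:)
qed (use n_pos p in simp)

end

section \<open>Drifts of codegrees, of \<open>R\<close> and of \<open>V\<close>\<close>

context good_state
begin

definition "f u v = rel_R n p u v E - rel_Y2 n p u v E"
definition "phi u v = (\<Sum>x\<in>V. A u x * A v x * y u x)"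

lemma small_ratio: "c \<le> 101/100 \<Longrightarrow> 0 \<le> c \<Longrightarrow> c / m \<le> eps\<^sup>2"
proof -
  assume c: "c \<le> 101/100" "0 \<le> c"
  have "c * (1 / m) \<le> (101/100) * r"
    using c r_ge(3) r_pos m_pos by (intro mult_mono) (auto simp: m_def)
  then have "c * (1 / m) \<le> eps\<^sup>2" using m_large(3) r_pos by linarith
  then show ?thesis by simp
qed

text \<open>\<open>R\<close> weights each common neighbour \<open>x\<close> by
  \<open>cd u x\<close>, up to the exclusion of \<open>v\<close>. So the errors of the edges
  \<open>ux\<close> over the copies of \<open>Y2\<close> sum to \<open>m\<close> times the tracked
  difference \<open>f u v\<close>; the exclusion costs at most \<open>rel_Y2\<close>, which is below
  \<open>m * eps^2\<close>.\<close>

lemma phi_approx: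
  assumes uv: "u \<in> V" "v \<in> V" "u \<noteq> v"
  shows "\<bar>phi u v - m * f u v\<bar> \<le> m * eps\<^sup>2"
proof -
  define C where "C = cnt (IR n u v) (FR u v) E"
  have "C = (\<Sum>x\<in>V. A u x * A v x * cd u x) - A u v * cd u v"
    unfolding C_def cnt_IR(1)[OF uv(3)] cd_def[of u v] sum_distrib_left sum_subtractf[symmetric]
    by (intro sum.cong refl) (simp add: algebra_simps)
  moreover have "(\<Sum>x\<in>V. A u x * A v x * cd u x) = m * (\<Sum>x\<in>V. A u x * A v x) + m * phi u v"
    unfolding phi_def sum_distrib_left sum.distrib[symmetric]
    by (intro sum.cong refl) (simp add: cd_y algebra_simps)
  ultimately have 1: "C + A u v * cd u v = m * cd u v + m * phi u v" by (simp add: cd_def)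
  have C2: "C = m * (m * rel_R n p u v E)"
    using n_pos p by (simp add: rel_R_def C_def m_def power2_eq_square eval_nat_numeral)
  have cd2: "cd u v = m * rel_Y2 n p u v E" by (simp add: rel_Y2_y cd_y)
  have "m * (phi u v - m * f u v) = m * (A u v * rel_Y2 n p u v E)"
    using 1 unfolding C2 cd2 f_def by (simp add: algebra_simps)
  then have 2: "phi u v - m * f u v = A u v * rel_Y2 n p u v E" using m_pos by simp
  have rel_Y2: "0 \<le> rel_Y2 n p u v E" "rel_Y2 n p u v E \<le> 101/100"
    using rel_bounds(4)[OF uv] p by (auto simp: rel_Y2_def)
  have "A u v * rel_Y2 n p u v E \<le> 1 * rel_Y2 n p u v E" using rel_Y2 by (intro mult_right_mono) (auto simp: adj_def)
  also have "\<dots> \<le> m * eps\<^sup>2" using small_ratio[OF rel_Y2(2,1)] m_pos by (simp add: divide_le_eq mult.commute)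
  finally show ?thesis unfolding 2 using rel_Y2 by simp
qed

lemma phi_approx_scaled:
  assumes "u \<in> V" "v \<in> V" "u \<noteq> v"
  shows "\<bar>m * phi u v - m * m * f u v\<bar> \<le> m * m * eps\<^sup>2"
proof -
  have "m * phi u v - m * m * f u v = m * (phi u v - m * f u v)" by (simp add: algebra_simps)
  then show ?thesis using phi_approx[OF assms] m_pos by (simp add: abs_mult mult.assoc)
qed

lemma drift_2:
  assumes uv: "u \<in> V" "v \<in> V" "u \<noteq> v"
  shows "\<bar>hsum (I2 n u v) (F2 u v) / (real n * p^2)
    - (f u v + f v u)\<bar> \<le> 2 * eps\<^sup>2"
  unfolding m_def[symmetric]
proof (rule abs_divide_diff_le[OF m_pos])
  have eq: "hsum (I2 n u v) (F2 u v) = phi u v + phi v u"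
    unfolding sum_F2[OF uv(3)] phi_def distrib_left sum.distrib by (simp add: mult.commute)
  show "\<bar>hsum (I2 n u v) (F2 u v) - m * (f u v + f v u)\<bar>
      \<le> m * (2 * eps\<^sup>2)"
  proof -
    have "\<bar>phi u v + phi v u - m * (f u v + f v u)\<bar> = \<bar>(phi u v - m * f u v) + (phi v u - m * f v u)\<bar>"
      by (simp add: algebra_simps)
    also have "\<dots> \<le> m * eps\<^sup>2 + m * eps\<^sup>2"
      using phi_approx[OF uv] phi_approx[of v u] uv by (intro order.trans[OF abs_triangle_ineq] add_mono) auto
    finally show ?thesis unfolding eq by simp
  qed
qed

lemma drift_3:
  assumes "u \<in> V" "v \<in> V" "w \<in> V" and uvw: "distinct [u, v, w]"
  shows "\<bar>hsum (I3 n u v w) (F3 u v w) / (real n * p^3)\<bar>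
    \<le> 365/10 * eps"
proof -
  let ?S = "hsum (I3 n u v w) (F3 u v w)"
  have "\<bar>?S / (real n * p^3)\<bar> = \<bar>?S\<bar> / (real n * p^3)"
    using np3_pos by (simp add: abs_divide)
  also have "\<dots> \<le> 36 * eps * td u v w / (real n * p^3)"
    using sum_F3_le[OF uvw] np3_pos by (intro divide_right_mono) auto
  also have "\<dots> = 36 * eps * rel_Y3 n p u v w E" by (simp add: rel_Y3_def cnt_I3)
  also have "\<dots> \<le> 36 * eps * (101/100)"
    using rel_bounds(6)[OF assms] eps_pos by (intro mult_left_mono) auto
  also have "\<dots> \<le> 365/10 * eps" using eps_pos by simp
  finally show ?thesis .
qed

lemma A_le_1: "A a b \<le> 1"
  by (simp add: adj_def)

lemma inner_R:
  assumes "u \<noteq> v"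
  shows "(\<Sum>z\<in>V. wR u v x z * c) = A u x * A v x * c * (cd u x - A u v * A x v)"
  unfolding cnt_IR(2)[OF assms, of x, symmetric] sum_distrib_left by (intro sum.cong refl) simp

text \<open>The edges \<open>ux\<close> and \<open>vx\<close> reproduce the drift of
  \<open>Y2\<close>, which cancels in the difference. The edge \<open>uz\<close> contributes
  \<open>e u\<close>, at most \<open>eps\<close>, once its weight is replaced by a constant. The
  edge \<open>xz\<close> is bounded only by the largest codegree error \<open>12 * eps\<close>.
  Hence 13.\<close>

lemma drift_R:
  assumes uv: "u \<in> V" "v \<in> V" "u \<noteq> v"
  shows "\<bar>hsum (IR n u v) (FR u v) / ((real n)\<^sup>2 * p^4)
    - (f u v + f v u)\<bar> \<le> 13 * eps + 1000 * eps\<^sup>2"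
proof (rule abs_divide_diff_le)
  define K where "K = m * m"
  define P where "P = real n * p^3"
  have K: "0 < K" using m_pos by (simp add: K_def)
  have P: "0 < P" using np3_pos by (simp add: P_def)
  have M: "(real n)\<^sup>2 * p^4 = K" by (simp add: K_def m_def power2_eq_square eval_nat_numeral)
  have PK: "P * (real n * p) = K" by (simp add: K_def P_def m_def power2_eq_square eval_nat_numeral)
  have Ke: "0 \<le> K * eps\<^sup>2" using K by simp
  define \<rho> where "\<rho> x = cd u x - A u v * A x v" for x
  have cd_le: "cd u v \<le> 101/100 * m"
    using rel_bounds(4)[OF uv] m_pos by (simp add: rel_Y2_y cd_y mult.commute)
  have bound: "12 * eps * (13 * eps * m) * (\<Sum>x\<in>V. A u x * A v x) \<le> K * (158 * eps\<^sup>2)"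
  proof -
    have "12 * eps * (13 * eps * m) * (\<Sum>x\<in>V. A u x * A v x) \<le> 12 * eps * (13 * eps * m) * (101/100 * m)"
      using cd_le eps_pos m_pos unfolding cd_def by (intro mult_left_mono) auto
    also have "\<dots> = K * (15756/100 * eps\<^sup>2)" by (simp add: K_def power2_eq_square)
    also have "\<dots> \<le> K * (158 * eps\<^sup>2)" using K by (intro mult_left_mono) auto
    finally show ?thesis .
  qed
  have \<rho>: "\<bar>\<rho> x - m\<bar> \<le> 13 * eps * m" if "A u x * A v x \<noteq> 0" for x
  proof -
    have x: "{u, x} \<in> E" "{v, x} \<in> E" using that by auto
    then have "A x v = 1" by (simp add: adj_def insert_commute)
    then show ?thesis unfolding \<rho>_def using cd_dev(3)[of u x u v] edgeD[OF x(1)] by simp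
  qed
  define R1 where "R1 = (\<Sum>x\<in>V. \<Sum>z\<in>V. wR u v x z * y u x)"
  define R2 where "R2 = (\<Sum>x\<in>V. \<Sum>z\<in>V. wR u v x z * y v x)"
  define R3 where "R3 = (\<Sum>x\<in>V. \<Sum>z\<in>V. wR u v x z * y u z)"
  define R4 where "R4 = (\<Sum>x\<in>V. \<Sum>z\<in>V. wR u v x z * y x z)"
  have "R1 = (\<Sum>x\<in>V. A u x * A v x * y u x * \<rho> x)" unfolding R1_def \<rho>_def by (simp only: inner_R[OF uv(3)])
  moreover have "\<bar>(\<Sum>x\<in>V. A u x * A v x * y u x * \<rho> x) - m * (\<Sum>x\<in>V. A u x * A v x * y u x)\<bar>
      \<le> 12 * eps * (13 * eps * m) * (\<Sum>x\<in>V. A u x * A v x)"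
    using \<rho> y_edge_le by (intro decouple) auto
  ultimately have "\<bar>R1 - m * phi u v\<bar> \<le> K * (158 * eps\<^sup>2)" using bound unfolding phi_def by linarith
  moreover have "\<bar>m * phi u v - K * f u v\<bar> \<le> K * eps\<^sup>2"
    unfolding K_def by (rule phi_approx_scaled[OF uv])
  ultimately have R1: "\<bar>R1 - K * f u v\<bar> \<le> 159 * (K * eps\<^sup>2)" by linarith
  have phi_vu: "phi v u = (\<Sum>x\<in>V. A u x * A v x * y v x)"
    unfolding phi_def by (intro sum.cong refl) simp
  have "R2 = (\<Sum>x\<in>V. A u x * A v x * y v x * \<rho> x)" unfolding R2_def \<rho>_def by (simp only: inner_R[OF uv(3)])
  moreover have "\<bar>(\<Sum>x\<in>V. A u x * A v x * y v x * \<rho> x) - m * phi v u\<bar>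
      \<le> 12 * eps * (13 * eps * m) * (\<Sum>x\<in>V. A u x * A v x)"
    unfolding phi_vu using \<rho> y_edge_le by (intro decouple) auto
  ultimately have "\<bar>R2 - m * phi v u\<bar> \<le> K * (158 * eps\<^sup>2)" using bound by linarith
  moreover have "\<bar>m * phi v u - K * f v u\<bar> \<le> K * eps\<^sup>2"
    unfolding K_def using uv by (intro phi_approx_scaled) auto
  ultimately have R2: "\<bar>R2 - K * f v u\<bar> \<le> 159 * (K * eps\<^sup>2)" by linarith
  define w where "w z = A u z * of_bool (z \<noteq> v)" for z
  \<comment> \<open>Summing over \<open>x\<close> first turns the weight into the codegree of
    \<open>u\<close>, \<open>v\<close>, \<open>z\<close>; here the triple codegrees are
    used.\<close>
  have "R3 = (\<Sum>z\<in>V. \<Sum>x\<in>V. wR u v x z * y u z)" unfolding R3_def by (rule sum.swap)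
  also have "\<dots> = (\<Sum>z\<in>V. w z * y u z * td u v z)"
    unfolding td_def sum_distrib_left w_def
  proof (intro sum.cong refl)
    fix z x
    have "A z x = A x z" by (rule adj_sym)
    then show "wR u v x z * y u z = A u z * of_bool (z \<noteq> v) * y u z * (A u x * A v x * A z x)" by simp
  qed
  finally have R3_eq: "R3 = (\<Sum>z\<in>V. w z * y u z * td u v z)" .
  have D: "\<bar>R3 - P * (\<Sum>z\<in>V. w z * y u z)\<bar> \<le> 12 * eps * (25 * eps * P) * (\<Sum>z\<in>V. w z)"
    unfolding R3_eq
  proof (rule decouple)
    fix z assume "w z \<noteq> 0"
    then have z: "{u, z} \<in> E" "z \<noteq> v" by (auto simp: w_def)
    show "\<bar>y u z\<bar> \<le> 12 * eps" using z y_edge_le by blast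
    show "\<bar>td u v z - P\<bar> \<le> 25 * eps * P"
      unfolding P_def using edgeD[OF z(1)] z uv by (intro td_dev) auto
  qed (auto simp: w_def)
  have "(\<Sum>z\<in>V. w z) \<le> deg u" unfolding deg_def w_def by (intro sum_mono) auto
  then have "12 * eps * (25 * eps * P) * (\<Sum>z\<in>V. w z) \<le> 12 * eps * (25 * eps * P) * (101/100 * (real n * p))"
    using deg_le[OF uv(1)] eps_pos P by (intro mult_left_mono) auto
  also have "\<dots> = 303 * (P * (real n * p) * eps\<^sup>2)" by (simp add: power2_eq_square)
  finally have "12 * eps * (25 * eps * P) * (\<Sum>z\<in>V. w z) \<le> 303 * (K * eps\<^sup>2)" unfolding PK .
  then have D2: "\<bar>R3 - P * (\<Sum>z\<in>V. w z * y u z)\<bar> \<le> 303 * (K * eps\<^sup>2)" by (rule order.trans[OF D])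
  have "(\<Sum>z\<in>V. A u z * y u z) - (\<Sum>z\<in>V. w z * y u z) = (\<Sum>z\<in>V. if z = v then A u z * y u z else 0)"
    unfolding sum_subtractf[symmetric] by (intro sum.cong refl) (auto simp: w_def)
  also have "\<dots> = A u v * y u v" using uv by (simp add: sum.delta)
  finally have "(\<Sum>z\<in>V. w z * y u z) = real n * p * e u - A u v * y u v"
    using e_sum[of u] by linarith
  then have "P * (\<Sum>z\<in>V. w z * y u z) = K * e u - P * (A u v * y u v)"
    by (simp add: right_diff_distrib PK[symmetric])
  moreover have "\<bar>P * (A u v * y u v)\<bar> \<le> K * eps\<^sup>2"
  proof -
    have "\<bar>A u v * y u v\<bar> \<le> 1 * (12 * eps)"
      unfolding abs_mult using y_le[OF uv] A_le_1 by (intro mult_mono) auto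
    then have "\<bar>P * (A u v * y u v)\<bar> \<le> P * (12 * eps)"
      using P by (simp add: abs_mult)
    also have "\<dots> = K * (12 * eps * (1 / (real n * p)))" using np_pos n_pos p by (simp add: PK[symmetric])
    also have "\<dots> \<le> K * (12 * eps * (eps / 1000000000))"
      using r_ge(2) m_large(2) K eps_pos by (intro mult_left_mono) auto
    also have "\<dots> \<le> K * eps\<^sup>2" using K by (intro mult_left_mono) (auto simp: power2_eq_square)
    finally show ?thesis .
  qed
  ultimately have R3: "\<bar>R3 - K * e u\<bar> \<le> 304 * (K * eps\<^sup>2)" using D2 by linarith
  have e: "\<bar>K * e u\<bar> \<le> K * eps" using e_le[OF uv(1)] K by (simp add: abs_mult)
  have C: "(\<Sum>x\<in>V. \<Sum>z\<in>V. wR u v x z) = K * rel_R n p u v E"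
  proof -
    have "(\<Sum>x\<in>V. \<Sum>z\<in>V. wR u v x z) = cnt (IR n u v) (FR u v) E"
      by (subst cnt_as_sum) (simp_all only: finite_families sum_IR[OF uv(3)] mult_1_right)
    then show ?thesis using K by (simp add: rel_R_def M)
  qed
  have "\<bar>R4\<bar> \<le> (\<Sum>x\<in>V. \<Sum>z\<in>V. wR u v x z * (12 * eps))"
    unfolding R4_def
  proof (rule order.trans[OF sum_abs], rule sum_mono, rule order.trans[OF sum_abs], rule sum_mono)
    fix x z
    show "\<bar>wR u v x z * y x z\<bar> \<le> wR u v x z * (12 * eps)"
    proof (cases "{x, z} \<in> E")
      case True
      then show ?thesis unfolding abs_mult using y_edge_le by (intro mult_mono) (auto simp: abs_mult)
    qed (simp add: adj_def)
  qed
  also have "\<dots> = (\<Sum>x\<in>V. \<Sum>z\<in>V. wR u v x z) * (12 * eps)" unfolding sum_distrib_right ..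
  also have "\<dots> = 12 * eps * (K * rel_R n p u v E)" unfolding C by simp
  also have "\<dots> \<le> 12 * eps * (K * (1 + 21 * eps))"
  proof -
    have "rel_R n p u v E \<le> 1 + 21 * eps" using codeg_close[OF uv] R_close[OF uv] eps_pos by linarith
    then show ?thesis using eps_pos K by (intro mult_left_mono) auto
  qed
  also have "\<dots> = 12 * (K * eps) + 252 * (K * eps\<^sup>2)" by (simp add: power2_eq_square algebra_simps)
  finally have R4: "\<bar>R4\<bar> \<le> 12 * (K * eps) + 252 * (K * eps\<^sup>2)" .
  have "hsum (IR n u v) (FR u v) = R1 + R2 + R3 + R4"
    unfolding sum_FR[OF uv(3)] R1_def R2_def R3_def R4_def distrib_left sum.distrib by (rule refl)
  then have "hsum (IR n u v) (FR u v) - K * (f u v + f v u)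
      = (R1 - K * f u v) + (R2 - K * f v u) + (R3 - K * e u) + K * e u + R4"
    by (simp add: algebra_simps)
  moreover have "K * (13 * eps + 1000 * eps\<^sup>2) = 13 * (K * eps) + 1000 * (K * eps\<^sup>2)"
    by (simp add: algebra_simps)
  moreover have "\<bar>a + b + c + d + R4\<bar> \<le> 13 * (K * eps) + 1000 * (K * eps\<^sup>2)"
    if "\<bar>a\<bar> \<le> 159 * (K * eps\<^sup>2)" "\<bar>b\<bar> \<le> 159 * (K * eps\<^sup>2)" "\<bar>c\<bar> \<le> 304 * (K * eps\<^sup>2)"
      "\<bar>d\<bar> \<le> K * eps" for a b c d
    using that R4 Ke by linarith
  ultimately show "\<bar>hsum (IR n u v) (FR u v)
      - (real n)\<^sup>2 * p^4 * (f u v + f v u)\<bar> \<le> (real n)\<^sup>2 * p^4 * (13 * eps + 1000 * eps\<^sup>2)"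
    unfolding M using R1 R2 R3 e by (simp only:)
qed (use n_pos p in simp)

definition "avg_e u = (\<Sum>x\<in>V. A u x * e x) / (real n * p)"

lemma avg_e_le:
  assumes "u \<in> V"
  shows "\<bar>avg_e u\<bar> \<le> 101/100 * eps"
proof -
  have "\<bar>\<Sum>x\<in>V. A u x * e x\<bar> \<le> (\<Sum>x\<in>V. A u x * eps)"
    by (rule order.trans[OF sum_abs], rule sum_mono) (simp add: abs_mult e_le mult_left_mono)
  also have "\<dots> = deg u * eps" unfolding deg_def sum_distrib_right ..
  also have "\<dots> \<le> (101/100 * (real n * p)) * eps"
    using deg_le[OF assms] eps_pos by (intro mult_right_mono) auto
  finally have "\<bar>(\<Sum>x\<in>V. A u x * e x) - (real n * p) * 0\<bar> \<le> (real n * p) * (101/100 * eps)" by simp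
  then have "\<bar>(\<Sum>x\<in>V. A u x * e x) / (real n * p) - 0\<bar> \<le> 101/100 * eps"
    by (rule abs_divide_diff_le[OF np_pos])
  then show ?thesis by (simp add: avg_e_def)
qed

lemma inner_V: "(\<Sum>t\<in>V. wV u x z t * c) = wT u x z * c * (cd x z - A x u * A z u)"
  unfolding sum_third[symmetric] sum_distrib_left by (intro sum.cong refl) simp

lemma wV_swap:
  "(\<Sum>x\<in>V. \<Sum>z\<in>V. \<Sum>t\<in>V. wV u x z t * g z t) = (\<Sum>x\<in>V. \<Sum>z\<in>V. \<Sum>t\<in>V. wV u x z t * g x t)"
proof -
  have "(\<Sum>x\<in>V. \<Sum>z\<in>V. \<Sum>t\<in>V. wV u x z t * g z t)
      = (\<Sum>z\<in>V. \<Sum>x\<in>V. \<Sum>t\<in>V. wV u x z t * g z t)" by (rule sum.swap)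
  also have "\<dots> = (\<Sum>x\<in>V. \<Sum>z\<in>V. \<Sum>t\<in>V. wV u x z t * g x t)"
  proof (intro sum.cong refl)
    fix x z t
    have "A z x = A x z" by (rule adj_sym)
    then show "wV u z x t * g x t = wV u x z t * g x t" by simp
  qed
  finally show ?thesis .
qed

text \<open>The number of copies of \<open>V\<close> through a fixed edge \<open>ux\<close>, used as
  a nearly constant weight in \<open>drift_V\<close>. It is a product of two codegree choices, whose
  relative errors add up.\<close>

lemma second_moment_dev:
  assumes ux: "{u, x} \<in> E"
  shows "\<bar>(\<Sum>z\<in>V. A u z * A x z * (cd x z - A x u * A z u)) - m * m\<bar> \<le> 26 * eps * (m * m)"
proof -
  let ?\<rho> = "\<Sum>z\<in>V. A u z * A x z * (cd x z - A x u * A z u)"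
  have x: "u \<in> V" "x \<in> V" "u \<noteq> x" using edgeD[OF ux] by auto
  have cd_le: "cd u x \<le> 101/100 * m"
    using rel_bounds(4)[OF x] m_pos by (simp add: rel_Y2_y cd_y mult.commute)
  have "?\<rho> - m * cd u x = (\<Sum>z\<in>V. A u z * A x z * (cd x z - A x u * A z u - m))"
    unfolding cd_def[of u x] sum_distrib_left sum_subtractf[symmetric]
    by (intro sum.cong refl) (simp add: algebra_simps)
  also have "\<bar>\<dots>\<bar> \<le> (\<Sum>z\<in>V. A u z * A x z * (13 * eps * m))"
  proof (rule order.trans[OF sum_abs], rule sum_mono)
    fix z
    show "\<bar>A u z * A x z * (cd x z - A x u * A z u - m)\<bar> \<le> A u z * A x z * (13 * eps * m)"
    proof (cases "{u, z} \<in> E \<and> {x, z} \<in> E")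
      case True
      then have eq: "A x u * A z u = A x u" by (simp add: adj_def insert_commute)
      have "\<bar>cd x z - A x u * A z u - m\<bar> \<le> 13 * eps * m"
        unfolding eq using True edgeD[of x z] by (intro cd_dev(3)) auto
      then have "A u z * A x z * \<bar>cd x z - A x u * A z u - m\<bar> \<le> A u z * A x z * (13 * eps * m)"
        by (rule mult_left_mono) simp
      then show ?thesis unfolding abs_mult[of "A u z * A x z"] by (simp only: abs_mult abs_of_nonneg adj_nonneg)
    qed (auto simp: adj_def)
  qed
  also have "\<dots> = cd u x * (13 * eps * m)" unfolding cd_def sum_distrib_right ..
  also have "\<dots> \<le> (101/100 * m) * (13 * eps * m)" using cd_le eps_pos m_pos by (intro mult_right_mono) auto
  also have "\<dots> = 1313/100 * (eps * (m * m))" by simp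
  finally have 1: "\<bar>?\<rho> - m * cd u x\<bar> \<le> 1313/100 * (eps * (m * m))" .
  have "m * cd u x - m * m = m * (cd u x - m)" by (simp add: algebra_simps)
  then have "\<bar>m * cd u x - m * m\<bar> \<le> m * (12 * eps * m)"
    using cd_dev(1)[OF x] m_pos by (simp add: abs_mult)
  then have 2: "\<bar>m * cd u x - m * m\<bar> \<le> 12 * (eps * (m * m))" by (simp add: mult_ac)
  have "0 \<le> eps * (m * m)" using eps_pos m_pos by simp
  moreover have "26 * eps * (m * m) = 26 * (eps * (m * m))" by simp
  ultimately show ?thesis using 1 2 by linarith
qed

text \<open>The edges \<open>ux\<close> and \<open>uz\<close> contribute \<open>e u\<close> each,
  and \<open>xz\<close> contributes the difference of \<open>V\<close> and \<open>T\<close>, as in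
  \<open>drift_T\<close>. The edges \<open>xt\<close> and \<open>zt\<close> to the far vertex run
  over the neighbourhoods of \<open>x\<close> and \<open>z\<close>, so each contributes the average
  of \<open>e\<close> over the neighbours of \<open>u\<close>. In the difference only
  \<open>2 * avg_e u\<close> is left, and codegree errors enter it to second order only.\<close>

lemma drift_V:
  assumes u: "u \<in> V"
  shows "\<bar>hsum (IV n u) (FV u) / ((real n)^3 * p^5)
    - (2 * e u + (rel_V n p u E - rel_T n p u E) + 2 * avg_e u)\<bar> \<le> 1500 * eps\<^sup>2"
proof (rule abs_divide_diff_le)
  define c where "c = real n * p"
  define K where "K = m * m * c"
  define P where "P = real n * p^3"
  define q where "q = rel_V n p u E - rel_T n p u E"
  have c: "0 < c" using np_pos by (simp add: c_def)
  have K: "0 < K" using m_pos c by (simp add: K_def)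
  have P: "0 < P" using np3_pos by (simp add: P_def)
  have M: "(real n)^3 * p^5 = K" by (simp add: K_def c_def m_def eval_nat_numeral)
  have PK: "P * (c * c) = K" by (simp add: K_def P_def c_def m_def eval_nat_numeral)
  have mK: "m * ((real n)\<^sup>2 * p^3) = K" by (simp add: K_def c_def m_def eval_nat_numeral)
  have Ke: "0 \<le> K * eps\<^sup>2" using K by simp
  define V1 where "V1 = (\<Sum>x\<in>V. \<Sum>z\<in>V. \<Sum>t\<in>V. wV u x z t * y u x)"
  define V3 where "V3 = (\<Sum>x\<in>V. \<Sum>z\<in>V. \<Sum>t\<in>V. wV u x z t * y x z)"
  define V4 where "V4 = (\<Sum>x\<in>V. \<Sum>z\<in>V. \<Sum>t\<in>V. wV u x z t * y x t)"
  have total: "hsum (IV n u) (FV u) = V1 + V1 + V3 + V4 + V4"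
    unfolding sum_FV distrib_left sum.distrib V1_def V3_def V4_def
    by (simp only: wV_swap[of u "\<lambda>z t. y u z"] wV_swap[of u y])
  define \<rho> where "\<rho> x = (\<Sum>z\<in>V. A u z * A x z * (cd x z - A x u * A z u))" for x
  have V1_eq: "V1 = (\<Sum>x\<in>V. A u x * y u x * \<rho> x)"
    unfolding V1_def inner_V \<rho>_def sum_distrib_left by (intro sum.cong refl) simp
  have "\<bar>V1 - (m * m) * (\<Sum>x\<in>V. A u x * y u x)\<bar> \<le> 12 * eps * (26 * eps * (m * m)) * (\<Sum>x\<in>V. A u x)"
    unfolding V1_eq using y_edge_le second_moment_dev[of u] unfolding \<rho>_def
    by (intro decouple) auto
  also have "\<dots> \<le> 12 * eps * (26 * eps * (m * m)) * (101/100 * c)"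
    using deg_le[OF u] eps_pos m_pos unfolding deg_def c_def by (intro mult_left_mono) auto
  also have "\<dots> = 31512/100 * (K * eps\<^sup>2)" by (simp add: K_def power2_eq_square)
  finally have V1: "\<bar>V1 - K * e u\<bar> \<le> 31512/100 * (K * eps\<^sup>2)"
    unfolding e_sum K_def c_def by (simp only: mult.assoc)
  have V3_eq: "V3 = (\<Sum>x\<in>V. \<Sum>z\<in>V. wT u x z * y x z * (cd x z - A x u * A z u))"
    unfolding V3_def inner_V ..
  have "\<bar>V3 - m * psi u\<bar> \<le> 12 * eps * (13 * eps * m) * (\<Sum>x\<in>V. \<Sum>z\<in>V. wT u x z)"
    unfolding V3_eq psi_def
  proof (rule decouple2)
    fix x z assume "wT u x z \<noteq> 0"
    then have xz: "{u, x} \<in> E" "{u, z} \<in> E" "{x, z} \<in> E" by auto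
    then show "\<bar>y x z\<bar> \<le> 12 * eps" by (intro y_edge_le)
    have eq: "A x u * A z u = A x u" using xz by (simp add: adj_def insert_commute)
    show "\<bar>cd x z - A x u * A z u - m\<bar> \<le> 13 * eps * m"
      unfolding eq using edgeD[OF xz(3)] by (intro cd_dev(3)) auto
  qed simp
  also have "\<dots> = 156 * (K * eps\<^sup>2) * rel_T n p u E" unfolding wT_sum mK[symmetric] by (simp add: power2_eq_square)
  also have "\<dots> \<le> 156 * (K * eps\<^sup>2) * (101/100)" using rel_bounds(2)[OF u] Ke by (intro mult_left_mono) auto
  finally have V3a: "\<bar>V3 - m * psi u\<bar> \<le> 158 * (K * eps\<^sup>2)" using Ke by linarith
  have T0: "0 \<le> rel_T n p u E" using p by (auto simp: rel_T_def intro!: divide_nonneg_nonneg)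
  have "m * psi u - K * q = K * (rel_T n p u E / m)"
    unfolding psi_eq mK[symmetric] q_def by (simp only: distrib_left mult.assoc add_diff_cancel_left')
  moreover have "\<bar>K * (rel_T n p u E / m)\<bar> \<le> K * eps\<^sup>2"
  proof -
    have "0 \<le> rel_T n p u E / m" using T0 m_pos by simp
    then show ?thesis unfolding abs_mult using small_ratio[OF rel_bounds(2)[OF u] T0] K
      by (intro mult_mono; linarith)
  qed
  ultimately have V3: "\<bar>V3 - K * q\<bar> \<le> 159 * (K * eps\<^sup>2)" using V3a by linarith
  define w where "w x t = A u x * (A x t * of_bool (t \<noteq> u))" for x t
  \<comment> \<open>Summing over \<open>z\<close> first gives the codegree of \<open>u\<close>,
    \<open>x\<close>, \<open>t\<close> as weight; decoupling it leaves the error sum over the edges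
    at \<open>x\<close>, that is, \<open>e x\<close>.\<close>
  have "V4 = (\<Sum>x\<in>V. \<Sum>t\<in>V. \<Sum>z\<in>V. wV u x z t * y x t)" unfolding V4_def by (intro sum.cong refl sum.swap)
  also have "\<dots> = (\<Sum>x\<in>V. \<Sum>t\<in>V. w x t * y x t * td u x t)"
    unfolding td_def sum_distrib_left w_def
  proof (intro sum.cong refl)
    fix x t z
    have "A z t = A t z" by (rule adj_sym)
    then show "wV u x z t * y x t = A u x * (A x t * of_bool (t \<noteq> u)) * y x t * (A u z * A x z * A t z)" by simp
  qed
  finally have V4_eq: "V4 = (\<Sum>x\<in>V. \<Sum>t\<in>V. w x t * y x t * td u x t)" .
  have D: "\<bar>V4 - P * (\<Sum>x\<in>V. \<Sum>t\<in>V. w x t * y x t)\<bar> \<le> 12 * eps * (25 * eps * P) * (\<Sum>x\<in>V. \<Sum>t\<in>V. w x t)"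
    unfolding V4_eq
  proof (rule decouple2)
    fix x t assume "w x t \<noteq> 0"
    then have xt: "{u, x} \<in> E" "{x, t} \<in> E" "t \<noteq> u" by (auto simp: w_def)
    show "\<bar>y x t\<bar> \<le> 12 * eps" using xt y_edge_le by blast
    show "\<bar>td u x t - P\<bar> \<le> 25 * eps * P"
      unfolding P_def using edgeD[OF xt(1)] edgeD[OF xt(2)] xt(3) by (intro td_dev) auto
  qed (auto simp: w_def)
  have "(\<Sum>x\<in>V. \<Sum>t\<in>V. w x t) \<le> (\<Sum>x\<in>V. \<Sum>t\<in>V. A u x * A x t)"
    unfolding w_def by (intro sum_mono mult_left_mono) auto
  also have "\<dots> = (\<Sum>x\<in>V. A u x * deg x)" unfolding deg_def sum_distrib_left ..
  also have "\<dots> \<le> (\<Sum>x\<in>V. A u x * (101/100 * c))" unfolding c_def by (intro sum_mono mult_left_mono deg_le) auto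
  also have "\<dots> = deg u * (101/100 * c)" unfolding deg_def sum_distrib_right ..
  also have "\<dots> \<le> (101/100 * c) * (101/100 * c)" using deg_le[OF u] c unfolding c_def by (intro mult_right_mono) auto
  finally have "12 * eps * (25 * eps * P) * (\<Sum>x\<in>V. \<Sum>t\<in>V. w x t)
      \<le> 12 * eps * (25 * eps * P) * ((101/100 * c) * (101/100 * c))"
    using eps_pos P by (intro mult_left_mono) auto
  also have "\<dots> = 30603/100 * (P * (c * c) * eps\<^sup>2)" by (simp add: power2_eq_square)
  finally have "12 * eps * (25 * eps * P) * (\<Sum>x\<in>V. \<Sum>t\<in>V. w x t) \<le> 30603/100 * (K * eps\<^sup>2)" unfolding PK .
  then have D2: "\<bar>V4 - P * (\<Sum>x\<in>V. \<Sum>t\<in>V. w x t * y x t)\<bar> \<le> 30603/100 * (K * eps\<^sup>2)"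
    by (rule order.trans[OF D])
  have inner: "(\<Sum>t\<in>V. w x t * y x t) = c * (A u x * e x) - A u x * y u x" if x: "x \<in> V" for x
  proof -
    have "(\<Sum>t\<in>V. A x t * y x t) - (\<Sum>t\<in>V. A x t * of_bool (t \<noteq> u) * y x t)
        = (\<Sum>t\<in>V. if t = u then A x t * y x t else 0)"
      unfolding sum_subtractf[symmetric] by (intro sum.cong refl) auto
    also have "\<dots> = A x u * y x u" using u by (simp add: sum.delta)
    finally have a: "(\<Sum>t\<in>V. A x t * of_bool (t \<noteq> u) * y x t) = c * e x - A x u * y x u"
      using e_sum[of x] unfolding c_def by linarith
    have b: "(\<Sum>t\<in>V. w x t * y x t) = A u x * (\<Sum>t\<in>V. A x t * of_bool (t \<noteq> u) * y x t)"
      unfolding w_def sum_distrib_left by (intro sum.cong refl) simp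
    have c: "A u x * (A x u * y x u) = A u x * y u x"
      unfolding y_sym[of x u] adj_sym[of E x u] by simp
    show ?thesis unfolding b a right_diff_distrib c by simp
  qed
  have "(\<Sum>x\<in>V. \<Sum>t\<in>V. w x t * y x t) = (\<Sum>x\<in>V. c * (A u x * e x) - A u x * y u x)"
    by (intro sum.cong refl inner)
  also have "\<dots> = c * (\<Sum>x\<in>V. A u x * e x) - (\<Sum>x\<in>V. A u x * y u x)"
    unfolding sum_subtractf sum_distrib_left ..
  also have "\<dots> = c * (c * avg_e u) - c * e u"
    using c unfolding e_sum avg_e_def c_def[symmetric] by simp
  finally have main: "(\<Sum>x\<in>V. \<Sum>t\<in>V. w x t * y x t) = c * c * avg_e u - c * e u" by simp
  have "P * (\<Sum>x\<in>V. \<Sum>t\<in>V. w x t * y x t) - K * avg_e u = - (K * (e u * (1 / c)))"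
    unfolding main PK[symmetric] using c by (simp add: algebra_simps)
  moreover have "\<bar>- (K * (e u * (1 / c)))\<bar> \<le> K * eps\<^sup>2"
  proof -
    have "\<bar>e u * (1 / c)\<bar> \<le> eps * eps"
      unfolding abs_mult using e_le[OF u] r_ge(2) m_large(2) eps_pos c c_def by (intro mult_mono) auto
    then have "K * \<bar>e u * (1 / c)\<bar> \<le> K * (eps * eps)" using K by (intro mult_left_mono) auto
    then show ?thesis using K by (simp only: abs_minus_cancel abs_mult[of K] abs_of_pos power2_eq_square)
  qed
  ultimately have V4: "\<bar>V4 - K * avg_e u\<bar> \<le> 308 * (K * eps\<^sup>2)" using D2 Ke by linarith
  have "V1 + V1 + V3 + V4 + V4 - K * (2 * e u + q + 2 * avg_e u)
      = 2 * (V1 - K * e u) + (V3 - K * q) + 2 * (V4 - K * avg_e u)"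
    by (simp add: algebra_simps)
  moreover have "\<bar>2 * a + b + 2 * d\<bar> \<le> 1500 * (K * eps\<^sup>2)"
    if "\<bar>a\<bar> \<le> 31512/100 * (K * eps\<^sup>2)" "\<bar>b\<bar> \<le> 159 * (K * eps\<^sup>2)" "\<bar>d\<bar> \<le> 308 * (K * eps\<^sup>2)" for a b d
    using that Ke by linarith
  moreover have "K * (1500 * eps\<^sup>2) = 1500 * (K * eps\<^sup>2)" by simp
  ultimately show "\<bar>hsum (IV n u) (FV u)
      - (real n)^3 * p^5 * (2 * e u + (rel_V n p u E - rel_T n p u E) + 2 * avg_e u)\<bar> \<le> (real n)^3 * p^5 * (1500 * eps\<^sup>2)"
    unfolding M q_def[symmetric] total using V1 V3 V4 by (simp only:)
qed (use n_pos p in simp)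

end

subsection \<open>One step of the process\<close>

context scale
begin

text \<open>\<open>eps^2 / L^2\<close> equals \<open>L^2 * r\<close>. This margin over the largest
  jump, which is of order \<open>r\<close>, meets the increment and variance conditions of
  \<open>process_tail\<close> and swallows the constants.\<close>

lemma r_L: "1000000000000 * r \<le> eps\<^sup>2 / L\<^sup>2"
proof -
  have "10^12 * r \<le> L\<^sup>2 * r" using L_pow[of 2] r_pos by (intro mult_right_mono) auto
  also have "L\<^sup>2 * r = eps\<^sup>2 / L\<^sup>2" using L by (simp add: eps_sq field_simps flip: power_add)
  finally show ?thesis by simp
qed

lemma u_bounds: "1 \<le> 1 / (1 - dl)" "1 / (1 - dl) \<le> 101/100"
  using dl_pos dl_small by (auto simp: field_simps)

text \<open>\<open>eps\<close> is proportional to \<open>p\<close> to the power -3/2. After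
  squaring, the discrete claim follows from \<open>(1 + 3/2 d)^2 \<le> (1 + d)^3\<close> and
  \<open>(1 - d^2)^3 \<le> 1\<close>.\<close>

lemma eps_growth: "(1 + 3/2 * dl) * eps \<le> L\<^sup>2 / sqrt (real n * p' ^ 3)"
proof -
  have dl1: "dl < 1" using dl_small by linarith
  define v where "v = sqrt ((1 - dl)^3)"
  have v: "0 < v" using dl1 by (simp add: v_def)
  have e: "L\<^sup>2 / sqrt (real n * p' ^ 3) = eps / v"
    by (simp add: eps_def p'_def v_def power_mult_distrib real_sqrt_mult mult_ac)
  have "((1 + 3/2 * dl) * v)\<^sup>2 = (1 + 3/2 * dl)\<^sup>2 * (1 - dl)^3"
    using dl1 by (simp add: power_mult_distrib v_def)
  also have "\<dots> \<le> (1 + dl)^3 * (1 - dl)^3"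
  proof (rule mult_right_mono)
    have "0 \<le> dl\<^sup>2" "0 \<le> dl^3" using dl_pos by auto
    then show "(1 + 3/2 * dl)\<^sup>2 \<le> (1 + dl)^3" by (simp add: power2_eq_square power3_eq_cube algebra_simps)
  qed (use dl1 in simp)
  also have "\<dots> = (1 - dl\<^sup>2)^3"
    by (simp add: power_mult_distrib[symmetric] power2_eq_square algebra_simps)
  also have "\<dots> \<le> 1\<^sup>2" using dl_pos dl1 by (simp add: power_le_one)
  finally have "(1 + 3/2 * dl) * v \<le> 1" by (rule power2_le_imp_le) simp
  then have "(1 + 3/2 * dl) * v * eps \<le> 1 * eps" using eps_pos by (intro mult_right_mono) auto
  then show ?thesis unfolding e using v by (simp add: field_simps)
qed

end

section \<open>Drift, jumps and variance of each statistic\<close>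

context good_state
begin

definition "Q = real (card (triangles E))"
definition "B = real n ^ 3 * p ^ 3 / 6"
definition "g = rel_Q n p E - 1"

lemma B_pos: "0 < B"
  using n_pos p by (simp add: B_def)

lemma Q_eq: "real (Q_var E) = Q" "Q = B * (1 + g)"
proof -
  show "real (Q_var E) = Q" by (simp add: Q_def Q_var_def)
  then show "Q = B * (1 + g)" using B_pos unfolding g_def rel_Q_def B_def[symmetric] by simp
qed

lemma g_le: "\<bar>g\<bar> \<le> 150 * eps\<^sup>2"
  using Q_close by (simp add: g_def)

lemma Q_pos: "0 < Q"
  unfolding Q_eq(2) using B_pos g_le eps_sq_small(2) by (intro mult_pos_pos) (auto simp: abs_le_iff)

lemma h_eq: "tdeg E a = m * (1 + h a)"
  using m_pos by (simp add: h_def)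

lemma h_le: "a \<in> E \<Longrightarrow> \<bar>h a\<bar> \<le> 12 * eps"
  using edgeE h_edge y_edge_le by metis

lemma one_step_family:
  fixes F :: "'i \<Rightarrow> nat set set"
  assumes "finite I" "\<And>\<iota>. \<iota> \<in> I \<Longrightarrow> card (F \<iota>) = k" "k \<le> 5" "0 < k" "0 < M"
    "cnt I F E / (M * p ^ k) \<le> 101/100"
    "\<And>a. a \<in> E \<Longrightarrow> real (card {\<iota> \<in> I. F \<iota> \<subseteq> E \<and> a \<in> F \<iota>}) \<le> 16 * (M * p ^ k * r)"
  shows "one_step E (cnt I F E / (M * p ^ k)) (\<lambda>E. cnt I F E / (M * p' ^ k))
    (hsum I F / (M * p ^ k))"
proof (rule family_step[OF finite_E assms(1) assms(2-4) _ g_le _ h_le \<open>0 < M\<close>])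
  show "real (Q_var E) = real n ^ 3 * p ^ 3 / 6 * (1 + g)" using Q_eq by (simp add: B_def)
  show "tdeg E a = real n * p\<^sup>2 * (1 + h a)" for a using h_eq by (simp add: m_def)
  have "0 < M * p ^ k" using \<open>0 < M\<close> p by simp
  then show "cnt I F E \<le> 2 * (M * p ^ k)" using assms(6) by (simp add: divide_le_eq)
qed (use assms in auto)

lemma scale_ge_two:
  assumes "k \<le> 3"
  shows "2 \<le> 16 * (real n * p ^ k * r)"
proof -
  have "p ^ 3 \<le> p ^ k" using p assms by (intro power_decreasing) auto
  then have "real n * p ^ 3 * r \<le> real n * p ^ k * r"
    using n_pos r_pos by (intro mult_right_mono mult_left_mono) auto
  moreover have "real n * p ^ 3 * r = 1" using np3_pos n_pos p by (simp add: r_def)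
  ultimately show ?thesis by linarith
qed

lemma F_mem: "b \<in> F1 u x \<Longrightarrow> x \<in> b" "b \<in> F2 u v x \<Longrightarrow> x \<in> b" "b \<in> F3 u v w x \<Longrightarrow> x \<in> b"
  by (auto simp: F1_def F2_def F3_def)

lemma hit_small:
  assumes "k \<le> 3" "a \<in> E" "\<And>x b. b \<in> F x \<Longrightarrow> x \<in> b"
  shows "real (card {x \<in> I. F x \<subseteq> E \<and> a \<in> F x}) \<le> 16 * (real n * p ^ k * r)"
  using order.trans[OF hit_F123[OF assms(2,3)] scale_ge_two[OF assms(1)]] by blast

lemma one_step_Y1:
  assumes "u \<in> V"
  shows "one_step E (rel_Y1 n p u E) (\<lambda>E. rel_Y1 n p' u E) (e u)"
proof -
  have "one_step E (cnt (I1 n u) (F1 u) E / (real n * p ^ 1)) (\<lambda>E. cnt (I1 n u) (F1 u) E / (real n * p' ^ 1))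
    (hsum (I1 n u) (F1 u) / (real n * p ^ 1))"
    by (rule one_step_family[OF _ card_F1]; (rule hit_small)?)
      (use n_pos rel_bounds(1)[OF assms, unfolded rel_Y1_def] in \<open>auto intro: F_mem(1)\<close>)
  then show ?thesis unfolding sum_F1 e_def rel_Y1_def by simp
qed

lemma one_step_Y2:
  assumes uv: "u \<in> V" "v \<in> V" "u \<noteq> v"
  shows "one_step E (rel_Y2 n p u v E) (\<lambda>E. rel_Y2 n p' u v E) (s2 u v)"
  unfolding rel_Y2_def s2_def
  by (rule one_step_family[OF _ card_F2[OF uv(3)]]; (rule hit_small)?)
    (use n_pos rel_bounds(4)[OF uv, unfolded rel_Y2_def] in \<open>auto intro: F_mem(2)\<close>)

lemma one_step_Y3:
  assumes uvw: "u \<in> V" "v \<in> V" "w \<in> V" "distinct [u, v, w]"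
  shows "one_step E (rel_Y3 n p u v w E) (\<lambda>E. rel_Y3 n p' u v w E) (s3 u v w)"
  unfolding rel_Y3_def s3_def
  by (rule one_step_family[OF _ card_F3[OF uvw(4)]]; (rule hit_small)?)
    (use n_pos rel_bounds(6)[OF uvw, unfolded rel_Y3_def] in \<open>auto intro: F_mem(3)\<close>)

lemma one_step_T:
  assumes u: "u \<in> V"
  shows "one_step E (rel_T n p u E) (\<lambda>E. rel_T n p' u E) (sT u)"
  unfolding rel_T_def sT_def
proof (rule one_step_family[OF _ card_FT])
  have "(real n)\<^sup>2 * p^3 * r = real n" using np3_pos n_pos p by (simp add: r_def power2_eq_square)
  then show "real (card {\<iota> \<in> IT n u. FT u \<iota> \<subseteq> E \<and> a \<in> FT u \<iota>}) \<le> 16 * ((real n)\<^sup>2 * p^3 * r)" if "a \<in> E" for a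
    using hit_FT[OF that, of u] by simp
qed (use n_pos rel_bounds(2)[OF u, unfolded rel_T_def] in auto)

lemma one_step_R:
  assumes uv: "u \<in> V" "v \<in> V" "u \<noteq> v"
  shows "one_step E (rel_R n p u v E) (\<lambda>E. rel_R n p' u v E) (sR u v)"
  unfolding rel_R_def sR_def
proof (rule one_step_family[OF _ card_FR[OF uv(3)]])
  have "(real n)\<^sup>2 * p^4 * r = real n * p" using np3_pos n_pos p by (simp add: r_def eval_nat_numeral)
  then show "real (card {\<iota> \<in> IR n u v. FR u v \<iota> \<subseteq> E \<and> a \<in> FR u v \<iota>}) \<le> 16 * ((real n)\<^sup>2 * p^4 * r)"
    if "a \<in> E" for a
    using hit_FR[OF that, of u v] deg_le[OF uv(1)] np_pos by simp
qed (use n_pos rel_bounds(5)[OF uv, unfolded rel_R_def] in auto)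

lemma one_step_V:
  assumes u: "u \<in> V"
  shows "one_step E (rel_V n p u E) (\<lambda>E. rel_V n p' u E) (sV u)"
  unfolding rel_V_def sV_def
proof (rule one_step_family[OF _ card_FV])
  have "(real n)^3 * p^5 * r = (real n * p)\<^sup>2" using np3_pos n_pos p by (simp add: r_def eval_nat_numeral)
  moreover have "4 * (101/100 * c)\<^sup>2 \<le> 16 * c\<^sup>2" for c :: real
    unfolding power_mult_distrib by (simp add: power2_eq_square)
  ultimately show "real (card {\<iota> \<in> IV n u. FV u \<iota> \<subseteq> E \<and> a \<in> FV u \<iota>}) \<le> 16 * ((real n)^3 * p^5 * r)"
    if "a \<in> E" for a
    using order.trans[OF hit_FV[OF that deg_le u]] by simp
qed (use n_pos rel_bounds(3)[OF u, unfolded rel_V_def] in auto)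

text \<open>The drift, increment and variance conditions of \<open>process_tail\<close> for one
  statistic at one graph; \<open>gg\<close> is the envelope and \<open>\<mu>\<close> the drift
  rate.\<close>

definition step_ok :: "real \<Rightarrow> real \<Rightarrow> real \<Rightarrow> (nat set set \<Rightarrow> real) \<Rightarrow> bool" where
  "step_ok \<mu> gg x x' \<longleftrightarrow>
    \<bar>\<Sum>t\<in>triangles E. x' (E - pairs t) - x\<bar> \<le> Q * (\<mu> * dl * gg) \<and>
    (\<forall>t\<in>triangles E. \<bar>x' (E - pairs t) - x\<bar> \<le> gg / L\<^sup>2) \<and>
    (\<Sum>t\<in>triangles E. (x' (E - pairs t) - x)\<^sup>2) \<le> Q * (dl * gg\<^sup>2 / L\<^sup>2)"

text \<open>Variances come from the largest jump and the first absolute moment, so second moments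
  need no analysis of their own.\<close>

lemma sum_squares_le:
  fixes X :: "'t \<Rightarrow> real"
  assumes "\<And>t. t \<in> S \<Longrightarrow> \<bar>X t\<bar> \<le> c" "(\<Sum>t\<in>S. \<bar>X t\<bar>) \<le> d" "0 \<le> c"
  shows "(\<Sum>t\<in>S. (X t)\<^sup>2) \<le> c * d"
proof -
  have "(\<Sum>t\<in>S. (X t)\<^sup>2) \<le> (\<Sum>t\<in>S. c * \<bar>X t\<bar>)"
  proof (rule sum_mono)
    fix t assume "t \<in> S"
    have "(X t)\<^sup>2 = \<bar>X t\<bar> * \<bar>X t\<bar>" by (simp add: power2_eq_square)
    also have "\<dots> \<le> c * \<bar>X t\<bar>" using assms(1)[OF \<open>t \<in> S\<close>] by (intro mult_right_mono) auto
    finally show "(X t)\<^sup>2 \<le> c * \<bar>X t\<bar>" .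
  qed
  also have "\<dots> \<le> c * d" using assms(2,3) by (simp add: sum_distrib_left[symmetric] mult_left_mono)
  finally show ?thesis .
qed

text \<open>The second-order terms amount to \<open>7000 * eps^2\<close>, below
  \<open>eps / 100\<close>. This is the origin of the added 1/100 in the drift rates of all
  statistics except \<open>SE\<close> and \<open>SG\<close>.\<close>

lemma step_ok_of_drift:
  assumes d: "\<bar>(\<Sum>t\<in>triangles E. x' (E - pairs t) - x) + Q * (dl * s)\<bar> \<le> Q * (4000 * dl * eps\<^sup>2)"
    and a: "(\<Sum>t\<in>triangles E. \<bar>x' (E - pairs t) - x\<bar>) \<le> Q * (100 * dl)"
    and m: "\<And>t. t \<in> triangles E \<Longrightarrow> \<bar>x' (E - pairs t) - x\<bar> \<le> 400 * r"
    and s: "\<bar>s\<bar> \<le> c * eps + 3000 * eps\<^sup>2"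
  shows "step_ok (c + 1/100) eps x x'"
  unfolding step_ok_def
proof (intro conjI ballI)
  define S where "S = (\<Sum>t\<in>triangles E. x' (E - pairs t) - x)"
  have "\<bar>Q * (dl * s)\<bar> \<le> Q * (dl * (c * eps + 3000 * eps\<^sup>2))"
    using s Q_pos dl_pos by (simp add: abs_mult mult_left_mono)
  then have "\<bar>S\<bar> \<le> Q * (4000 * dl * eps\<^sup>2) + Q * (dl * (c * eps + 3000 * eps\<^sup>2))"
    using d unfolding S_def[symmetric] by linarith
  also have "\<dots> = Q * dl * (c * eps + 7000 * eps\<^sup>2)" by (simp add: algebra_simps)
  also have "\<dots> \<le> Q * dl * ((c + 1/100) * eps)"
  proof (rule mult_left_mono)
    have "7000 * eps\<^sup>2 \<le> 1/100 * eps" using eps_sq_small(1) eps_pos by linarith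
    then show "c * eps + 7000 * eps\<^sup>2 \<le> (c + 1/100) * eps" by (simp add: algebra_simps)
  qed (use Q_pos dl_pos in simp)
  finally show "\<bar>\<Sum>t\<in>triangles E. x' (E - pairs t) - x\<bar> \<le> Q * ((c + 1/100) * dl * eps)"
    by (simp add: S_def mult_ac)
next
  have Lp: "0 < L" using L by simp
  have "eps\<^sup>2 / L\<^sup>2 \<le> eps / L\<^sup>2" using eps_sq_small(1) eps_pos by (intro divide_right_mono) auto
  then show "\<bar>x' (E - pairs t) - x\<bar> \<le> eps / L\<^sup>2" if "t \<in> triangles E" for t
    using m[OF that] r_L r_pos by linarith
  have "(\<Sum>t\<in>triangles E. (x' (E - pairs t) - x)\<^sup>2) \<le> 400 * r * (Q * (100 * dl))"
    using m a r_pos by (intro sum_squares_le) auto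
  also have "\<dots> = Q * dl * (40000 * r)" by simp
  also have "\<dots> \<le> Q * dl * (eps\<^sup>2 / L\<^sup>2)"
    using r_L r_pos Q_pos dl_pos by (intro mult_left_mono) auto
  finally show "(\<Sum>t\<in>triangles E. (x' (E - pairs t) - x)\<^sup>2) \<le> Q * (dl * eps\<^sup>2 / L\<^sup>2)" by simp
qed

lemma step_ok_single:
  assumes "one_step E x x' s" "\<bar>s\<bar> \<le> c * eps + 3000 * eps\<^sup>2"
  shows "step_ok (c + 1/100) eps (x - 1) (\<lambda>E. x' E - 1)"
proof (rule step_ok_of_drift[OF _ _ _ assms(2)])
  have nn: "0 \<le> Q * (dl * eps\<^sup>2)" "0 \<le> Q * dl" using Q_pos dl_pos by auto
  have scale: "Q * (2000 * dl * eps\<^sup>2) = 2000 * (Q * (dl * eps\<^sup>2))"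
    "Q * (4000 * dl * eps\<^sup>2) = 4000 * (Q * (dl * eps\<^sup>2))"
    "Q * (50 * dl) = 50 * (Q * dl)" "Q * (100 * dl) = 100 * (Q * dl)" by simp_all
  have F: "\<bar>(\<Sum>t\<in>triangles E. x' (E - pairs t) - x) + Q * (dl * s)\<bar> \<le> Q * (2000 * dl * eps\<^sup>2)"
    "(\<Sum>t\<in>triangles E. \<bar>x' (E - pairs t) - x\<bar>) \<le> Q * (50 * dl)"
    "\<And>t. t \<in> triangles E \<Longrightarrow> \<bar>x' (E - pairs t) - x\<bar> \<le> 200 * r"
    using assms(1) unfolding one_step_def Q_eq(1) by blast+
  have shift: "x' E' - 1 - (x - 1) = x' E' - x" for E' by simp
  show "\<bar>(\<Sum>t\<in>triangles E. x' (E - pairs t) - 1 - (x - 1)) + Q * (dl * s)\<bar> \<le> Q * (4000 * dl * eps\<^sup>2)"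
    unfolding shift using F(1) nn unfolding scale by linarith
  show "(\<Sum>t\<in>triangles E. \<bar>x' (E - pairs t) - 1 - (x - 1)\<bar>) \<le> Q * (100 * dl)"
    unfolding shift using F(2) nn unfolding scale by linarith
  show "\<bar>x' (E - pairs t) - 1 - (x - 1)\<bar> \<le> 400 * r" if "t \<in> triangles E" for t
    unfolding shift using F(3)[OF that] r_pos by linarith
qed

lemma step_ok_diff:
  assumes "one_step E x x' s" "one_step E z z' r'" "\<bar>s - r'\<bar> \<le> c * eps + 3000 * eps\<^sup>2"
  shows "step_ok (c + 1/100) eps (x - z) (\<lambda>E. x' E - z' E)"
  using one_step_diff[OF assms(1,2), unfolded Q_eq(1)] assms(3) by (intro step_ok_of_drift[where s = "s - r'"]) auto

lemma step_D:
  assumes "u \<in> V"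
  shows "step_ok (101/100) eps (rel_Y1 n p u E - 1) (\<lambda>E. rel_Y1 n p' u E - 1)"
proof -
  have "\<bar>e u\<bar> \<le> 1 * eps + 3000 * eps\<^sup>2" using e_le[OF assms] zero_le_power2[of eps] by linarith
  from step_ok_single[OF one_step_Y1[OF assms] this] show ?thesis by simp
qed

lemma step_Y:
  assumes uv: "u \<in> V" "v \<in> V" "u \<noteq> v"
  shows "step_ok (1761/100) eps (rel_Y2 n p u v E - 1) (\<lambda>E. rel_Y2 n p' u v E - 1)"
proof -
  have "\<bar>f u v\<bar> \<le> 44/5 * eps" "\<bar>f v u\<bar> \<le> 44/5 * eps"
    using R_close[OF uv] R_close[of v u] uv by (auto simp: f_def)
  then have "\<bar>s2 u v\<bar> \<le> 88/5 * eps + 3000 * eps\<^sup>2"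
    using drift_2[OF uv, folded s2_def] zero_le_power2[of eps] by linarith
  from step_ok_single[OF one_step_Y2[OF uv] this] show ?thesis by simp
qed

lemma step_W:
  assumes uvw: "u \<in> V" "v \<in> V" "w \<in> V" "distinct [u, v, w]"
  shows "step_ok (3651/100) eps (rel_Y3 n p u v w E - 1) (\<lambda>E. rel_Y3 n p' u v w E - 1)"
proof -
  have "\<bar>s3 u v w\<bar> \<le> 365/10 * eps + 3000 * eps\<^sup>2"
    using drift_3[OF uvw, folded s3_def] zero_le_power2[of eps] by linarith
  from step_ok_single[OF one_step_Y3[OF uvw] this] show ?thesis by simp
qed

lemma step_K:
  assumes u: "u \<in> V"
  shows "step_ok (203/100) eps (rel_V n p u E - rel_T n p u E) (\<lambda>E. rel_V n p' u E - rel_T n p' u E)"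
proof -
  have "\<bar>sV u - sT u\<bar> \<le> 202/100 * eps + 3000 * eps\<^sup>2"
    using drift_V[OF u, folded sV_def] drift_T[OF u, folded sT_def] avg_e_le[OF u]
      zero_le_power2[of eps] by linarith
  from step_ok_diff[OF one_step_V[OF u] one_step_T[OF u] this] show ?thesis by simp
qed

lemma step_F:
  assumes uv: "u \<in> V" "v \<in> V" "u \<noteq> v"
  shows "step_ok (1301/100) eps (rel_R n p u v E - rel_Y2 n p u v E) (\<lambda>E. rel_R n p' u v E - rel_Y2 n p' u v E)"
proof -
  have "\<bar>sR u v - s2 u v\<bar> \<le> 13 * eps + 3000 * eps\<^sup>2"
    using drift_R[OF uv, folded sR_def] drift_2[OF uv, folded s2_def]
      zero_le_power2[of eps] by linarith
  from step_ok_diff[OF one_step_R[OF uv] one_step_Y2[OF uv] this] show ?thesis by simp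
qed

text \<open>
  Because of the weight \<open>1 / p\<close> the self-correcting drift \<open>- (e + q)\<close> becomes \<open>- q / p\<close>.
\<close>

lemma step_E:
  assumes u: "u \<in> V"
  shows "step_ok (203/100) (eps / p) ((rel_T n p u E - rel_Y1 n p u E) / p) (\<lambda>E. (rel_T n p' u E - rel_Y1 n p' u E) / p')"
  unfolding step_ok_def
proof (intro conjI ballI)
  define x where "x = rel_T n p u E - rel_Y1 n p u E"
  define x' where "x' E = rel_T n p' u E - rel_Y1 n p' u E" for E
  define \<Delta> where "\<Delta> t = x' (E - pairs t) - x" for t
  define \<nu> where "\<nu> = 1 / (1 - dl)"
  have \<nu>: "1 \<le> \<nu>" "\<nu> \<le> 101/100" using u_bounds by (auto simp: \<nu>_def)
  have x: "\<bar>x\<bar> \<le> eps" using tri_close[OF u] by (simp add: x_def)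
  have dl1: "1 - dl \<noteq> 0" using dl_small by simp
  \<comment> \<open>Passing from \<open>p\<close> to \<open>p'\<close> in the weight multiplies by
    \<open>\<nu>\<close> and adds \<open>dl * x\<close>; since \<open>x\<close> equals
    \<open>e u\<close>, this cancels the part \<open>- e\<close> of the drift.\<close>
  have eq: "x' (E - pairs t) / p' - x / p = \<nu> * ((\<Delta> t + dl * x) / p)" for t
    using dl1 p by (simp add: p'_def \<nu>_def \<Delta>_def field_simps)
  note D = one_step_diff[OF one_step_T[OF u] one_step_Y1[OF u], unfolded Q_eq(1), folded x_def x'_def, folded \<Delta>_def]
  have S: "(\<Sum>t\<in>triangles E. x' (E - pairs t) / p' - x / p) = \<nu> * ((\<Sum>t\<in>triangles E. \<Delta> t) + Q * (dl * x)) / p"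
    unfolding eq by (simp add: sum_distrib_left[symmetric] sum_divide_distrib[symmetric] sum.distrib Q_def)
  define q where "q = rel_V n p u E - rel_T n p u E"
  have "\<bar>sT u - e u - x\<bar> \<le> 2 * eps + 300 * eps\<^sup>2"
    using drift_T[OF u, folded sT_def] V_close[OF u] unfolding x_def e_eq[symmetric] by linarith
  then have "\<bar>Q * (dl * (sT u - e u - x))\<bar> \<le> Q * (dl * (2 * eps + 300 * eps\<^sup>2))"
    using Q_pos dl_pos by (simp add: abs_mult mult_left_mono)
  moreover have "(\<Sum>t\<in>triangles E. \<Delta> t) + Q * (dl * x)
      = ((\<Sum>t\<in>triangles E. \<Delta> t) + Q * (dl * (sT u - e u))) - Q * (dl * (sT u - e u - x))"
    by (simp add: algebra_simps)
  ultimately have "\<bar>(\<Sum>t\<in>triangles E. \<Delta> t) + Q * (dl * x)\<bar>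
      \<le> Q * (4000 * dl * eps\<^sup>2) + Q * (dl * (2 * eps + 300 * eps\<^sup>2))"
    using D(1) by linarith
  also have "\<dots> = Q * dl * (2 * eps + 4300 * eps\<^sup>2)" by (simp add: algebra_simps)
  also have "\<dots> \<le> Q * dl * (2001/1000 * eps)"
    using eps_sq_small(1) eps_pos Q_pos dl_pos by (intro mult_left_mono) auto
  finally have 1: "\<bar>(\<Sum>t\<in>triangles E. \<Delta> t) + Q * (dl * x)\<bar> \<le> Q * dl * (2001/1000 * eps)" .
  have "\<bar>\<Sum>t\<in>triangles E. x' (E - pairs t) / p' - x / p\<bar>
      = \<nu> * \<bar>(\<Sum>t\<in>triangles E. \<Delta> t) + Q * (dl * x)\<bar> / p"
    unfolding S using \<nu> p by (simp add: abs_mult)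
  also have "\<dots> \<le> (101/100) * (Q * dl * (2001/1000 * eps)) / p"
    using 1 \<nu> p by (intro divide_right_mono mult_mono) auto
  also have "\<dots> = (202101/100000) * (Q * dl * eps / p)" by simp
  also have "\<dots> \<le> (203/100) * (Q * dl * eps / p)"
    using Q_pos dl_pos eps_pos p by (intro mult_right_mono) auto
  finally show "\<bar>\<Sum>t\<in>triangles E. (rel_T n p' u (E - pairs t) - rel_Y1 n p' u (E - pairs t)) / p' - (rel_T n p u E - rel_Y1 n p u E) / p\<bar>
      \<le> Q * (203/100 * dl * (eps / p))"
    unfolding x_def x'_def by simp
  have dx: "\<bar>dl * x\<bar> \<le> dl" 
    using mult_mono[of dl dl "\<bar>x\<bar>" 1] x eps_small dl_pos by (simp add: abs_mult)
  have pt: "\<bar>x' (E - pairs t) / p' - x / p\<bar> \<le> 500 * r / p" if t: "t \<in> triangles E" for t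
  proof -
    have "\<bar>\<Delta> t + dl * x\<bar> \<le> 401 * r" using D(3)[OF t] dx dl_r r_pos by linarith
    then have "\<nu> * \<bar>\<Delta> t + dl * x\<bar> \<le> (101/100) * (401 * r)" using \<nu> by (intro mult_mono) auto
    also have "\<dots> \<le> 500 * r" using r_pos by simp
    finally show ?thesis unfolding eq using \<nu> p by (simp add: abs_mult divide_right_mono)
  qed
  have "500 * r \<le> eps / L\<^sup>2"
  proof -
    have "eps\<^sup>2 / L\<^sup>2 \<le> eps / L\<^sup>2" using eps_sq_small(1) eps_pos by (intro divide_right_mono) auto
    then show ?thesis using r_L r_pos by linarith
  qed
  then have "500 * r / p \<le> eps / L\<^sup>2 / p" using p by (intro divide_right_mono) auto
  then show "\<bar>(rel_T n p' u (E - pairs t) - rel_Y1 n p' u (E - pairs t)) / p' - (rel_T n p u E - rel_Y1 n p u E) / p\<bar>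
      \<le> eps / p / L\<^sup>2" if "t \<in> triangles E" for t
    using pt[OF that] unfolding x_def x'_def by (simp add: mult.commute)
  have "(\<Sum>t\<in>triangles E. \<bar>x' (E - pairs t) / p' - x / p\<bar>) \<le> (\<Sum>t\<in>triangles E. (101/100) * ((\<bar>\<Delta> t\<bar> + dl) / p))"
  proof (rule sum_mono)
    fix t
    have "\<bar>\<Delta> t + dl * x\<bar> \<le> \<bar>\<Delta> t\<bar> + dl" using dx by linarith
    then have "\<nu> * (\<bar>\<Delta> t + dl * x\<bar> / p) \<le> (101/100) * ((\<bar>\<Delta> t\<bar> + dl) / p)"
      using \<nu> p by (intro mult_mono divide_right_mono) auto
    then show "\<bar>x' (E - pairs t) / p' - x / p\<bar> \<le> (101/100) * ((\<bar>\<Delta> t\<bar> + dl) / p)"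
      unfolding eq using \<nu> p by (simp add: abs_mult)
  qed
  also have "\<dots> = (101/100) * (((\<Sum>t\<in>triangles E. \<bar>\<Delta> t\<bar>) + Q * dl) / p)"
    by (simp add: sum_distrib_left[symmetric] sum_divide_distrib[symmetric] sum.distrib Q_def)
  also have "\<dots> \<le> (101/100) * ((Q * (100 * dl) + Q * dl) / p)"
    using D(2) p by (intro mult_left_mono divide_right_mono) auto
  finally have "(\<Sum>t\<in>triangles E. (x' (E - pairs t) / p' - x / p)\<^sup>2)
      \<le> (500 * r / p) * ((101/100) * ((Q * (100 * dl) + Q * dl) / p))"
    using pt r_pos p by (intro sum_squares_le) auto
  also have "\<dots> = Q * dl * (51005 * r) / p\<^sup>2" by (simp add: power2_eq_square field_simps)
  also have "\<dots> \<le> Q * dl * (eps\<^sup>2 / L\<^sup>2) / p\<^sup>2"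
    using r_L r_pos Q_pos dl_pos by (intro divide_right_mono mult_left_mono) auto
  also have "\<dots> = Q * (dl * (eps / p)\<^sup>2 / L\<^sup>2)" by (simp add: power_divide mult_ac)
  finally show "(\<Sum>t\<in>triangles E. ((rel_T n p' u (E - pairs t) - rel_Y1 n p' u (E - pairs t)) / p' - (rel_T n p u E - rel_Y1 n p u E) / p)\<^sup>2)
      \<le> Q * (dl * (eps / p)\<^sup>2 / L\<^sup>2)"
    unfolding x_def x'_def .
qed

end

section \<open>The number of triangles\<close>

context good_state
begin

lemma sum_tdeg_triangle:
  assumes t: "t \<in> triangles E"
  shows "\<bar>(\<Sum>a\<in>pairs t. tdeg E a) - 3 * m\<bar> \<le> 36 * eps * m"
proof -
  have c: "card (pairs t) = 3" "pairs t \<subseteq> E" using t card_pairs_triangle by (auto simp: triangles_def)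
  have "(\<Sum>a\<in>pairs t. tdeg E a) - 3 * m = m * (\<Sum>a\<in>pairs t. h a)"
    by (simp add: h_eq distrib_left sum.distrib c sum_distrib_left)
  moreover have "\<bar>\<Sum>a\<in>pairs t. h a\<bar> \<le> (\<Sum>a\<in>pairs t. 12 * eps)"
    using c h_le by (intro order.trans[OF sum_abs] sum_mono) auto
  ultimately show ?thesis using m_pos c by (simp add: abs_mult mult.commute)
qed

definition "loss t = real (card {s \<in> triangles E. pairs s \<inter> pairs t \<noteq> {}})"

lemma Q_var_remove:
  assumes "t \<in> triangles E"
  shows "real (Q_var (E - pairs t)) = Q - loss t"
proof -
  have "Q - loss t = cnt (triangles E) pairs (E - pairs t)"
  proof -
    have "cnt (triangles E) pairs E = Q"
      by (simp add: cnt_def Q_def) (metis (mono_tags, lifting) Collect_cong Collect_mem_eq mem_Collect_eq triangles_def)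
    moreover have "cnt (triangles E) pairs E - cnt (triangles E) pairs (E - pairs t) = loss t"
      unfolding cnt_loss_eq[OF finite_triangles[OF finite_E]] loss_def of_nat_eq_iff
      by (rule arg_cong[where f = card]) (auto simp: triangles_def)
    ultimately show ?thesis by linarith
  qed
  moreover have "{s \<in> triangles E. pairs s \<subseteq> E - pairs t} = triangles (E - pairs t)"
    by (auto simp: triangles_def)
  ultimately show ?thesis by (simp add: cnt_def Q_var_def)
qed

lemma loss_tdeg:
  assumes t: "t \<in> triangles E"
  shows "loss t \<le> (\<Sum>a\<in>pairs t. tdeg E a)" "(\<Sum>a\<in>pairs t. tdeg E a) - 9 \<le> loss t"
proof -
  have c: "card (pairs t) = 3" using t card_pairs_triangle by (auto simp: triangles_def)
  then have fin: "finite (pairs t)" by (auto intro: card_ge_0_finite)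
  show "loss t \<le> (\<Sum>a\<in>pairs t. tdeg E a)" "(\<Sum>a\<in>pairs t. tdeg E a) - 9 \<le> loss t"
    using hit_le[OF finite_E fin] hit_ge[OF finite_E fin] c by (simp_all add: loss_def)
qed

lemma loss_bounds:
  assumes t: "t \<in> triangles E"
  shows "\<bar>loss t - 3 * m\<bar> \<le> 37 * eps * m"
proof -
  have "9 \<le> eps * m"
  proof -
    have "9 * 1 \<le> 9 * (r * m)" using m_large(1) by simp
    also have "\<dots> \<le> eps * m" using m_large(2) eps_pos m_pos
      by (simp add: mult.assoc[symmetric] mult_right_mono)
    finally show ?thesis by simp
  qed
  moreover have "37 * eps * m = 36 * eps * m + eps * m" by (simp add: algebra_simps)
  ultimately show ?thesis using sum_tdeg_triangle[OF t] loss_tdeg[OF t] by linarith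
qed

text \<open>Error of replacing the total triangle loss, in units of \<open>m\<close>, by
  \<open>6 * Q - 3 * B\<close>. That expression comes from expanding the squared codegrees
  \<open>(m * (1 + h a))^2\<close>: the linear terms are evaluated by \<open>sum_edges_tdeg\<close>,
  and \<open>m * card E\<close> is \<open>3 * B\<close> up to lower order.\<close>

definition "\<zeta> = (\<Sum>t\<in>triangles E. loss t) / m - 6 * Q + 3 * B"

text \<open>What survives the expansion is the sum of the squares of \<open>h\<close>, at most
  \<open>144 * eps^2\<close> per edge. As \<open>m * card E\<close> is at most \<open>3 * B\<close>,
  this gives \<open>3 * 144 = 432\<close>; the last unit covers overlaps of triangles and the term
  \<open>- real n\<close> of the edge count.\<close>

lemma zeta_le: "\<bar>\<zeta>\<bar> \<le> 433 * (B * eps\<^sup>2)"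
proof -
  define H where "H = (\<Sum>t\<in>triangles E. loss t)"
  define S2 where "S2 = (\<Sum>a\<in>E. (tdeg E a)\<^sup>2)"
  define Eh where "Eh = (\<Sum>a\<in>E. (h a)\<^sup>2)"
  define c where "c = (real n)\<^sup>2 * p\<^sup>2 / 2"
  have H1: "H \<le> S2" unfolding H_def S2_def sum_edges_tdeg_sq[symmetric] by (intro sum_mono loss_tdeg)
  have "S2 - 9 * Q = (\<Sum>t\<in>triangles E. (\<Sum>a\<in>pairs t. tdeg E a) - 9)"
    unfolding S2_def sum_edges_tdeg_sq[symmetric] by (simp add: sum_subtractf Q_def)
  also have "\<dots> \<le> H" unfolding H_def by (intro sum_mono loss_tdeg)
  finally have H2: "S2 - 9 * Q \<le> H" .
  have hsum: "m * (\<Sum>a\<in>E. h a) = 3 * Q - m * real (card E)"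
  proof -
    have "3 * Q = (\<Sum>a\<in>E. m * (1 + h a))" using sum_edges_tdeg Q_eq(1) by (simp add: h_eq)
    also have "\<dots> = m * real (card E) + m * (\<Sum>a\<in>E. h a)"
      by (simp add: distrib_left sum.distrib sum_distrib_left)
    finally show ?thesis by linarith
  qed
  have "S2 = (\<Sum>a\<in>E. m * m + 2 * m * (m * h a) + m * m * (h a)\<^sup>2)"
    unfolding S2_def h_eq by (intro sum.cong refl) (simp add: power2_eq_square algebra_simps)
  also have "\<dots> = m * m * real (card E) + 2 * m * (m * (\<Sum>a\<in>E. h a)) + m * m * Eh"
    by (simp add: sum.distrib sum_distrib_left Eh_def)
  also have "\<dots> = m * (6 * Q - m * real (card E) + m * Eh)"
    unfolding hsum by (simp add: algebra_simps)
  finally have S2: "S2 = m * (6 * Q - m * real (card E) + m * Eh)" .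
  have mE: "m * real (card E) = 3 * B - c"
  proof -
    have cE: "real (card E) = ((real n)\<^sup>2 * p - real n) / 2" using card_E by simp
    show ?thesis unfolding cE m_def B_def c_def
      by (simp add: power2_eq_square power3_eq_cube field_simps)
  qed
  have c0: "0 \<le> c" by (simp add: c_def)
  have "c = 3 * B * (1 / (real n * p))"
    using n_pos p by (simp add: c_def B_def power2_eq_square power3_eq_cube)
  also have "\<dots> \<le> 3 * B * (eps\<^sup>2 / 1000000000)"
    using r_ge(2) m_large(3) B_pos by (intro mult_left_mono) auto
  finally have c1: "c \<le> 3/1000000000 * (B * eps\<^sup>2)" by simp
  have Eh0: "0 \<le> m * Eh" using m_pos unfolding Eh_def by (intro mult_nonneg_nonneg sum_nonneg) auto
  have "Eh \<le> (\<Sum>a\<in>E. 144 * eps\<^sup>2)" unfolding Eh_def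
  proof (rule sum_mono)
    fix a assume "a \<in> E"
    then have "\<bar>h a\<bar>\<^sup>2 \<le> (12 * eps)\<^sup>2" using h_le by (intro power_mono) auto
    then show "(h a)\<^sup>2 \<le> 144 * eps\<^sup>2" by (simp add: power_mult_distrib)
  qed
  then have "m * Eh \<le> m * (real (card E) * (144 * eps\<^sup>2))" using m_pos by (intro mult_left_mono) auto
  also have "\<dots> = (3 * B - c) * (144 * eps\<^sup>2)" unfolding mE[symmetric] by simp
  also have "\<dots> \<le> (3 * B) * (144 * eps\<^sup>2)" using c0 by (intro mult_right_mono) auto
  finally have Eh1: "m * Eh \<le> 432 * (B * eps\<^sup>2)" by simp
  have g1: "1 + g \<le> 2" using g_le eps_sq_small(2) by linarith
  have "9 * Q / m = 9 * (B * ((1 + g) * (1 / m)))" by (simp add: Q_eq)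
  also have "\<dots> \<le> 9 * (B * (2 * (eps\<^sup>2 / 1000000000)))"
    using g1 r_ge(3) m_large(3) B_pos m_pos unfolding m_def[symmetric]
    by (intro mult_left_mono mult_mono) auto
  finally have Q9: "9 * Q / m \<le> 18/1000000000 * (B * eps\<^sup>2)" by simp
  define a where "a = H / m"
  define b where "b = S2 / m"
  define d where "d = 9 * Q / m"
  have ab: "a \<le> b" unfolding a_def b_def using H1 m_pos by (intro divide_right_mono) auto
  have "(S2 - 9 * Q) / m \<le> H / m" using H2 m_pos by (intro divide_right_mono) auto
  then have ba: "b - d \<le> a" unfolding a_def b_def d_def by (simp only: diff_divide_distrib)
  have b: "b = 6 * Q - (3 * B - c) + m * Eh" using m_pos by (simp add: b_def S2 mE)
  have Be: "0 \<le> B * eps\<^sup>2" using B_pos by simp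
  have "\<zeta> = a - 6 * Q + 3 * B" by (simp add: \<zeta>_def a_def H_def)
  then show ?thesis using ab ba b c0 c1 Eh0 Eh1 Q9[folded d_def] Be by linarith
qed

text \<open>
  The terms linear in \<open>g\<close> cancel, which is why the relative error of \<open>Q\<close> is of order \<open>eps\<^sup>2\<close>.
\<close>

lemma step_G: "step_ok 440 (eps\<^sup>2) (rel_Q n p E - 1) (\<lambda>E. rel_Q n p' E - 1)"
proof -
  define u where "u = 1 / (1 - dl) ^ 3"
  define \<Delta> where "\<Delta> t = rel_Q n p' (E - pairs t) - 1 - (rel_Q n p E - 1)" for t
  have dl1: "dl \<le> 1/100" using dl_small by simp
  note ub = inverse_power_expansion[OF less_imp_le[OF dl_pos] dl1, of 3, folded u_def, simplified]
  define v where "v = u - 1 - 3 * dl"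
  have dd: "dl\<^sup>2 \<le> dl * (eps\<^sup>2 / 1000000000)"
    unfolding power2_eq_square using dl_r r_pos m_large(3) dl_pos by (intro mult_left_mono) (auto simp: power2_eq_square)
  have v: "0 \<le> v" "v \<le> 50 * dl\<^sup>2" using ub by (auto simp: v_def)
  have dle: "0 \<le> dl * eps\<^sup>2" "0 < dl" using dl_pos by auto
  have e2s: "eps\<^sup>2 \<le> 1/1000000000" using eps_sq_small(2) .
  have "dl * (eps\<^sup>2 / 1000000000) \<le> dl * 1" using e2s dl_pos by (intro mult_left_mono) auto
  then have u1: "0 \<le> u - 1" "u - 1 \<le> 6 * dl"
  proof -
    show "0 \<le> u - 1" using v(1) dl_pos by (simp add: v_def)
    have "50 * dl\<^sup>2 \<le> 50 * (dl * (1/1000000000))"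
      unfolding power2_eq_square using dl_small(1) dl_pos by (intro mult_left_mono) auto
    then show "u - 1 \<le> 6 * dl" using v(2) dl_pos unfolding v_def by linarith
  qed
  have mB: "m = B * dl" using n_pos p by (simp add: m_def B_def dl_def power2_eq_square power3_eq_cube)
  have B': "real n ^ 3 * p' ^ 3 / 6 = B / u"
    by (simp add: B_def u_def p'_def power_mult_distrib)
  have x0: "rel_Q n p E = 1 + g" by (simp add: g_def)
  have \<Delta>_eq: "\<Delta> t = (u - 1) * (1 + g) - u * dl * (loss t / m)" if "t \<in> triangles E" for t
  proof -
    have "rel_Q n p' (E - pairs t) = u * ((Q - loss t) / B)"
      unfolding rel_Q_def Q_var_remove[OF that] B' by simp
    also have "\<dots> = u * (1 + g) - u * (loss t / B)"
      unfolding Q_eq(2) using B_pos by (simp add: diff_divide_distrib right_diff_distrib)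
    also have "loss t / B = dl * (loss t / m)" unfolding mB using dl_pos B_pos by simp
    finally show ?thesis unfolding \<Delta>_def x0 by (simp add: algebra_simps)
  qed
  have g1: "0 \<le> 1 + g" "1 + g \<le> 2" "999/1000 \<le> 1 + g" using g_le e2s by linarith+
  have pt: "\<bar>\<Delta> t\<bar> \<le> 40 * dl * eps" if t: "t \<in> triangles E" for t
  proof -
    define \<nu> where "\<nu> = loss t / m - 3"
    have "\<bar>\<nu>\<bar> \<le> 37 * eps"
      unfolding \<nu>_def by (rule abs_divide_diff_le[OF m_pos]) (use loss_bounds[OF t] in \<open>simp add: mult.commute\<close>)
    then have l3: "\<bar>3 + \<nu>\<bar> \<le> 4" "\<bar>dl * \<nu>\<bar> \<le> dl * (37 * eps)"
      using eps_small dl_pos by (auto simp: abs_mult)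
    have eq: "\<Delta> t = v * (1 + g) + 3 * (dl * g) - (u - 1) * dl * (3 + \<nu>) - dl * \<nu>"
      unfolding \<Delta>_eq[OF t] v_def \<nu>_def by (simp add: algebra_simps)
    have 1: "\<bar>v * (1 + g)\<bar> \<le> 50 * dl\<^sup>2 * 2" unfolding abs_mult using v g1 by (intro mult_mono) auto
    have 2: "\<bar>dl * g\<bar> \<le> dl * (150 * eps\<^sup>2)" unfolding abs_mult using dl_pos g_le by (intro mult_mono) auto
    have 3: "\<bar>(u - 1) * dl * (3 + \<nu>)\<bar> \<le> 6 * dl * dl * 4"
      unfolding abs_mult using u1 dl_pos l3 by (intro mult_mono) auto
    have 4: "dl * eps\<^sup>2 \<le> dl * (eps / 1000000000)" using eps_sq_small(1) dl_pos by (intro mult_left_mono) auto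
    have sc: "6 * dl * dl * 4 = 24 * dl\<^sup>2" "dl * (150 * eps\<^sup>2) = 150 * (dl * eps\<^sup>2)"
      "dl * (eps / 1000000000) = dl * eps / 1000000000" "dl * (37 * eps) = 37 * (dl * eps)"
      "dl * (eps\<^sup>2 / 1000000000) = dl * eps\<^sup>2 / 1000000000" "40 * dl * eps = 40 * (dl * eps)"
      by (simp_all add: power2_eq_square)
    have 5: "0 \<le> dl * eps" using dl_pos eps_pos by simp
    have "\<bar>a + 3 * b - c - d\<bar> \<le> 40 * (dl * eps)"
      if "\<bar>a\<bar> \<le> 50 * dl\<^sup>2 * 2" "\<bar>b\<bar> \<le> 150 * (dl * eps\<^sup>2)" "\<bar>c\<bar> \<le> 24 * dl\<^sup>2" "\<bar>d\<bar> \<le> 37 * (dl * eps)" for a b c d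
      using that 4 5 dd unfolding sc by linarith
    then show ?thesis unfolding eq using 1 2 3 l3(2) unfolding sc by blast
  qed
  show ?thesis
    unfolding step_ok_def \<Delta>_def[symmetric]
  proof (intro conjI ballI)
    have "(\<Sum>t\<in>triangles E. \<Delta> t) = (\<Sum>t\<in>triangles E. (u - 1) * (1 + g) - u * dl * (loss t / m))"
      by (intro sum.cong refl \<Delta>_eq)
    also have "\<dots> = Q * ((u - 1) * (1 + g)) - u * dl * ((\<Sum>t\<in>triangles E. loss t) / m)"
      by (simp add: sum_subtractf Q_def sum_distrib_left sum_divide_distrib)
    also have "(\<Sum>t\<in>triangles E. loss t) / m = 6 * Q - 3 * B + \<zeta>" by (simp add: \<zeta>_def)
    \<comment> \<open>The cancellation is
      \<open>3 (1 + g)^2 - (6 (1 + g) - 3) = 3 g^2\<close>.\<close>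
    also have "Q * ((u - 1) * (1 + g)) - u * dl * (6 * Q - 3 * B + \<zeta>)
      = B * ((1 + g)\<^sup>2 * v + 3 * (dl * g\<^sup>2) - (u - 1) * dl * (6 * (1 + g) - 3)) - u * dl * \<zeta>"
      unfolding Q_eq(2) v_def by (simp add: power2_eq_square algebra_simps)
    finally have S: "(\<Sum>t\<in>triangles E. \<Delta> t)
      = B * ((1 + g)\<^sup>2 * v + 3 * (dl * g\<^sup>2) - (u - 1) * dl * (6 * (1 + g) - 3)) - u * dl * \<zeta>" .
    have 1: "\<bar>(1 + g)\<^sup>2 * v\<bar> \<le> 4 * (50 * dl\<^sup>2)"
      unfolding abs_mult using v g1 power_mono[OF g1(2,1), of 2] by (intro mult_mono) auto
    have "\<bar>g\<bar> * \<bar>g\<bar> \<le> (150 * eps\<^sup>2) * (150 * (1/1000000000))"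
      using g_le e2s by (intro mult_mono) auto
    then have 2: "\<bar>dl * g\<^sup>2\<bar> \<le> dl * (22500/1000000000 * eps\<^sup>2)"
      unfolding abs_mult using dl_pos by (intro mult_mono) (auto simp: power2_eq_square)
    have 3: "\<bar>(u - 1) * dl * (6 * (1 + g) - 3)\<bar> \<le> 6 * dl * dl * 9"
      unfolding abs_mult using u1 dl_pos g1 by (intro mult_mono) auto
    have sc: "6 * dl * dl * 9 = 54 * dl\<^sup>2" "dl * (22500/1000000000 * eps\<^sup>2) = 22500/1000000000 * (dl * eps\<^sup>2)"
      "dl * (eps\<^sup>2 / 1000000000) = dl * eps\<^sup>2 / 1000000000" by (simp_all add: power2_eq_square)
    have "\<bar>a + 3 * b - c\<bar> \<le> 1/10 * (dl * eps\<^sup>2)"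
      if "\<bar>a\<bar> \<le> 4 * (50 * dl\<^sup>2)" "\<bar>b\<bar> \<le> 22500/1000000000 * (dl * eps\<^sup>2)" "\<bar>c\<bar> \<le> 54 * dl\<^sup>2" for a b c
      using that dd dle unfolding sc by linarith
    then have "\<bar>(1 + g)\<^sup>2 * v + 3 * (dl * g\<^sup>2) - (u - 1) * dl * (6 * (1 + g) - 3)\<bar> \<le> 1/10 * (dl * eps\<^sup>2)"
      using 1 2 3 unfolding sc by blast
    then have 4: "\<bar>B * ((1 + g)\<^sup>2 * v + 3 * (dl * g\<^sup>2) - (u - 1) * dl * (6 * (1 + g) - 3))\<bar> \<le> B * (1/10 * (dl * eps\<^sup>2))"
      unfolding abs_mult using B_pos by (intro mult_mono) auto
    have "u \<le> 1001/1000" using u1 dl_small(1) by linarith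
    then have 5: "\<bar>u * dl * \<zeta>\<bar> \<le> (1001/1000 * dl) * (433 * (B * eps\<^sup>2))"
      unfolding abs_mult using u1 dl_pos zeta_le by (intro mult_mono) auto
    have 6: "B * (999/1000) * (440 * dl * eps\<^sup>2) \<le> Q * (440 * dl * eps\<^sup>2)"
      unfolding Q_eq(2) using g1 B_pos dle by (intro mult_right_mono mult_left_mono) auto
    \<comment> \<open>The margin is that \<open>433 * 1.001 + 0.1\<close> stays below
      \<open>440 * 0.999\<close>; the factors 1.001 and 0.999 account for \<open>u\<close> and for
      \<open>Q\<close> against \<open>B\<close>.\<close>
    have "\<bar>\<Sum>t\<in>triangles E. \<Delta> t\<bar> \<le> B * (1/10 * (dl * eps\<^sup>2)) + (1001/1000 * dl) * (433 * (B * eps\<^sup>2))"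
      unfolding S by (rule order.trans[OF abs_triangle_ineq4 add_mono[OF 4 5]])
    also have "\<dots> = 433533/1000 * (B * (dl * eps\<^sup>2))" by simp
    also have "\<dots> \<le> 43956/100 * (B * (dl * eps\<^sup>2))" using B_pos dle by (intro mult_right_mono) auto
    also have "\<dots> = B * (999/1000) * (440 * dl * eps\<^sup>2)" by simp
    also note 6
    finally show "\<bar>\<Sum>t\<in>triangles E. \<Delta> t\<bar> \<le> Q * (440 * dl * eps\<^sup>2)" .
  next
    define z where "z = eps / L\<^sup>2"
    have z0: "0 < z" using eps_pos L by (simp add: z_def)
    have z1: "eps\<^sup>2 / L\<^sup>2 = eps * z" by (simp add: z_def power2_eq_square)
    have "eps * z \<le> 1 * z" using eps_small z0 by (intro mult_right_mono) auto
    then have small: "40 * dl \<le> z" using r_L[unfolded z1] r_pos dl_r by linarith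
    show "\<bar>\<Delta> t\<bar> \<le> eps\<^sup>2 / L\<^sup>2" if "t \<in> triangles E" for t
    proof -
      have "40 * dl * eps \<le> z * eps" using small eps_pos by (intro mult_right_mono) auto
      also have "\<dots> = eps\<^sup>2 / L\<^sup>2" unfolding z1 by simp
      finally show ?thesis using pt[OF that] by linarith
    qed
    have "(\<Sum>t\<in>triangles E. (\<Delta> t)\<^sup>2) \<le> (\<Sum>t\<in>triangles E. (40 * dl * eps)\<^sup>2)"
    proof (rule sum_mono)
      fix t assume "t \<in> triangles E"
      then have "\<bar>\<Delta> t\<bar>\<^sup>2 \<le> (40 * dl * eps)\<^sup>2" using pt by (intro power_mono) auto
      then show "(\<Delta> t)\<^sup>2 \<le> (40 * dl * eps)\<^sup>2" by simp
    qed
    also have "\<dots> = Q * (dl * eps\<^sup>2 * (1600 * dl))" by (simp add: Q_def power2_eq_square)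
    also have "\<dots> \<le> Q * (dl * eps\<^sup>2 * (eps\<^sup>2 / L\<^sup>2))"
    proof -
      have "1600 * dl \<le> eps\<^sup>2 / L\<^sup>2" using r_L r_pos dl_r by linarith
      then show ?thesis using Q_pos dle(1) by (intro mult_left_mono less_imp_le[of 0 Q])
    qed
    also have "\<dots> = Q * (dl * (eps\<^sup>2)\<^sup>2 / L\<^sup>2)" by (simp add: power2_eq_square)
    finally show "(\<Sum>t\<in>triangles E. (\<Delta> t)\<^sup>2) \<le> Q * (dl * (eps\<^sup>2)\<^sup>2 / L\<^sup>2)" .
  qed
qed

end

subsection \<open>The initial graph and the estimates\<close>

lemma packing_graph_complete: "packing_graph n (pairs {1..n})"
  by standard simp

lemma card_pairs_complete: "2 * real (card (pairs {1..n})) = (real n)\<^sup>2 - real n"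
proof -
  have "card (pairs {1..n}) = n choose 2" using n_subsets[of "{1..n}" 2] by (simp add: pairs_def)
  moreover have "2 * real (n choose 2) = real n * (real n - 1)"
    using choose_two[of n] by (cases n) (auto simp: real_of_nat_div algebra_simps)
  ultimately show ?thesis by (simp add: power2_eq_square algebra_simps)
qed

text \<open>The exact counts are products of factors \<open>N\<close>, \<open>N - 1\<close>,
  \<open>N - 2\<close>, \<open>N - 3\<close>; only coincidences of vertices separate them from
  powers of \<open>N\<close>. This serves the initial condition of
  \<open>process_tail\<close>.\<close>

lemma complete_initial:
  assumes n: "4 \<le> n"
  defines "E \<equiv> pairs {1..n}"
  shows "u \<in> {1..n} \<Longrightarrow> \<bar>rel_Y1 n 1 u E - 1\<bar> \<le> 3 / real n"
    "u \<in> {1..n} \<Longrightarrow> \<bar>rel_T n 1 u E - rel_Y1 n 1 u E\<bar> \<le> 3 / real n"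
    "u \<in> {1..n} \<Longrightarrow> \<bar>rel_V n 1 u E - rel_T n 1 u E\<bar> \<le> 3 / real n"
    "u \<in> {1..n} \<Longrightarrow> v \<in> {1..n} \<Longrightarrow> u \<noteq> v \<Longrightarrow> \<bar>rel_Y2 n 1 u v E - 1\<bar> \<le> 3 / real n"
    "u \<in> {1..n} \<Longrightarrow> v \<in> {1..n} \<Longrightarrow> u \<noteq> v \<Longrightarrow> \<bar>rel_R n 1 u v E - rel_Y2 n 1 u v E\<bar> \<le> 3 / real n"
    "u \<in> {1..n} \<Longrightarrow> v \<in> {1..n} \<Longrightarrow> w \<in> {1..n} \<Longrightarrow> distinct [u, v, w] \<Longrightarrow>
      \<bar>rel_Y3 n 1 u v w E - 1\<bar> \<le> 3 / real n"
    "\<bar>rel_Q n 1 E - 1\<bar> \<le> 3 / real n"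
proof -
  interpret packing_graph n E unfolding E_def by (rule packing_graph_complete)
  define N :: real where "N = real n"
  have N: "4 \<le> N" using n by (simp add: N_def)
  have A: "A x y = of_bool (x \<noteq> y)" if "x \<in> V" "y \<in> V" for x y
    using that by (auto simp: adj_def E_def pairs_def card_insert_if)
  have deg: "deg u = N - 1" if u: "u \<in> V" for u
  proof -
    have "deg u = (\<Sum>x\<in>V. of_bool (x \<noteq> u))" unfolding deg_def using A u by (intro sum.cong) auto
    also have "\<dots> = real (card (V - {u}))" by (simp add: Int_def set_diff_eq)
    also have "\<dots> = N - 1" using u n by (simp add: N_def of_nat_diff)
    finally show ?thesis .
  qed
  have cd: "cd u v = N - 2" if uv: "u \<in> V" "v \<in> V" "u \<noteq> v" for u v
  proof -
    have "cd u v = (\<Sum>x\<in>V. of_bool (x \<noteq> u \<and> x \<noteq> v))" unfolding cd_def using A uv by (intro sum.cong) auto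
    also have "\<dots> = real (card (V - {u, v}))" by (simp add: Int_def set_diff_eq)
    also have "card (V - {u, v}) = n - 2" using uv by (subst card_Diff_subset) auto
    finally show ?thesis using n by (simp add: N_def of_nat_diff)
  qed
  have td: "td u v w = N - 3" if uv: "u \<in> V" "v \<in> V" "w \<in> V" "distinct [u, v, w]" for u v w
  proof -
    have "td u v w = (\<Sum>x\<in>V. of_bool (x \<noteq> u \<and> x \<noteq> v \<and> x \<noteq> w))" unfolding td_def using A uv by (intro sum.cong) auto
    also have "\<dots> = real (card (V - {u, v, w}))" by (simp add: Int_def set_diff_eq)
    also have "card (V - {u, v, w}) = n - 3" using uv by (subst card_Diff_subset) auto
    finally show ?thesis using n by (simp add: N_def of_nat_diff)
  qed
  have cT: "cnt (IT n u) (FT u) E = (N - 1) * (N - 2)" if u: "u \<in> V" for u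
  proof -
    have "cnt (IT n u) (FT u) E = (\<Sum>x\<in>V. A u x * (N - 2))"
      unfolding cnt_IT
    proof (intro sum.cong refl)
      fix x assume "x \<in> V"
      then show "A u x * cd u x = A u x * (N - 2)" using cd[of u x] u by (cases "u = x") auto
    qed
    then show ?thesis using deg[OF u] by (simp add: deg_def sum_distrib_right[symmetric])
  qed
  have cR: "cnt (IR n u v) (FR u v) E = (N - 2) * (N - 3)" if uv: "u \<in> V" "v \<in> V" "u \<noteq> v" for u v
  proof -
    have "cnt (IR n u v) (FR u v) E = (\<Sum>x\<in>V. A u x * A v x * (N - 3))"
      unfolding cnt_IR(1)[OF uv(3)]
    proof (intro sum.cong refl)
      fix x assume "x \<in> V"
      then show "A u x * A v x * (cd u x - A u v) = A u x * A v x * (N - 3)"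
        using cd[of u x] uv A[of u v] by (cases "u = x") auto
    qed
    then show ?thesis using cd[OF uv] by (simp add: cd_def sum_distrib_right[symmetric])
  qed
  have cV: "cnt (IV n u) (FV u) E = (N - 1) * (N - 2) * (N - 3)" if u: "u \<in> V" for u
  proof -
    have "cnt (IV n u) (FV u) E = (\<Sum>x\<in>V. \<Sum>y\<in>V. A u x * A u y * A x y * (N - 3))"
      unfolding cnt_IV
    proof (intro sum.cong refl)
      fix x y assume "x \<in> V" "y \<in> V"
      then show "A u x * A u y * A x y * (cd x y - 1) = A u x * A u y * A x y * (N - 3)"
        using cd[of x y] by (cases "x = y") auto
    qed
    also have "\<dots> = (\<Sum>x\<in>V. A u x * cd u x) * (N - 3)"
      unfolding cd_def by (simp add: sum_distrib_left sum_distrib_right mult_ac)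
    finally show ?thesis using cT[OF u] by (simp add: cnt_IT)
  qed
  have Q: "real (Q_var E) = N * (N - 1) * (N - 2) / 6"
  proof -
    have "3 * real (Q_var E) = (\<Sum>a\<in>E. N - 2)"
      unfolding sum_edges_tdeg[symmetric]
    proof (intro sum.cong refl)
      fix a assume a: "a \<in> E"
      then obtain x y where xy: "a = {x, y}" "x \<noteq> y" "x \<in> V" "y \<in> V" by (rule edgeE)
      then show "tdeg E a = N - 2" using a cd[OF xy(3,4,2)] tdeg_eq by simp
    qed
    also have "\<dots> = (N\<^sup>2 - N) / 2 * (N - 2)" using card_pairs_complete[of n] by (simp add: E_def N_def)
    finally show ?thesis by (simp add: power2_eq_square algebra_simps)
  qed
  have N0: "N \<noteq> 0" using N by simp
  have fin: "\<bar>a / N\<bar> \<le> 3 / N" if "\<bar>a\<bar> \<le> 3" for a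
    using that N by (simp add: abs_divide divide_right_mono)
  have q: "0 \<le> 1 / N" "1 / N \<le> 1/4" using N by (auto simp: divide_le_eq)
  show "\<bar>rel_Y1 n 1 u E - 1\<bar> \<le> 3 / real n" if u: "u \<in> V"
  proof -
    have "rel_Y1 n 1 u E - 1 = (- 1) / N" using N0 by (simp add: rel_Y1_def cnt_I1 deg[OF u] N_def[symmetric] field_simps)
    then show ?thesis using fin[of "- 1"] by (simp add: N_def)
  qed
  show "\<bar>rel_Y2 n 1 u v E - 1\<bar> \<le> 3 / real n" if uv: "u \<in> V" "v \<in> V" "u \<noteq> v"
  proof -
    have "rel_Y2 n 1 u v E - 1 = (- 2) / N" using N0 by (simp add: rel_Y2_def cnt_I2 cd[OF uv] N_def[symmetric] field_simps)
    then show ?thesis using fin[of "- 2"] by (simp add: N_def)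
  qed
  show "\<bar>rel_Y3 n 1 u v w E - 1\<bar> \<le> 3 / real n" if uv: "u \<in> V" "v \<in> V" "w \<in> V" "distinct [u, v, w]"
  proof -
    have "rel_Y3 n 1 u v w E - 1 = (- 3) / N" using N0 by (simp add: rel_Y3_def cnt_I3 td[OF uv] N_def[symmetric] field_simps)
    then show ?thesis using fin[of "- 3"] by (simp add: N_def)
  qed
  have j: "\<bar>- 2 * (1 - j)\<bar> \<le> 3" "\<bar>- 3 * (1 - 2 * j)\<bar> \<le> 3" "\<bar>- 3 + 2 * j\<bar> \<le> 3"
    if "0 \<le> j" "j \<le> 1/4" for j :: real
    using that by (simp_all add: abs_le_iff)
  show "\<bar>rel_T n 1 u E - rel_Y1 n 1 u E\<bar> \<le> 3 / real n" if u: "u \<in> V"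
  proof -
    have "rel_T n 1 u E - rel_Y1 n 1 u E = (- 2 * (1 - 1 / N)) / N"
      using N0 by (simp add: rel_T_def rel_Y1_def cnt_I1 deg[OF u] cT[OF u] N_def[symmetric] power2_eq_square field_simps)
    then show ?thesis using fin[OF j(1)[OF q]] by (simp add: N_def)
  qed
  show "\<bar>rel_R n 1 u v E - rel_Y2 n 1 u v E\<bar> \<le> 3 / real n" if uv: "u \<in> V" "v \<in> V" "u \<noteq> v"
  proof -
    have "rel_R n 1 u v E - rel_Y2 n 1 u v E = (- 3 * (1 - 2 * (1 / N))) / N"
      using N0 by (simp add: rel_R_def rel_Y2_def cnt_I2 cd[OF uv] cR[OF uv] N_def[symmetric] power2_eq_square field_simps)
    then show ?thesis using fin[OF j(2)[OF q]] by (simp add: N_def)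
  qed
  show "\<bar>rel_V n 1 u E - rel_T n 1 u E\<bar> \<le> 3 / real n" if u: "u \<in> V"
  proof -
    have eq: "rel_V n 1 u E - rel_T n 1 u E = (- 3 * ((1 - 1 / N) * (1 - 2 * (1 / N)))) / N"
      using N0 by (simp add: rel_V_def rel_T_def cT[OF u] cV[OF u] N_def[symmetric] power2_eq_square power3_eq_cube field_simps)
    have "(1 - 1 / N) * (1 - 2 * (1 / N)) \<le> 1 * 1" using q by (intro mult_mono) auto
    moreover have "0 \<le> (1 - 1 / N) * (1 - 2 * (1 / N))" using q by (intro mult_nonneg_nonneg) auto
    moreover have "\<bar>- 3 * x\<bar> \<le> 3" if "x \<le> 1 * 1" "0 \<le> x" for x :: real using that by simp
    ultimately have "\<bar>- 3 * ((1 - 1 / N) * (1 - 2 * (1 / N)))\<bar> \<le> 3" by blast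
    then show ?thesis unfolding eq using fin by (simp only: N_def)
  qed
  show "\<bar>rel_Q n 1 E - 1\<bar> \<le> 3 / real n"
  proof -
    have eq: "rel_Q n 1 E - 1 = (- 3 + 2 * (1 / N)) / N"
      using N0 by (simp add: rel_Q_def Q N_def[symmetric] power3_eq_cube field_simps)
    show ?thesis unfolding eq using fin[OF j(3)[OF q]] by (simp only: N_def)
  qed
qed

section \<open>Translation into the variables of the theorem\<close>

context packing_graph
begin

lemma Y1_var_eq: "real (Y1_var E u) = cnt (I1 n u) (F1 u) E"
proof -
  have "nbrs E u = {x \<in> I1 n u. F1 u x \<subseteq> E}"
    using edgeD by (fastforce simp: nbrs_def I1_def F1_def insert_commute)
  then show ?thesis by (simp add: Y1_var_def cnt_def)
qed

lemma Y2_var_eq: "real (Y2_var E u v) = cnt (I2 n u v) (F2 u v) E"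
proof -
  have "nbrs E u \<inter> nbrs E v = {x \<in> I2 n u v. F2 u v x \<subseteq> E}"
    using edgeD by (fastforce simp: nbrs_def I2_def F2_def insert_commute)
  then show ?thesis by (simp add: Y2_var_def cnt_def)
qed

lemma Y3_var_eq: "real (Y3_var E u v w) = cnt (I3 n u v w) (F3 u v w) E"
proof -
  have "nbrs E u \<inter> nbrs E v \<inter> nbrs E w = {x \<in> I3 n u v w. F3 u v w x \<subseteq> E}"
    using edgeD by (fastforce simp: nbrs_def I3_def F3_def insert_commute)
  then show ?thesis by (simp add: Y3_var_def cnt_def)
qed

lemma R_var_eq:
  assumes "u \<noteq> v"
  shows "real (R_var E u v) = cnt (IR n u v) (FR u v) E"
proof -
  have "{(x, y). {x, y} \<in> E \<and> x \<in> nbrs E u \<inter> nbrs E v \<and> y \<in> nbrs E u \<and> y \<noteq> v}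
      = {\<iota> \<in> IR n u v. FR u v \<iota> \<subseteq> E}" (is "?L = ?R")
  proof (intro set_eqI)
    fix \<iota> show "\<iota> \<in> ?L \<longleftrightarrow> \<iota> \<in> ?R"
    proof (cases \<iota>)
      case (Pair x y)
      have c: "{x, u} = {u, x}" "{x, v} = {v, x}" "{y, u} = {u, y}" by auto
      show ?thesis using assms edgeD[of u x] edgeD[of v x] edgeD[of u y] edgeD[of x y]
        unfolding Pair
        by (simp only: IR_def FR_def nbrs_def c mem_Collect_eq case_prod_conv insert_subset empty_subsetI
          distinct.simps list.set insert_iff empty_iff Int_iff) blast
    qed
  qed
  then show ?thesis by (simp add: R_var_def cnt_def)
qed

text \<open>Each edge inside the neighbourhood arises from two ordered pairs.\<close>

lemma T_var_eq: "2 * real (T_var E u) = cnt (IT n u) (FT u) E"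
proof -
  let ?T = "{e \<in> E. e \<subseteq> nbrs E u}"
  let ?S = "\<lambda>e. {(x, y). {x, y} = e}"
  have pair: "?S e = {(a, b), (b, a)}" if "e = {a, b}" for e :: "nat set" and a b
    using that by (auto simp: doubleton_eq_iff)
  have c: "finite (?S e) \<and> card (?S e) = 2" if "e \<in> E" for e
  proof -
    obtain a b where "e = {a, b}" "a \<noteq> b" using edgeE[OF \<open>e \<in> E\<close>] by blast
    then show ?thesis using pair[of e a b] by simp
  qed
  have "{\<iota> \<in> IT n u. FT u \<iota> \<subseteq> E} = (\<Union>e\<in>?T. ?S e)" (is "?L = ?R")
  proof (intro set_eqI)
    fix \<iota> show "\<iota> \<in> ?L \<longleftrightarrow> \<iota> \<in> ?R"
    proof (cases \<iota>)
      case (Pair x y)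
      have c: "{x, u} = {u, x}" "{y, u} = {u, y}" by auto
      have "\<iota> \<in> ?L \<longleftrightarrow> {u, x} \<in> E \<and> {u, y} \<in> E \<and> {x, y} \<in> E"
        using edgeD[of u x] edgeD[of u y] edgeD[of x y] unfolding Pair
        by (simp only: IT_def FT_def mem_Collect_eq case_prod_conv insert_subset empty_subsetI
          distinct.simps list.set insert_iff empty_iff) blast
      then show ?thesis unfolding Pair by (simp add: nbrs_def c) blast
    qed
  qed
  then have "card {\<iota> \<in> IT n u. FT u \<iota> \<subseteq> E} = (\<Sum>e\<in>?T. card (?S e))"
    using c finite_E by (simp only:) (subst card_UN_disjoint; auto)
  also have "\<dots> = (\<Sum>e\<in>?T. 2)" using c by (intro sum.cong) auto
  finally show ?thesis by (simp add: cnt_def T_var_def)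
qed

end

context good_state
begin

text \<open>Everything is read off from \<open>eps = L^2 / (a * b^3)\<close>, where \<open>a\<close>
  and \<open>b\<close> are the square roots of \<open>n\<close> and \<open>p\<close>, so that
  half-integer powers become polynomials. Lowering the exponent 1/2 to \<open>gam_hat n\<close>
  enlarges the powers of \<open>p\<close>, and \<open>L^2\<close> is at most \<open>Phi n p\<close>.
  The constant 12 is the codegree bound; 20, 2 and 3 are generous.\<close>

lemma estimates_hold:
  assumes Lln: "L = ln (real n)"
  shows "estimates 12 20 2 3 n p E"
proof -
  define a where "a = sqrt (real n)"
  define b where "b = sqrt p"
  have a: "0 < a" and b: "0 < b" using n_pos p by (auto simp: a_def b_def)
  have na: "real n = a\<^sup>2" and pb: "p = b\<^sup>2" using n_pos p by (auto simp: a_def b_def)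
  have "sqrt (real n * p^3) = a * b^3"
    by (rule real_sqrt_unique) (use a b in \<open>auto simp: na pb power_mult_distrib simp flip: power_mult\<close>)
  then have eps: "eps = L\<^sup>2 / (a * b^3)" by (simp add: eps_def)
  have E1: "real n * p * eps = L\<^sup>2 * (a * (1 / b))"
    and E2: "real n * p\<^sup>2 * eps = L\<^sup>2 * (a * b)"
    and E3: "real n * p^3 * eps = L\<^sup>2 * (a * b^3)"
    and ER: "(real n)\<^sup>2 * p^4 * eps = L\<^sup>2 * (a^3 * b^5)"
    and ET: "(real n)\<^sup>2 * p^3 * eps = L\<^sup>2 * (a^3 * b^3)"
    unfolding eps unfolding na pb using a b by (simp_all add: field_simps eval_nat_numeral)
  define \<Phi> where "\<Phi> = Phi n p"
  have "1 * L\<^sup>2 \<le> exp (1 - p) * L\<^sup>2" using p by (intro mult_right_mono) auto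
  then have \<Phi>: "L\<^sup>2 \<le> \<Phi>" by (simp add: \<Phi>_def Phi_def Lln)
  have L0: "0 < L" "0 < L\<^sup>2" using L by auto
  have pw: "p powr x \<le> p powr y" if "y \<le> x" for x y using powr_mono'[OF that, of p] p by simp
  have gh: "gam_hat n \<le> 1/2" using L0 by (simp add: gam_hat_def gam_def Lln[symmetric])
  have n12: "real n powr (1/2) = a" using n_pos by (simp add: a_def powr_half_sqrt)
  have n32: "real n powr (3/2) = a^3"
  proof -
    have "real n powr (3/2) = real n powr (1/2) * real n powr 1"
      unfolding powr_add[symmetric] by simp
    then show ?thesis using n_pos unfolding n12 by (simp add: na power2_eq_square power3_eq_cube)
  qed
  have p12: "p powr (1/2) = b" using p by (simp add: b_def powr_half_sqrt)
  have pk: "p powr (real k + 1/2) = b^(2 * k + 1)" for k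
    using p b by (simp add: powr_add p12 powr_realpow pb power_mult)
  have P2: "b \<le> p powr gam_hat n" using pw[OF gh] p12 by simp
  have PR: "b^5 \<le> p powr (2 + gam_hat n)" using pw[of "2 + gam_hat n" "2 + 1/2"] gh pk[of 2] by simp
  have PT: "b^3 \<le> p powr (1 + gam_hat n)" using pw[of "1 + gam_hat n" "1 + 1/2"] gh pk[of 1] by simp
  have P1: "1 / b \<le> p powr (gam_hat n - 1)"
  proof -
    have "p powr (1/2 - 1) = p powr (1/2) / p powr 1" by (rule powr_diff)
    also have "\<dots> = 1 / b" unfolding p12 using p b by (simp add: pb power2_eq_square)
    finally show ?thesis using pw[of "gam_hat n - 1" "1/2 - 1"] gh by simp
  qed
  have PQ: "1 \<le> p powr (2 * gam_hat n - 1)"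
    using pw[of "2 * gam_hat n - 1" 0] gh p by simp
  note conv = Y1_var_eq Y2_var_eq Y3_var_eq
  have up: "\<bar>X\<bar> \<le> c * D * d * \<Phi>" if "\<bar>X\<bar> \<le> c * (L\<^sup>2 * (D * q))" "q \<le> d" "0 \<le> q" "0 \<le> c" "0 \<le> D" for X c D q d
  proof -
    have "c * (L\<^sup>2 * (D * q)) = c * D * (q * L\<^sup>2)" by simp
    also have "\<dots> \<le> c * D * (d * \<Phi>)" using that \<Phi> L0 by (intro mult_left_mono mult_mono) auto
    finally show ?thesis using that(1) by (simp add: mult.assoc)
  qed
  show ?thesis
    unfolding estimates_def \<Phi>_def[symmetric]
  proof (intro ballI impI)
    fix u v w assume uvw: "u \<in> V" "v \<in> V" "w \<in> V" and d: "u \<noteq> v \<and> u \<noteq> w \<and> v \<noteq> w"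
    have duv: "u \<noteq> v" "distinct [u, v, w]" using d by auto
    define X1 where "X1 = rel_Y1 n p u E"
    define X2 where "X2 = rel_Y2 n p u v E"
    define X3 where "X3 = rel_Y3 n p u v w E"
    define XT where "XT = rel_T n p u E"
    define XR where "XR = rel_R n p u v E"
    have Y1: "real (Y1_var E u) = real n * p * X1" using n_pos p by (simp add: X1_def rel_Y1_def conv)
    have Y2: "real (Y2_var E u v) = real n * p\<^sup>2 * X2" using n_pos p by (simp add: X2_def rel_Y2_def conv)
    have Y3: "real (Y3_var E u v w) = real n * p^3 * X3" using n_pos p by (simp add: X3_def rel_Y3_def conv)
    have T: "real (T_var E u) = (real n)\<^sup>2 * p^3 * XT / 2" using n_pos p T_var_eq[of u] by (simp add: XT_def rel_T_def)
    have R: "real (R_var E u v) = (real n)\<^sup>2 * p^4 * XR" using n_pos p R_var_eq[OF duv(1)] by (simp add: XR_def rel_R_def)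
    have b1: "\<bar>X1 - 1\<bar> \<le> eps" "X1 \<le> 101/100" "0 \<le> X1"
      using deg_close[OF uvw(1)] rel_bounds(1)[OF uvw(1)] p by (auto simp: X1_def rel_Y1_def)
    have b2: "\<bar>X2 - 1\<bar> \<le> 12 * eps" "X2 \<le> 101/100" "0 \<le> X2"
      using codeg_close[OF uvw(1,2) duv(1)] rel_bounds(4)[OF uvw(1,2) duv(1)] p by (auto simp: X2_def rel_Y2_def)
    have b3: "\<bar>X3 - 1\<bar> \<le> 25 * eps" using codeg3_close[OF uvw duv(2)] by (simp add: X3_def)
    have bT: "\<bar>XT - X1\<bar> \<le> eps" using tri_close[OF uvw(1)] by (simp add: XT_def X1_def)
    have bR: "\<bar>XR - X2\<bar> \<le> 44/5 * eps" using R_close[OF uvw(1,2) duv(1)] by (simp add: XR_def X2_def)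
    have cQ: "real (Q_var E) \<in> (real n)^3 * p^3 / 6 \<plusminus> 12\<^sup>2 * (real n)\<^sup>2 * p powr (2 * gam_hat n - 1) * \<Phi>\<^sup>2"
    proof -
      have "real (Q_var E) - (real n)^3 * p^3 / 6 = B * g" using Q_eq by (simp add: B_def algebra_simps)
      moreover have "\<bar>B * g\<bar> \<le> B * (150 * eps\<^sup>2)" unfolding abs_mult using B_pos g_le by (intro mult_mono) auto
      \<comment> \<open>The 25 is \<open>150 / 6\<close>, well below \<open>12^2\<close>.\<close>
      moreover have "B * (150 * eps\<^sup>2) = 25 * (real n)\<^sup>2 * (1 * (L\<^sup>2)\<^sup>2)"
        unfolding B_def eps_sq r_def using n_pos p by (simp add: field_simps eval_nat_numeral)
      moreover have "25 * (real n)\<^sup>2 * (1 * (L\<^sup>2)\<^sup>2) \<le> 12\<^sup>2 * (real n)\<^sup>2 * (p powr (2 * gam_hat n - 1) * \<Phi>\<^sup>2)"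
        using PQ \<Phi> L0 by (intro mult_mono power_mono) auto
      ultimately have "\<bar>real (Q_var E) - (real n)^3 * p^3 / 6\<bar> \<le> 12\<^sup>2 * (real n)\<^sup>2 * p powr (2 * gam_hat n - 1) * \<Phi>\<^sup>2"
        by (simp add: mult.assoc)
      then show ?thesis by (simp add: abs_le_iff algebra_simps)
    qed
    have c2: "real (Y2_var E u v) \<in> real n * p\<^sup>2 \<plusminus> 12 * real n powr (1/2) * p powr gam_hat n * \<Phi>"
    proof -
      have "real (Y2_var E u v) - real n * p\<^sup>2 = real n * p\<^sup>2 * (X2 - 1)" by (simp add: Y2 algebra_simps)
      then have "\<bar>real (Y2_var E u v) - real n * p\<^sup>2\<bar> \<le> real n * p\<^sup>2 * (12 * eps)"
        using b2 n_pos p by (simp add: abs_mult)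
      also have "\<dots> = 12 * (L\<^sup>2 * (a * b))" unfolding E2[symmetric] by simp
      finally have "\<bar>real (Y2_var E u v) - real n * p\<^sup>2\<bar> \<le> 12 * a * p powr gam_hat n * \<Phi>"
        using P2 a b by (intro up) auto
      then show ?thesis unfolding n12 by (simp add: abs_le_iff)
    qed
    have cR: "real (R_var E u v) \<in> p * real (Y1_var E u) * real (Y2_var E u v)
        \<plusminus> 20 * real n powr (3/2) * p powr (2 + gam_hat n) * \<Phi>"
    proof -
      have "\<bar>X2 * (X1 - 1)\<bar> \<le> (101/100) * eps" unfolding abs_mult using b1 b2 by (intro mult_mono) auto
      \<comment> \<open>\<open>R\<close> is tracked against \<open>Y2\<close> alone, whereas the
        theorem compares it with \<open>p\<close> times the product of \<open>Y1\<close> and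
        \<open>Y2\<close>; the change costs one degree error.\<close>
      moreover have "XR - X1 * X2 = (XR - X2) - X2 * (X1 - 1)" by (simp add: algebra_simps)
      ultimately have "\<bar>XR - X1 * X2\<bar> \<le> 20 * eps" using bR eps_pos by linarith
      moreover have "real (R_var E u v) - p * real (Y1_var E u) * real (Y2_var E u v) = (real n)\<^sup>2 * p^4 * (XR - X1 * X2)"
        by (simp add: R Y1 Y2 algebra_simps eval_nat_numeral)
      ultimately have "\<bar>real (R_var E u v) - p * real (Y1_var E u) * real (Y2_var E u v)\<bar> \<le> (real n)\<^sup>2 * p^4 * (20 * eps)"
        using n_pos p by (simp add: abs_mult)
      also have "\<dots> = 20 * (L\<^sup>2 * (a^3 * b^5))" unfolding ER[symmetric] by simp
      finally have "\<bar>real (R_var E u v) - p * real (Y1_var E u) * real (Y2_var E u v)\<bar>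
          \<le> 20 * a^3 * p powr (2 + gam_hat n) * \<Phi>"
        using PR a b by (intro up) auto
      then show ?thesis unfolding n32 by (simp add: abs_le_iff)
    qed
    have c1: "real (Y1_var E u) \<in> real n * p \<plusminus> 2 * real n powr (1/2) * p powr (gam_hat n - 1) * \<Phi>"
    proof -
      have "real (Y1_var E u) - real n * p = real n * p * (X1 - 1)" by (simp add: Y1 algebra_simps)
      then have "\<bar>real (Y1_var E u) - real n * p\<bar> \<le> real n * p * (2 * eps)"
        using b1 eps_pos n_pos p by (simp add: abs_mult)
      also have "\<dots> = 2 * (L\<^sup>2 * (a * (1 / b)))" unfolding E1[symmetric] by simp
      finally have "\<bar>real (Y1_var E u) - real n * p\<bar> \<le> 2 * a * p powr (gam_hat n - 1) * \<Phi>"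
        using P1 a b by (intro up) auto
      then show ?thesis unfolding n12 by (simp add: abs_le_iff)
    qed
    have cT: "real (T_var E u) \<in> p * (real (Y1_var E u))\<^sup>2 / 2
        \<plusminus> 3 * real n powr (3/2) * p powr (1 + gam_hat n) * \<Phi>"
    proof -
      have "\<bar>X1 * (X1 - 1)\<bar> \<le> (101/100) * eps" unfolding abs_mult using b1 by (intro mult_mono) auto
      moreover have "XT - X1 * X1 = (XT - X1) - X1 * (X1 - 1)" by (simp add: algebra_simps)
      ultimately have bd: "\<bar>XT - X1 * X1\<bar> \<le> 6 * eps" using bT eps_pos by linarith
      have eq: "real (T_var E u) - p * (real (Y1_var E u))\<^sup>2 / 2 = (real n)\<^sup>2 * p^3 / 2 * (XT - X1 * X1)"
        by (simp add: T Y1 algebra_simps eval_nat_numeral)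
      have "\<bar>real (T_var E u) - p * (real (Y1_var E u))\<^sup>2 / 2\<bar> \<le> (real n)\<^sup>2 * p^3 / 2 * (6 * eps)"
        unfolding eq abs_mult using bd n_pos p by (intro mult_mono) auto
      also have "\<dots> = 3 * (L\<^sup>2 * (a^3 * b^3))" unfolding ET[symmetric] by simp
      finally have "\<bar>real (T_var E u) - p * (real (Y1_var E u))\<^sup>2 / 2\<bar> \<le> 3 * a^3 * p powr (1 + gam_hat n) * \<Phi>"
        using PT a b by (intro up) auto
      then show ?thesis unfolding n32 by (simp add: abs_le_iff)
    qed
    have c3: "real (Y3_var E u v w) \<in> real n * p^3 \<plusminus> 2 * sqrt (real n * p^3 * (ln (real n))^5)"
    proof -
      have "real (Y3_var E u v w) - real n * p^3 = real n * p^3 * (X3 - 1)" by (simp add: Y3 algebra_simps)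
      then have "\<bar>real (Y3_var E u v w) - real n * p^3\<bar> \<le> real n * p^3 * (25 * eps)"
        using b3 n_pos p by (simp add: abs_mult)
      also have "\<dots> = 25 * (L\<^sup>2 * (a * b^3))" unfolding E3[symmetric] by simp
      also have "\<dots> \<le> 2 * sqrt (real n * p^3 * L^5)"
      proof -
        \<comment> \<open>The factor \<open>sqrt L\<close> by which the allowance exceeds
          \<open>eps\<close> beats the constant 25 as soon as \<open>L \<ge> 625\<close>.\<close>
        have "625 * (L^4 * (a * b^3)\<^sup>2) \<le> L * (L^4 * (a * b^3)\<^sup>2)"
          using L by (intro mult_right_mono) auto
        also have "\<dots> = real n * p^3 * L^5" by (simp add: na pb power_mult_distrib eval_nat_numeral)
        finally have "(25 * (L\<^sup>2 * (a * b^3)))\<^sup>2 \<le> real n * p^3 * L^5"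
          by (simp add: power_mult_distrib flip: power_mult)
        then have "25 * (L\<^sup>2 * (a * b^3)) \<le> sqrt (real n * p^3 * L^5)" by (rule real_le_rsqrt)
        moreover have "0 \<le> sqrt (real n * p^3 * L^5)" using np3_pos L0 by simp
        ultimately show ?thesis by linarith
      qed
      finally show ?thesis unfolding Lln by (simp add: abs_le_iff)
    qed
    show "real (Q_var E) \<in> (real n)^3 * p^3 / 6 \<plusminus> 12\<^sup>2 * (real n)\<^sup>2 * p powr (2 * gam_hat n - 1) * \<Phi>\<^sup>2 \<and>
        real (Y2_var E u v) \<in> real n * p\<^sup>2 \<plusminus> 12 * real n powr (1/2) * p powr gam_hat n * \<Phi> \<and>
        real (R_var E u v) \<in> p * real (Y1_var E u) * real (Y2_var E u v)
          \<plusminus> 20 * real n powr (3/2) * p powr (2 + gam_hat n) * \<Phi> \<and>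
        real (Y1_var E u) \<in> real n * p \<plusminus> 2 * real n powr (1/2) * p powr (gam_hat n - 1) * \<Phi> \<and>
        real (T_var E u) \<in> p * (real (Y1_var E u))\<^sup>2 / 2
          \<plusminus> 3 * real n powr (3/2) * p powr (1 + gam_hat n) * \<Phi> \<and>
        real (Y3_var E u v w) \<in> real n * p^3 \<plusminus> 2 * sqrt (real n * p^3 * (ln (real n))^5)"
      using cQ c2 cR c1 cT c3 by blast
  qed
qed

end

subsection \<open>Assembling the statistics\<close>

text \<open>\<open>SD\<close>, \<open>SE\<close>, \<open>SK\<close>, \<open>SY\<close>,
  \<open>SF\<close> stand for the quantities \<open>d\<close>, \<open>e\<close>, \<open>q\<close>,
  \<open>y\<close>, \<open>f\<close> of the overview, \<open>SW\<close> for triple codegrees and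
  \<open>SG\<close> for the number of triangles.\<close>

datatype stat = SD nat | SE nat | SK nat | SY nat nat | SF nat nat | SW nat nat nat | SG

fun stat_val :: "nat \<Rightarrow> real \<Rightarrow> nat set set \<Rightarrow> stat \<Rightarrow> real" where
  "stat_val n p E (SD u) = rel_Y1 n p u E - 1"
| "stat_val n p E (SE u) = (rel_T n p u E - rel_Y1 n p u E) / p"
| "stat_val n p E (SK u) = rel_V n p u E - rel_T n p u E"
| "stat_val n p E (SY u v) = rel_Y2 n p u v E - 1"
| "stat_val n p E (SF u v) = rel_R n p u v E - rel_Y2 n p u v E"
| "stat_val n p E (SW u v w) = rel_Y3 n p u v w E - 1"
| "stat_val n p E SG = rel_Q n p E - 1"

text \<open>The unit \<open>eps\<close> as a function of \<open>p\<close> outside the locale, since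
  \<open>p\<close> varies along the process.\<close>

definition base_env :: "nat \<Rightarrow> real \<Rightarrow> real" where
  "base_env n p = (ln (real n))\<^sup>2 / sqrt (real n * p^3)"

fun env :: "nat \<Rightarrow> real \<Rightarrow> stat \<Rightarrow> real" where
  "env n p (SE u) = base_env n p / p"
| "env n p SG = (base_env n p)\<^sup>2"
| "env n p _ = base_env n p"

fun bnd :: "stat \<Rightarrow> real" where
  "bnd (SD u) = 1"
| "bnd (SE u) = 1"
| "bnd (SK u) = 2"
| "bnd (SY u v) = 12"
| "bnd (SF u v) = 44/5"
| "bnd (SW u v w) = 25"
| "bnd SG = 150"

text \<open>The rates proved in the lemmas \<open>step_D\<close> to \<open>step_G\<close>. The
  budget, drift rate over growth rate plus 11/100 at most \<open>bnd\<close>, is tightest for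
  \<open>SF\<close>: \<open>1301/150 + 11/100\<close> is just below \<open>44/5\<close>.\<close>

fun drift_rate :: "stat \<Rightarrow> real" where
  "drift_rate (SD u) = 101/100"
| "drift_rate (SE u) = 203/100"
| "drift_rate (SK u) = 203/100"
| "drift_rate (SY u v) = 1761/100"
| "drift_rate (SF u v) = 1301/100"
| "drift_rate (SW u v w) = 3651/100"
| "drift_rate SG = 440"

text \<open>Exponents of \<open>1 / p\<close> in the envelopes: 3/2 for \<open>eps\<close>, one more
  through the weight of \<open>SE\<close>, twice as much for the square used by
  \<open>SG\<close>.\<close>

fun growth_rate :: "stat \<Rightarrow> real" where
  "growth_rate (SE u) = 5/2"
| "growth_rate SG = 3"
| "growth_rate _ = 3/2"

definition stats :: "nat \<Rightarrow> stat set" where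
  "stats n = {SG} \<union> SD ` {1..n} \<union> SE ` {1..n} \<union> SK ` {1..n}
    \<union> (\<lambda>(u, v). SY u v) ` {(u, v) \<in> {1..n} \<times> {1..n}. u \<noteq> v}
    \<union> (\<lambda>(u, v). SF u v) ` {(u, v) \<in> {1..n} \<times> {1..n}. u \<noteq> v}
    \<union> (\<lambda>(u, v, w). SW u v w) ` {(u, v, w) \<in> {1..n} \<times> {1..n} \<times> {1..n}. distinct [u, v, w]}"

lemma stats_iff [simp]:
  "SG \<in> stats n" "SD u \<in> stats n \<longleftrightarrow> u \<in> {1..n}" "SE u \<in> stats n \<longleftrightarrow> u \<in> {1..n}"
  "SK u \<in> stats n \<longleftrightarrow> u \<in> {1..n}"
  "SY u v \<in> stats n \<longleftrightarrow> u \<in> {1..n} \<and> v \<in> {1..n} \<and> u \<noteq> v"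
  "SF u v \<in> stats n \<longleftrightarrow> u \<in> {1..n} \<and> v \<in> {1..n} \<and> u \<noteq> v"
  "SW u v w \<in> stats n \<longleftrightarrow> u \<in> {1..n} \<and> v \<in> {1..n} \<and> w \<in> {1..n} \<and> distinct [u, v, w]"
  by (auto simp: stats_def image_iff)

lemma stats_subset: "stats n \<subseteq> {SG} \<union> SD ` {1..n} \<union> SE ` {1..n} \<union> SK ` {1..n}
    \<union> (\<lambda>(u, v). SY u v) ` ({1..n} \<times> {1..n}) \<union> (\<lambda>(u, v). SF u v) ` ({1..n} \<times> {1..n})
    \<union> (\<lambda>(u, v, w). SW u v w) ` ({1..n} \<times> {1..n} \<times> {1..n})" (is "_ \<subseteq> ?S")
  unfolding stats_def by blast

lemma finite_stats: "finite (stats n)"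
  by (rule finite_subset[OF stats_subset]) simp

lemma card_stats:
  assumes "1 \<le> n"
  shows "card (stats n) \<le> 7 * n ^ 3"
proof -
  let ?V = "{1..n}"
  have "card (stats n) \<le> card ({SG} \<union> SD ` ?V \<union> SE ` ?V \<union> SK ` ?V
    \<union> (\<lambda>(u, v). SY u v) ` (?V \<times> ?V) \<union> (\<lambda>(u, v). SF u v) ` (?V \<times> ?V)
    \<union> (\<lambda>(u, v, w). SW u v w) ` (?V \<times> ?V \<times> ?V))"
    by (intro card_mono stats_subset) simp
  also have "\<dots> \<le> 1 + n + n + n + n * n + n * n + n * (n * n)"
    by (intro order.trans[OF card_Un_le] add_mono order.trans[OF card_image_le])
       (simp_all add: card_cartesian_product)
  also have "\<dots> \<le> 7 * n ^ 3"
  proof -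
    have "1 \<le> n ^ 3" "n \<le> n ^ 3" "n * n \<le> n ^ 3"
      using assms power_increasing[of 1 3 n] power_increasing[of 2 3 n] by (auto simp: power2_eq_square)
    moreover have "n * (n * n) = n ^ 3" by (simp add: power3_eq_cube)
    ultimately show ?thesis by linarith
  qed
  finally show ?thesis .
qed

text \<open>Every step removes exactly three edges, so the edge count, unlike the other counts, is
  not random.\<close>

lemma greedy_process_trajectory:
  assumes "finite E" "Gs \<in> set_pmf (greedy_process E)" "j < length Gs"
  shows "Gs ! j \<subseteq> E \<and> card (Gs ! j) + 3 * j = card E"
  using assms
proof (induction E arbitrary: Gs j rule: greedy_process.induct)
  case (1 E)
  show ?case
  proof (cases "triangles E = {}")
    case True
    then have "Gs = [E]" using 1(3) by (subst (asm) greedy_process.simps) auto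
    then show ?thesis using 1(4) by simp
  next
    case False
    have ft: "finite (triangles E)" using 1(2) by (rule finite_triangles)
    have "Gs \<in> set_pmf (bind_pmf (pmf_of_set (triangles E))
             (\<lambda>t. map_pmf (\<lambda>Gs. E # Gs) (greedy_process (E - pairs t))))"
      using 1(2,3) False by (subst (asm) greedy_process.simps) simp
    then obtain t Hs where t: "t \<in> set_pmf (pmf_of_set (triangles E))"
      and Hs: "Hs \<in> set_pmf (greedy_process (E - pairs t))" "Gs = E # Hs"
      by auto
    then have "t \<in> triangles E" using ft False by simp
    then have p3: "card (pairs t) = 3" "pairs t \<subseteq> E" using card_pairs_triangle by (auto simp: triangles_def)
    show ?thesis
    proof (cases j)
      case 0
      then show ?thesis by (simp add: Hs(2))
    next
      case (Suc k)
      have "Hs ! k \<subseteq> E - pairs t \<and> card (Hs ! k) + 3 * k = card (E - pairs t)"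
        using 1(1)[OF _ t _ Hs(1), of k] 1(2,4) False Suc Hs(2) by simp
      moreover have "card (E - pairs t) = card E - 3"
        using p3 finite_subset[OF p3(2) 1(2)] by (simp add: card_Diff_subset)
      moreover have "3 \<le> card E" using card_mono[OF 1(2) p3(2)] p3(1) by simp
      ultimately show ?thesis using Suc Hs(2) by auto
    qed
  qed
qed

lemma scale_base_env: "scale n p (ln (real n)) \<Longrightarrow> scale.eps n p (ln (real n)) = base_env n p"
  by (simp add: scale.eps_def base_env_def)

lemma good_state_of_stats:
  assumes s: "scale n p (ln (real n))" and E: "E \<subseteq> pairs {1..n}" "2 * real (card E) = (real n)\<^sup>2 * p - real n"
    and st: "\<forall>\<kappa>\<in>stats n. \<bar>stat_val n p E \<kappa>\<bar> \<le> bnd \<kappa> * env n p \<kappa>"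
  shows "good_state n p (ln (real n)) E"
proof -
  interpret scale n p "ln (real n)" by fact
  interpret packing_graph n E by standard fact
  note e = scale_base_env[OF s]
  have p: "0 < p" using scale_axioms by (simp add: scale_def)
  have S: "\<kappa> \<in> stats n \<Longrightarrow> \<bar>stat_val n p E \<kappa>\<bar> \<le> bnd \<kappa> * env n p \<kappa>" for \<kappa> using st by blast
  show ?thesis
  proof (standard, goal_cases)
    case 1 then show ?case by (rule E(2))
  next
    case (2 u) then show ?case using S[of "SD u"] by (simp add: e)
  next
    case (3 u) then show ?case using S[of "SE u"] p by (simp add: e abs_divide divide_right_mono divide_le_cancel)
  next
    case (4 u) then show ?case using S[of "SK u"] by (simp add: e)
  next
    case (5 u v) then show ?case using S[of "SY u v"] by (simp add: e)
  next
    case (6 u v) then show ?case using S[of "SF u v"] by (simp add: e)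
  next
    case (7 u v w) then show ?case using S[of "SW u v w"] by (simp add: e)
  next
    case 8 then show ?case using S[of SG] by (simp add: e)
  qed
qed

lemma step_ok_stats:
  assumes g: "good_state n p (ln (real n)) E" and \<kappa>: "\<kappa> \<in> stats n"
  shows "good_state.step_ok n p (ln (real n)) E (drift_rate \<kappa>) (env n p \<kappa>) (stat_val n p E \<kappa>)
    (\<lambda>E. stat_val n (p - 6 / (real n)\<^sup>2) E \<kappa>)"
proof -
  interpret good_state n p "ln (real n)" E by fact
  note e = scale_base_env[OF scale_axioms] p'_eq
  show ?thesis
    using \<kappa> step_D step_E step_K step_Y step_F step_W step_G
    by (cases \<kappa>) (simp_all add: e)
qed

text \<open>Besides \<open>eps_growth\<close> this uses
  \<open>(1 + 5/2 d) (1 - d) \<le> 1 + 3/2 d\<close> for \<open>SE\<close> and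
  \<open>1 + 3 d \<le> (1 + 3/2 d)^2\<close> for \<open>SG\<close>.\<close>

lemma env_growth:
  assumes s: "scale n p (ln (real n))"
  shows "(1 + growth_rate \<kappa> * (6 / ((real n)\<^sup>2 * p))) * env n p \<kappa> \<le> env n (p - 6 / (real n)\<^sup>2) \<kappa>"
proof -
  interpret scale n p "ln (real n)" by fact
  define \<epsilon> where "\<epsilon> = base_env n p"
  define \<epsilon>' where "\<epsilon>' = base_env n (p - 6 / (real n)\<^sup>2)"
  have d: "6 / ((real n)\<^sup>2 * p) = dl" by (simp add: dl_def)
  have \<epsilon>: "0 < \<epsilon>" using eps_pos scale_base_env[OF s] by (simp add: \<epsilon>_def)
  have base: "(1 + 3/2 * dl) * \<epsilon> \<le> \<epsilon>'"
    using eps_growth scale_base_env[OF s] by (simp add: \<epsilon>_def \<epsilon>'_def base_env_def p'_eq)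
  have p: "0 < p" using scale_axioms by (simp add: scale_def)
  have dl1: "dl < 1" using dl_small by linarith
  have "(1 + 5/2 * dl) * (\<epsilon> / p) \<le> \<epsilon>' / p'"
  proof -
    have "(1 + 5/2 * dl) * (1 - dl) \<le> 1 + 3/2 * dl" using dl_pos by (simp add: algebra_simps)
    then have "(1 + 5/2 * dl) * (1 - dl) * \<epsilon> \<le> (1 + 3/2 * dl) * \<epsilon>"
      using \<epsilon> by (intro mult_right_mono) auto
    then have "(1 + 5/2 * dl) * \<epsilon> * (1 - dl) \<le> \<epsilon>'" using base by (simp add: mult_ac)
    then have "(1 + 5/2 * dl) * \<epsilon> \<le> \<epsilon>' / (1 - dl)" using dl1 by (simp add: le_divide_eq)
    then have "(1 + 5/2 * dl) * \<epsilon> / p \<le> \<epsilon>' / (1 - dl) / p" using p by (intro divide_right_mono) auto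
    then show ?thesis by (simp add: p'_def mult_ac)
  qed
  moreover have "(1 + 3 * dl) * \<epsilon>\<^sup>2 \<le> \<epsilon>'\<^sup>2"
  proof -
    have "1 + 3 * dl \<le> (1 + 3/2 * dl)\<^sup>2" by (simp add: power2_eq_square algebra_simps)
    then have "(1 + 3 * dl) * \<epsilon>\<^sup>2 \<le> ((1 + 3/2 * dl) * \<epsilon>)\<^sup>2"
      unfolding power_mult_distrib by (rule mult_right_mono) simp
    also have "\<dots> \<le> \<epsilon>'\<^sup>2" using base \<epsilon> dl_pos by (intro power_mono) auto
    finally show ?thesis .
  qed
  ultimately show ?thesis using base unfolding d
    by (cases \<kappa>) (simp_all add: \<epsilon>_def[symmetric] \<epsilon>'_def[symmetric] p'_eq)
qed

lemma dens_Suc: "dens n (Suc i) = dens n i - 6 / (real n)\<^sup>2"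
  by (simp add: dens_def add_divide_distrib algebra_simps)

text \<open>The invariant holds only what is deterministic, the vertex set and the edge count.
  Together with the bounds at the current time it makes the graph a \<open>good_state\<close>, where
  \<open>step_ok_stats\<close> gives drift, increments and variance.\<close>

lemma failure_bound:
  fixes n m :: nat
  defines "L \<equiv> ln (real n)"
  assumes sc: "\<And>i. i \<le> m \<Longrightarrow> scale n (dens n i) L"
  shows "measure_pmf.prob (greedy_process (pairs {1..n}))
      {Gs. \<exists>j\<le>m. \<not> (j < length Gs \<and>
        (\<forall>\<kappa>\<in>stats n. \<bar>stat_val n (dens n j) (Gs ! j) \<kappa>\<bar> \<le> bnd \<kappa> * env n (dens n j) \<kappa>))}
    \<le> real (card (stats n)) * 2 * real (m + 1) * exp (- 7 * L)"
proof -
  define Inv where "Inv i E \<longleftrightarrow> E \<subseteq> pairs {1..n} \<and> 2 * real (card E) = (real n)\<^sup>2 * dens n i - real n" for i E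
  have s0: "scale n 1 L" using sc[of 0] by (simp add: dens_def)
  interpret s0: scale n 1 L by (rule s0)
  have n: "0 < real n" by (rule s0.n_pos)
  have L: "10^6 \<le> L" "L ^ 10 \<le> real n" using s0 by (auto simp: scale_def)
  have good: "good_state n (dens n i) L E"
    if "Inv i E" "\<forall>\<kappa>\<in>stats n. \<bar>stat_val n (dens n i) E \<kappa>\<bar> \<le> bnd \<kappa> * env n (dens n i) \<kappa>" "i < m" for i E
    using good_state_of_stats[of n "dens n i" E] that sc[of i] by (auto simp: Inv_def L_def)
  have ok: "good_state.step_ok n (dens n i) L E (drift_rate \<kappa>) (env n (dens n i) \<kappa>) (stat_val n (dens n i) E \<kappa>)
      (\<lambda>E. stat_val n (dens n (Suc i)) E \<kappa>)" 
    if "Inv i E" "\<forall>\<kappa>\<in>stats n. \<bar>stat_val n (dens n i) E \<kappa>\<bar> \<le> bnd \<kappa> * env n (dens n i) \<kappa>" "i < m" "\<kappa> \<in> stats n" for i E \<kappa>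
    using step_ok_stats[of n "dens n i" E \<kappa>] good[OF that(1-3)] that(4) by (simp add: L_def dens_Suc)
  have small: "3 / real n \<le> env n 1 \<kappa> / 100" if "\<kappa> \<in> stats n" for \<kappa>
  proof -
    have e: "base_env n 1 = s0.eps" using scale_base_env[of n 1] s0 by (simp add: L_def)
    \<comment> \<open>At \<open>p = 1\<close> the smallest envelope is that of \<open>SG\<close>,
      namely \<open>eps^2 = L^4 / n\<close>.\<close>
    have "300 * (1 / real n) \<le> L ^ 4 * (1 / real n)"
      using power_mono[OF L(1), of 4] n by (intro mult_right_mono) auto
    also have "\<dots> = s0.eps\<^sup>2" by (simp add: s0.eps_sq s0.r_def)
    finally have 1: "300 / real n \<le> s0.eps\<^sup>2" by simp
    have 2: "s0.eps\<^sup>2 \<le> s0.eps" using s0.eps_sq_small(1) s0.eps_pos by linarith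
    show ?thesis using 1 2 by (cases \<kappa>) (simp_all add: e)
  qed
  show ?thesis
  proof (rule process_tail[where Inv = Inv and W = "\<lambda>\<kappa> i E. stat_val n (dens n i) E \<kappa>"
        and g = "\<lambda>\<kappa> i. env n (dens n i) \<kappa>" and b = bnd and \<mu> = drift_rate and s = growth_rate
        and d = "\<lambda>i. 6 / ((real n)\<^sup>2 * dens n i)" and K = "stats n"], goal_cases)
    case 1 show ?case by (rule finite_stats)
  next
    case 2 show ?case using L by simp
  next
    case (3 i E)
    then show ?case using packing_graph.finite_E[of n E] by (simp add: Inv_def packing_graph_def)
  next
    case (4 i E t)
    have E: "E \<subseteq> pairs {1..n}" "2 * real (card E) = (real n)\<^sup>2 * dens n i - real n" using 4(1) by (auto simp: Inv_def)
    then have fE: "finite E" using packing_graph.finite_E[of n E] by (simp add: packing_graph_def)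
    have p3: "card (pairs t) = 3" "pairs t \<subseteq> E" using 4(4) card_pairs_triangle by (auto simp: triangles_def)
    have "finite (pairs t)" using p3 fE finite_subset by blast
    then have "card (E - pairs t) = card E - 3" using p3 by (simp add: card_Diff_subset)
    moreover have "3 \<le> card E" using card_mono[OF fE p3(2)] p3(1) by simp
    ultimately have "2 * real (card (E - pairs t)) = 2 * real (card E) - 6" by (simp add: of_nat_diff)
    also have "\<dots> = (real n)\<^sup>2 * dens n (Suc i) - real n"
      using n by (simp add: E(2) dens_Suc right_diff_distrib)
    finally show ?case using E(1) by (auto simp: Inv_def)
  next
    case (5 i E)
    then show ?case using good_state.Q_pos[OF good[OF 5]] good_state.Q_def[OF good[OF 5]] by auto
  next
    case (6 \<kappa> i E)
    note g = good[OF 6(2-4)]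
    show ?case using ok[OF 6(2-4,1)] unfolding good_state.step_ok_def[OF g] good_state.Q_def[OF g]
      by (simp add: scale.dl_def[OF sc] 6(4) less_imp_le)
  next
    case (7 \<kappa> i E t)
    note g = good[OF 7(2-4)]
    show ?case using ok[OF 7(2-4,1)] 7(5) unfolding good_state.step_ok_def[OF g] by blast
  next
    case (8 \<kappa> i E)
    note g = good[OF 8(2-4)]
    show ?case using ok[OF 8(2-4,1)] unfolding good_state.step_ok_def[OF g] good_state.Q_def[OF g]
      by (simp add: scale.dl_def[OF sc] 8(4) less_imp_le)
  next
    case (9 \<kappa> i)
    have "0 < base_env n (dens n i)" using scale.eps_pos[OF sc[OF 9(2)]] scale_base_env[of n "dens n i"] sc[OF 9(2)]
      by (simp add: L_def)
    moreover have "0 < dens n i" using sc[OF 9(2)] by (simp add: scale_def)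
    ultimately show ?case by (cases \<kappa>) auto
  next
    case (10 i)
    have "0 < dens n i" using sc[of i] 10 by (simp add: scale_def)
    then show ?case by simp
  next
    case (11 \<kappa> i)
    show ?case using env_growth[of n "dens n i" \<kappa>] sc[of i] 11 by (simp add: dens_Suc L_def)
  next
    case (12 \<kappa>) show ?case by (cases \<kappa>) auto
  next
    case (13 \<kappa>) show ?case by (cases \<kappa>) auto
  next
    case (14 \<kappa>) show ?case by (cases \<kappa>) auto
  next
    case 15 show ?case using card_pairs_complete[of n] by (simp add: Inv_def dens_def)
  next
    case (16 \<kappa>)
    have "4 \<le> real n" using L power_increasing[of 1 10 L] by simp
    then have n4: "4 \<le> n" by simp
    have "\<bar>stat_val n 1 (pairs {1..n}) \<kappa>\<bar> \<le> 3 / real n"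
      using complete_initial[OF n4] 16 by (cases \<kappa>) (simp_all del: One_nat_def)
    then show ?case using small[OF 16] by (simp add: dens_def)
  qed
qed

section \<open>From the threshold to the probability bound\<close>

text \<open>The exponent \<open>4 - 2 * gam_hat n\<close> equals \<open>3 + 12 / L\<close>, so at
  the threshold \<open>p\<close> to this power is at least \<open>864 e^2 L^10 / n\<close>. As
  \<open>p \<le> 1\<close>, dropping \<open>12 / L\<close> from the exponent only enlarges the
  power, and \<open>n p^3 \<ge> L^10\<close> follows.\<close>

lemma scale_of_dens:
  assumes L: "10^6 \<le> ln (real n)" and i: "pstar 12 n \<le> dens n i"
  shows "scale n (dens n i) (ln (real n))"
proof -
  define L where "L = ln (real n)"
  define p where "p = dens n i"
  define c where "c = 6 * 12\<^sup>2 * (exp 1)\<^sup>2 * (L ^ 10 / real n)"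
  have L0: "0 < L" using L by (simp add: L_def)
  have n: "0 < real n" using L by (cases n) auto
  have c0: "0 < c" using L0 n by (simp add: c_def)
  have ps: "pstar 12 n = c powr (1 / (4 - 2 * gam_hat n))" by (simp add: pstar_def c_def L_def)
  have ex: "4 - 2 * gam_hat n = 3 + 12 / L" by (simp add: gam_hat_def gam_def L_def)
  have e0: "0 < 3 + 12 / L" using L0 by (simp add: add_pos_pos)
  have pp: "c powr (1 / (3 + 12 / L)) \<le> p" using i ps ex by (simp add: p_def)
  then have p0: "0 < p" using powr_gt_zero[of c "1 / (3 + 12 / L)"] c0 by linarith
  have p1: "p \<le> 1" by (simp add: p_def dens_def)
  have "c = (c powr (1 / (3 + 12 / L))) powr (3 + 12 / L)" using c0 e0 by (simp add: powr_powr)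
  also have "\<dots> \<le> p powr (3 + 12 / L)" using pp e0 by (intro powr_mono2) auto
  also have "\<dots> \<le> p powr 3" using powr_mono'[of 3 "3 + 12 / L" p] p0 p1 L0 by simp
  also have "p powr 3 = p ^ 3" using p0 powr_realpow[of p 3] by simp
  finally have "real n * c \<le> real n * p ^ 3" using n by (intro mult_left_mono) auto
  moreover have "L ^ 10 \<le> real n * c"
  proof -
    have "1 \<le> exp (1::real)" by simp
    then have "1 \<le> (exp (1::real))\<^sup>2" by (rule one_le_power)
    moreover have "6 * 12\<^sup>2 * (exp (1::real))\<^sup>2 = 864 * (exp 1)\<^sup>2" by simp
    ultimately have "1 \<le> 6 * 12\<^sup>2 * (exp (1::real))\<^sup>2" by linarith
    then have "1 * L ^ 10 \<le> (6 * 12\<^sup>2 * (exp 1)\<^sup>2) * L ^ 10" using L0 by (intro mult_right_mono zero_le_power less_imp_le[of 0 L])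
    also have "\<dots> = real n * c" using n by (simp add: c_def)
    finally show ?thesis by simp
  qed
  ultimately show ?thesis
    using L p0 p1 by (simp add: scale_def L_def[symmetric] p_def[symmetric])
qed

text \<open>Union bound: at most \<open>7 n^3\<close> statistics, two signs and at most
  \<open>n^2\<close> target times, each of weight \<open>exp (- 7 * L) = 1 / n^7\<close>, leave
  \<open>14 / n^2\<close>.\<close>

lemma success_probability:
  assumes L: "10^6 \<le> ln (real n)"
  shows "1 - 14 / (real n)\<^sup>2 \<le> measure_pmf.prob (triangle_packing_process n)
       {Gs. \<forall>i. dens n i \<ge> pstar 12 n \<longrightarrow>
          i < length Gs \<and> estimates 12 20 2 3 n (dens n i) (Gs ! i)}" (is "_ \<le> measure_pmf.prob ?P ?T")
proof -
  define J where "J = {i. pstar 12 n \<le> dens n i}"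
  have n0: "0 < real n" using L by (cases n) auto
  have Jpos: "0 < dens n i" if "i \<in> J" for i
    using scale_of_dens[OF L, of i] that by (simp add: J_def scale_def)
  have Jle: "6 * i < n\<^sup>2" if "i \<in> J" for i
  proof -
    have "6 * real i / (real n)\<^sup>2 < 1" using Jpos[OF that] by (simp add: dens_def)
    then have "6 * real i < (real n)\<^sup>2" using n0 by (simp add: divide_less_eq)
    then have "real (6 * i) < real (n\<^sup>2)" by simp
    then show ?thesis by (simp only: of_nat_less_iff)
  qed
  have "J \<subseteq> {..<n\<^sup>2}" using Jle by fastforce
  then have finJ: "finite J" by (rule finite_subset) simp
  show ?thesis
  proof (cases "J = {}")
    case True
    \<comment> \<open>No step is above the threshold, so the condition is vacuous.\<close>
    then have "?T = UNIV" by (auto simp: J_def)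
    then show ?thesis by simp
  next
    case False
    define m where "m = Max J"
    have mJ: "m \<in> J" unfolding m_def using finJ False by (rule Max_in)
    have Jm: "i \<le> m" if "i \<in> J" for i unfolding m_def using finJ that by (rule Max_ge)
    \<comment> \<open>The density decreases along the steps, so the steps above the threshold form
      an initial segment, and control up to its last member is enough.\<close>
    have dm: "i \<in> J" if "i \<le> m" for i
    proof -
      have "dens n m \<le> dens n i" using that by (simp add: dens_def divide_right_mono)
      then show ?thesis using mJ by (simp add: J_def)
    qed
    have sc: "scale n (dens n i) (ln (real n))" if "i \<le> m" for i
      using scale_of_dens[OF L] dm[OF that] by (simp add: J_def)
    let ?F = "{Gs. \<exists>j\<le>m. \<not> (j < length Gs \<and>
        (\<forall>\<kappa>\<in>stats n. \<bar>stat_val n (dens n j) (Gs ! j) \<kappa>\<bar> \<le> bnd \<kappa> * env n (dens n j) \<kappa>))}"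
    have "m + 1 \<le> n\<^sup>2" using Jle[OF mJ] by linarith
    then have m1: "real (m + 1) \<le> (real n)\<^sup>2" by (metis of_nat_le_iff of_nat_power)
    have n1: "1 \<le> n" using n0 by simp
    have "real (card (stats n)) \<le> real (7 * n ^ 3)" unfolding of_nat_le_iff by (rule card_stats[OF n1])
    then have cs: "real (card (stats n)) \<le> 7 * real n ^ 3" by simp
    have ex: "exp (- 7 * ln (real n)) = 1 / real n ^ 7"
    proof -
      have "exp (7 * ln (real n)) = real n ^ 7" using n0 exp_of_nat_mult[of 7 "ln (real n)"] by simp
      then show ?thesis by (simp add: exp_minus inverse_eq_divide)
    qed
    have "measure_pmf.prob ?P ?F \<le> real (card (stats n)) * 2 * real (m + 1) * exp (- 7 * ln (real n))"
      unfolding triangle_packing_process_def by (rule failure_bound[OF sc])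
    also have "\<dots> \<le> (7 * real n ^ 3) * 2 * (real n)\<^sup>2 * (1 / real n ^ 7)"
      unfolding ex using cs m1 by (intro mult_mono) auto
    also have "\<dots> = 14 / (real n)\<^sup>2" using n0 by (simp add: field_simps flip: power_add)
    finally have F: "measure_pmf.prob ?P ?F \<le> 14 / (real n)\<^sup>2" .
    have fin: "finite (pairs {1..n})"
      using packing_graph.finite_E[OF packing_graph_complete] .
    \<comment> \<open>The edge count is known only for trajectories of positive probability, hence
      the restriction to the support.\<close>
    have sub: "Gs \<in> ?T" if Gs: "Gs \<in> set_pmf ?P" "Gs \<notin> ?F" for Gs
    proof (intro CollectI allI impI)
      fix i assume "pstar 12 n \<le> dens n i"
      then have im: "i \<le> m" using Jm by (simp add: J_def)
      then have i: "i < length Gs"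
        "\<forall>\<kappa>\<in>stats n. \<bar>stat_val n (dens n i) (Gs ! i) \<kappa>\<bar> \<le> bnd \<kappa> * env n (dens n i) \<kappa>"
        using Gs(2) by auto
      have tr: "Gs ! i \<subseteq> pairs {1..n}" "card (Gs ! i) + 3 * i = card (pairs {1..n})"
        using greedy_process_trajectory[OF fin _ i(1)] Gs(1) by (auto simp: triangle_packing_process_def)
      have "2 * real (card (Gs ! i)) = 2 * real (card (pairs {1..n})) - 6 * real i"
        using tr(2) by linarith
      also have "\<dots> = (real n)\<^sup>2 * dens n i - real n"
        using n0 card_pairs_complete[of n] by (simp add: dens_def right_diff_distrib)
      finally have "good_state n (dens n i) (ln (real n)) (Gs ! i)"
        using sc[OF im] tr(1) i(2) by (intro good_state_of_stats)
      then have "estimates 12 20 2 3 n (dens n i) (Gs ! i)" by (rule good_state.estimates_hold) simp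
      then show "i < length Gs \<and> estimates 12 20 2 3 n (dens n i) (Gs ! i)" using i(1) by simp
    qed
    have "measure_pmf.prob ?P (UNIV - ?F) \<le> measure_pmf.prob ?P ?T"
      using sub by (intro measure_pmf.finite_measure_mono_AE) (auto simp: AE_measure_pmf_iff)
    moreover have "measure_pmf.prob ?P (UNIV - ?F) = 1 - measure_pmf.prob ?P ?F"
      using measure_pmf.prob_compl[of ?F ?P] by simp
    ultimately show ?thesis using F by linarith
  qed
qed

theorem theorem2p1:
  shows "\<exists>\<alpha> \<beta> \<kappa> \<mu> :: real. \<alpha> > 0 \<and> \<beta> > 0 \<and> \<kappa> > 0 \<and> \<mu> > 0 \<and>
    (\<lambda>n. measure_pmf.prob (triangle_packing_process n)
       {Gs. \<forall>i. dens n i \<ge> pstar \<alpha> n \<longrightarrow>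
          i < length Gs \<and> estimates \<alpha> \<beta> \<kappa> \<mu> n (dens n i) (Gs ! i)})
      \<longlonglongrightarrow> 1"
proof -
  \<comment> \<open>The witnesses are the constants of \<open>estimates_hold\<close>; 12 also enters
    \<open>pstar\<close>.\<close>
  let ?p = "\<lambda>n. measure_pmf.prob (triangle_packing_process n)
       {Gs. \<forall>i. dens n i \<ge> pstar 12 n \<longrightarrow>
          i < length Gs \<and> estimates 12 20 2 3 n (dens n i) (Gs ! i)}"
  have "filterlim (\<lambda>n. ln (real n)) at_top sequentially"
    by (rule filterlim_compose[OF ln_at_top filterlim_real_sequentially])
  then have "eventually (\<lambda>n. 10^6 \<le> ln (real n)) sequentially"
    by (simp add: filterlim_at_top)
  then have low: "eventually (\<lambda>n. 1 - 14 / (real n)\<^sup>2 \<le> ?p n) sequentially"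
    by eventually_elim (rule success_probability)
  have "(\<lambda>n. 14 / (real n)\<^sup>2) \<longlonglongrightarrow> 0"
    by (intro tendsto_divide_0[OF tendsto_const] filterlim_at_top_imp_at_infinity
        filterlim_pow_at_top filterlim_real_sequentially) simp
  then have "(\<lambda>n. 1 - 14 / (real n)\<^sup>2) \<longlonglongrightarrow> 1 - 0" by (intro tendsto_diff tendsto_const)
  then have lim: "(\<lambda>n. 1 - 14 / (real n)\<^sup>2) \<longlonglongrightarrow> 1" by simp
  have "?p \<longlonglongrightarrow> 1"
    by (rule tendsto_sandwich[OF low _ lim tendsto_const]) simp
  then have "(12::real) > 0 \<and> (20::real) > 0 \<and> (2::real) > 0 \<and> (3::real) > 0 \<and> ?p \<longlonglongrightarrow> 1" by simp
  then show ?thesis by blast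
qed

end
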